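(* Let $\mathbb{F}$ be a field. Let $A$ be a Frobenius graded superalgebra over $\mathbb{F}$ of degree $(-\lambda_A,\pi_A)$ with trace map $\mathrm{tr}_A$ and Nakayama automorphism $\psi_A$, and let $B$ be a graded subalgebra of $A$ that is itself a Frobenius graded superalgebra of degree $(-\lambda_B,\pi_B)$ with trace map $\mathrm{tr}_B$ and Nakayama automorphism $\psi_B$. If $A$ is projective as a left $B$-module, then $A$ is a $(\psi_A,\psi_B)$-Frobenius extension of $B$ of degree $(\lambda_B-\lambda_A,\pi_B+\pi_A)$. In particular, the induction functor ${}_AA_B\otimes_B-\colon B\text{-mod}\to A\text{-mod}$ is right adjoint to the twisted restriction functor $\{\lambda_B-\lambda_A,\pi_B+\pi_A\}\,{}^{\psi_B}_{B}A^{\psi_A}_{A}\otimes_A-\colon A\text{-mod}\to B\text{-mod}$.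
   Context: Fix an abelian group $\Lambda$. A graded superring is an associative unital $\Lambda\times\mathbb{Z}_2$-graded ring; subrings are graded (with the same unit), automorphisms preserve the grading, and modules and bimodules are $\Lambda\times\mathbb{Z}_2$-graded. For homogeneous $v$, $|v|\in\Lambda$ and $\bar v\in\mathbb{Z}_2$ denote its degrees; formulas involving degrees are stated for homogeneous elements and extended additively. Homomorphisms of modules and bimodules are additive maps of degree $(0,0)$ commuting strictly with the actions. $R\text{-mod}$ is the category of left $R$-modules with these morphisms. A graded superalgebra over $\mathbb{F}$ is an $\mathbb{F}$-algebra that is a graded superring with homogeneous components $\mathbb{F}$-subspaces ($\mathbb{F}$ itself sits in degree $(0,0)$). A finite-dimensional graded superalgebra $A$ is a Frobenius graded superalgebra of degree $(-\lambda_A,\pi_A)$ with trace map $\mathrm{tr}_A$ if $\mathrm{tr}_A\colon A\to\mathbb{F}$ is an $\mathbb{F}$-linear map, homogeneous of degree $(-\lambda_A,\pi_A)$, whose kernel contains no nonzero left ideals of $A$. Its Nakayama automorphism is the algebra automorphism $\psi_A$ of $A$ with $\mathrm{tr}_A(a_1a_2)=(-1)^{\bar a_1\bar a_2}\mathrm{tr}_A(a_2\psi_A(a_1))$ for all $a_1,a_2\in A$. Shifts: $\{\mu,\gamma\}M$ is $M$ as an abelian group, with $(\{\mu,\gamma\}M)_{\nu,\delta}=M_{\nu-\mu,\delta+\gamma}$, unchanged right action, and left action $a\cdot\{\mu,\gamma\}m=(-1)^{\gamma\bar a}\{\mu,\gamma\}(am)$. Let $\alpha,\beta$ be automorphisms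 of $A$ and $B$. ${}^{\beta}_{B}A^{\alpha}_{A}$ is $A$ as a graded abelian group with $b\cdot x=\beta(b)x$ and $x\cdot a=x\alpha(a)$. $\mathrm{HOM}^{\mathrm L}_B({}^{\beta}_{B}A^{\alpha}_{A},\{\lambda,\pi\}{}_BB_B)$ is the direct sum over $(\mu,\gamma)\in\Lambda\times\mathbb{Z}_2$ of the groups of additive maps $f\colon A\to\{\lambda,\pi\}B$ of degree $(\mu,\gamma)$ with $f(\beta(b)x)=(-1)^{\gamma\bar b}\,b\cdot f(x)$ (action in $\{\lambda,\pi\}B$). It is an $(A,B)$-bimodule via $(a\cdot f)(x)=(-1)^{\bar a\bar f+\bar a\bar x}f(x\alpha(a))$ and $(f\cdot b)(x)=(-1)^{\bar b\bar x}f(x)b$. $A$ is an $(\alpha,\beta)$-Frobenius extension of $B$ of degree $(-\lambda,\pi)$ if (L1) $A$ is finitely generated and projective as a left $B$-module, and (L2) ${}_AA_B\cong\mathrm{HOM}^{\mathrm L}_B({}^{\beta}_{B}A^{\alpha}_{A},\{\lambda,\pi\}{}_BB_B)$ as $(A,B)$-bimodules. *)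

theory Defs
  imports "HOL-Algebra.Algebra" "HOL-Library.Z2" "HOL-Library.Product_Plus"
begin

text \<open>
  Degrees are elements of \<open>'l \<times> bit\<close>, where the type \<open>'l\<close> is the abelian group \<open>\<Lambda>\<close> and
  \<open>bit\<close> is \<open>\<int>\<^sub>2\<close>. One record serves for rings, algebras and modules; for a module over
  a noncommutative ring the fields \<open>mult\<close> and \<open>one\<close> inherited from \<open>ring\<close> are ignored, and for a
  superring the field \<open>smult\<close> is ignored.
\<close>

record ('l, 'r, 'm) gmodule = "('r, 'm) module" +
  gr :: "'l \<times> bit \<Rightarrow> 'm set"

record ('l, 'r, 'm, 's) gbimodule = "('l, 'r, 'm) gmodule" +
  rsmult :: "'m \<Rightarrow> 's \<Rightarrow> 'm"

definition homogeneous_decomposition ::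
    "('l, 'r, 'm, 'e) gmodule_scheme \<Rightarrow> 'm \<Rightarrow> ('l \<times> bit \<Rightarrow> 'm) \<Rightarrow> bool" where
  "homogeneous_decomposition M x f \<longleftrightarrow>
     (\<forall>d. f d \<in> gr M d) \<and> finite {d. f d \<noteq> \<zero>\<^bsub>M\<^esub>} \<and> x = finsum M f {d. f d \<noteq> \<zero>\<^bsub>M\<^esub>}"

definition grading :: "('l, 'r, 'm, 'e) gmodule_scheme \<Rightarrow> bool" where
  "grading M \<longleftrightarrow> (\<forall>d. additive_subgroup (gr M d) M) \<and>
     (\<forall>x\<in>carrier M. \<exists>!f. homogeneous_decomposition M x f)"

definition hcomp :: "('l, 'r, 'm, 'e) gmodule_scheme \<Rightarrow> 'm \<Rightarrow> 'l \<times> bit \<Rightarrow> 'm" where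
  "hcomp M x = (THE f. homogeneous_decomposition M x f)"

definition hsupp :: "('l, 'r, 'm, 'e) gmodule_scheme \<Rightarrow> 'm \<Rightarrow> ('l \<times> bit) set" where
  "hsupp M x = {d. hcomp M x d \<noteq> \<zero>\<^bsub>M\<^esub>}"

text \<open>\<open>sgn_mult M p x\<close> is \<open>(-1)^p x\<close>.\<close>

definition sgn_mult :: "('m, 'e) ring_scheme \<Rightarrow> bit \<Rightarrow> 'm \<Rightarrow> 'm" where
  "sgn_mult M p x = (if p = 1 then \<ominus>\<^bsub>M\<^esub> x else x)"

definition graded_superring :: "('l::ab_group_add, 'r, 'a, 'e) gmodule_scheme \<Rightarrow> bool" where
  "graded_superring R \<longleftrightarrow> ring R \<and> grading R \<and>
     (\<forall>d e. \<forall>x\<in>gr R d. \<forall>y\<in>gr R e. x \<otimes>\<^bsub>R\<^esub> y \<in> gr R (d + e))"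

definition graded_left_module ::
    "('l::ab_group_add, 'q, 'r, 'e) gmodule_scheme \<Rightarrow> ('l, 'r, 'm, 'f) gmodule_scheme \<Rightarrow> bool" where
  "graded_left_module R M \<longleftrightarrow> abelian_group M \<and> grading M \<and>
     (\<forall>r\<in>carrier R. \<forall>x\<in>carrier M. r \<odot>\<^bsub>M\<^esub> x \<in> carrier M) \<and>
     (\<forall>r\<in>carrier R. \<forall>s\<in>carrier R. \<forall>x\<in>carrier M.
        (r \<oplus>\<^bsub>R\<^esub> s) \<odot>\<^bsub>M\<^esub> x = r \<odot>\<^bsub>M\<^esub> x \<oplus>\<^bsub>M\<^esub> s \<odot>\<^bsub>M\<^esub> x) \<and>
     (\<forall>r\<in>carrier R. \<forall>x\<in>carrier M. \<forall>y\<in>carrier M.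
        r \<odot>\<^bsub>M\<^esub> (x \<oplus>\<^bsub>M\<^esub> y) = r \<odot>\<^bsub>M\<^esub> x \<oplus>\<^bsub>M\<^esub> r \<odot>\<^bsub>M\<^esub> y) \<and>
     (\<forall>r\<in>carrier R. \<forall>s\<in>carrier R. \<forall>x\<in>carrier M.
        (r \<otimes>\<^bsub>R\<^esub> s) \<odot>\<^bsub>M\<^esub> x = r \<odot>\<^bsub>M\<^esub> (s \<odot>\<^bsub>M\<^esub> x)) \<and>
     (\<forall>x\<in>carrier M. \<one>\<^bsub>R\<^esub> \<odot>\<^bsub>M\<^esub> x = x) \<and>
     (\<forall>d e. \<forall>r\<in>gr R d. \<forall>x\<in>gr M e. r \<odot>\<^bsub>M\<^esub> x \<in> gr M (d + e))"

text \<open>Morphisms are extensional, so that equal morphisms are equal as HOL functions.\<close>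

definition mod_hom ::
    "('r, 'e) ring_scheme \<Rightarrow> ('l, 'r, 'm, 'f) gmodule_scheme \<Rightarrow> ('l, 'r, 'n, 'g) gmodule_scheme
      \<Rightarrow> ('m \<Rightarrow> 'n) set" where
  "mod_hom R M N = {f \<in> carrier M \<rightarrow>\<^sub>E carrier N.
     (\<forall>x\<in>carrier M. \<forall>y\<in>carrier M. f (x \<oplus>\<^bsub>M\<^esub> y) = f x \<oplus>\<^bsub>N\<^esub> f y) \<and>
     (\<forall>d. \<forall>x\<in>gr M d. f x \<in> gr N d) \<and>
     (\<forall>r\<in>carrier R. \<forall>x\<in>carrier M. f (r \<odot>\<^bsub>M\<^esub> x) = r \<odot>\<^bsub>N\<^esub> f x)}"

definition bimodule_isomorphic ::
    "('r, 'e) ring_scheme \<Rightarrow> ('s, 'e') ring_scheme \<Rightarrow> ('l, 'r, 'm, 's, 'f) gbimodule_scheme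
      \<Rightarrow> ('l, 'r, 'n, 's, 'g) gbimodule_scheme \<Rightarrow> bool" where
  "bimodule_isomorphic R S M N \<longleftrightarrow>
     (\<exists>f \<in> mod_hom R M N. bij_betw f (carrier M) (carrier N) \<and>
        (\<forall>x\<in>carrier M. \<forall>s\<in>carrier S. f (rsmult M x s) = rsmult N (f x) s))"

definition finitely_generated ::
    "('r, 'e) ring_scheme \<Rightarrow> ('r, 'm, 'f) module_scheme \<Rightarrow> bool" where
  "finitely_generated R M \<longleftrightarrow>
     (\<exists>S. finite S \<and> S \<subseteq> carrier M \<and>
        (\<forall>x\<in>carrier M. \<exists>c. c \<in> S \<rightarrow> carrier R \<and> x = (\<Oplus>\<^bsub>M\<^esub>s\<in>S. c s \<odot>\<^bsub>M\<^esub> s)))"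

text \<open>
  The lifting property of projective objects of \<open>R\<close>-mod. A HOL definition cannot quantify over the
  carrier types of the modules tested. The two types used here are enough for lifting against
  surjections of modules over arbitrary types: the free graded module on the nonzero homogeneous
  elements of \<open>M\<close> (finitely supported functions \<open>'m \<Rightarrow> 'r\<close>) and its canonical surjection onto
  \<open>M\<close> are among the test data, so \<open>M\<close> is a direct summand of a free graded module.
\<close>

definition projective ::
    "('l::ab_group_add, 'q, 'r, 'e) gmodule_scheme \<Rightarrow> ('l, 'r, 'm, 'f) gmodule_scheme \<Rightarrow> bool" where
  "projective R M \<longleftrightarrow> graded_left_module R M \<and>
     (\<forall>(P :: ('l, 'r, 'm \<Rightarrow> 'r) gmodule) (Q :: ('l, 'r, 'm) gmodule).
        \<forall>p\<in>mod_hom R P Q. \<forall>f\<in>mod_hom R M Q.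
          graded_left_module R P \<and> graded_left_module R Q \<and> p ` carrier P = carrier Q \<longrightarrow>
          (\<exists>h\<in>mod_hom R M P. compose (carrier M) p h = f))"

definition sub_structure ::
    "('l, 'r, 'a) gmodule \<Rightarrow> 'a set \<Rightarrow> ('l, 'r, 'a) gmodule" where
  "sub_structure A B = A\<lparr>carrier := B, gr := (\<lambda>d. gr A d \<inter> B)\<rparr>"

definition graded_subring :: "'a set \<Rightarrow> ('l::ab_group_add, 'r, 'a) gmodule \<Rightarrow> bool" where
  "graded_subring B A \<longleftrightarrow> subring B A \<and> grading (sub_structure A B)"

definition graded_automorphism ::
    "('l, 'r, 'a, 'e) gmodule_scheme \<Rightarrow> ('a \<Rightarrow> 'a) \<Rightarrow> bool" where
  "graded_automorphism A \<alpha> \<longleftrightarrow> \<alpha> \<in> ring_iso A A \<and> (\<forall>d. \<forall>x\<in>gr A d. \<alpha> x \<in> gr A d)"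

definition graded_superalgebra ::
    "('k, 'e) ring_scheme \<Rightarrow> ('l::ab_group_add, 'k, 'a, 'f) gmodule_scheme \<Rightarrow> bool" where
  "graded_superalgebra F A \<longleftrightarrow> graded_superring A \<and> module F A \<and>
     (\<forall>c\<in>carrier F. \<forall>x\<in>carrier A. \<forall>y\<in>carrier A.
        (c \<odot>\<^bsub>A\<^esub> x) \<otimes>\<^bsub>A\<^esub> y = c \<odot>\<^bsub>A\<^esub> (x \<otimes>\<^bsub>A\<^esub> y) \<and>
        x \<otimes>\<^bsub>A\<^esub> (c \<odot>\<^bsub>A\<^esub> y) = c \<odot>\<^bsub>A\<^esub> (x \<otimes>\<^bsub>A\<^esub> y)) \<and>
     (\<forall>d. \<forall>c\<in>carrier F. \<forall>x\<in>gr A d. c \<odot>\<^bsub>A\<^esub> x \<in> gr A d)"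

definition graded_subalgebra ::
    "('k, 'e) ring_scheme \<Rightarrow> 'a set \<Rightarrow> ('l::ab_group_add, 'k, 'a) gmodule \<Rightarrow> bool" where
  "graded_subalgebra F B A \<longleftrightarrow> graded_subring B A \<and>
     (\<forall>c\<in>carrier F. \<forall>x\<in>B. c \<odot>\<^bsub>A\<^esub> x \<in> B)"

definition left_ideal :: "'a set \<Rightarrow> ('a, 'e) ring_scheme \<Rightarrow> bool" where
  "left_ideal I R \<longleftrightarrow> additive_subgroup I R \<and> (\<forall>r\<in>carrier R. \<forall>x\<in>I. r \<otimes>\<^bsub>R\<^esub> x \<in> I)"

text \<open>The degree \<open>\<delta>\<close> is the degree of the trace map itself, written \<open>(-\<lambda>, \<pi>)\<close> in the usual notation.\<close>

definition frobenius_superalgebra ::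
    "('k, 'e) ring_scheme \<Rightarrow> ('l::ab_group_add, 'k, 'a, 'f) gmodule_scheme \<Rightarrow> 'l \<times> bit
      \<Rightarrow> ('a \<Rightarrow> 'k) \<Rightarrow> bool" where
  "frobenius_superalgebra F A \<delta> tr \<longleftrightarrow> graded_superalgebra F A \<and> finitely_generated F A \<and>
     tr \<in> carrier A \<rightarrow> carrier F \<and>
     (\<forall>x\<in>carrier A. \<forall>y\<in>carrier A. tr (x \<oplus>\<^bsub>A\<^esub> y) = tr x \<oplus>\<^bsub>F\<^esub> tr y) \<and>
     (\<forall>c\<in>carrier F. \<forall>x\<in>carrier A. tr (c \<odot>\<^bsub>A\<^esub> x) = c \<otimes>\<^bsub>F\<^esub> tr x) \<and>
     (\<forall>d. \<forall>x\<in>gr A d. tr x \<in> (if d + \<delta> = 0 then carrier F else {\<zero>\<^bsub>F\<^esub>})) \<and>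
     (\<forall>I. left_ideal I A \<and> I \<subseteq> {x \<in> carrier A. tr x = \<zero>\<^bsub>F\<^esub>} \<longrightarrow> I = {\<zero>\<^bsub>A\<^esub>})"

definition nakayama_automorphism ::
    "('k, 'e) ring_scheme \<Rightarrow> ('l::ab_group_add, 'k, 'a, 'f) gmodule_scheme \<Rightarrow> ('a \<Rightarrow> 'k)
      \<Rightarrow> ('a \<Rightarrow> 'a) \<Rightarrow> bool" where
  "nakayama_automorphism F A tr \<psi> \<longleftrightarrow> graded_automorphism A \<psi> \<and>
     (\<forall>c\<in>carrier F. \<forall>x\<in>carrier A. \<psi> (c \<odot>\<^bsub>A\<^esub> x) = c \<odot>\<^bsub>A\<^esub> \<psi> x) \<and>
     (\<forall>d e. \<forall>x\<in>gr A d. \<forall>y\<in>gr A e.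
        tr (x \<otimes>\<^bsub>A\<^esub> y) = sgn_mult F (snd d * snd e) (tr (y \<otimes>\<^bsub>A\<^esub> \<psi> x)))"

text \<open>\<open>shift R (\<mu>, \<gamma>) M\<close> is \<open>{\<mu>, \<gamma>}M\<close> for an \<open>R\<close>-left (bi)module \<open>M\<close>.\<close>

definition shift ::
    "('l::ab_group_add, 'q, 'r, 'e) gmodule_scheme \<Rightarrow> 'l \<times> bit
      \<Rightarrow> ('l, 'r, 'm, 's) gbimodule \<Rightarrow> ('l, 'r, 'm, 's) gbimodule" where
  "shift R \<delta> M = M\<lparr>
     smult := (\<lambda>r x. \<Oplus>\<^bsub>M\<^esub>d\<in>hsupp R r. sgn_mult M (snd \<delta> * snd d) (hcomp R r d \<odot>\<^bsub>M\<^esub> x)),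
     gr := (\<lambda>(\<nu>, \<epsilon>). gr M (\<nu> - fst \<delta>, \<epsilon> + snd \<delta>))\<rparr>"

text \<open>\<open>twisted_bimodule A \<beta> \<alpha>\<close> is \<open>A\<close> with left action through \<open>\<beta>\<close> and right action through \<open>\<alpha>\<close>.
  The acting rings (\<open>A\<close> or subrings of \<open>A\<close>) are determined by the context of use.\<close>

definition twisted_bimodule ::
    "('l, 'r, 'a) gmodule \<Rightarrow> ('a \<Rightarrow> 'a) \<Rightarrow> ('a \<Rightarrow> 'a) \<Rightarrow> ('l, 'a, 'a, 'a) gbimodule" where
  "twisted_bimodule A \<beta> \<alpha> =
     \<lparr>carrier = carrier A, monoid.mult = monoid.mult A, one = one A, ring.zero = ring.zero A, ring.add = ring.add A,
      smult = (\<lambda>b x. \<beta> b \<otimes>\<^bsub>A\<^esub> x), gr = gr A, rsmult = (\<lambda>x a. x \<otimes>\<^bsub>A\<^esub> \<alpha> a)\<rparr>"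

abbreviation regular_bimodule :: "('l, 'r, 'a) gmodule \<Rightarrow> ('l, 'a, 'a, 'a) gbimodule" where
  "regular_bimodule A \<equiv> twisted_bimodule A (\<lambda>b. b) (\<lambda>a. a)"

definition HOML_gr ::
    "('l::ab_group_add, 'q, 'r, 'e) gmodule_scheme \<Rightarrow> ('l, 'r, 'm, 's) gbimodule
      \<Rightarrow> ('l, 'r, 'n, 't) gbimodule \<Rightarrow> 'l \<times> bit \<Rightarrow> ('m \<Rightarrow> 'n) set" where
  "HOML_gr R M N d = {f \<in> carrier M \<rightarrow>\<^sub>E carrier N.
     (\<forall>x\<in>carrier M. \<forall>y\<in>carrier M. f (x \<oplus>\<^bsub>M\<^esub> y) = f x \<oplus>\<^bsub>N\<^esub> f y) \<and>
     (\<forall>e. \<forall>x\<in>gr M e. f x \<in> gr N (e + d)) \<and>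
     (\<forall>e. \<forall>r\<in>gr R e. \<forall>x\<in>carrier M.
        f (r \<odot>\<^bsub>M\<^esub> x) = sgn_mult N (snd d * snd e) (r \<odot>\<^bsub>N\<^esub> f x))}"

text \<open>
  The direct sum of the groups \<open>HOML_gr R M N d\<close> is formed inside the additive maps, where the
  sum is direct. The actions are \<open>(s\<cdot>f)(x) = (-1)^(|s||f| + |s||x|) f(x\<cdot>s)\<close> and
  \<open>(f\<cdot>t)(x) = (-1)^(|t||x|) f(x)\<cdot>t\<close> (parities in the exponents) on homogeneous elements, extended
  additively in \<open>s\<close>, \<open>t\<close>, \<open>f\<close> and \<open>x\<close>.
\<close>

definition HOML_group ::
    "('l::ab_group_add, 'q, 'r, 'e) gmodule_scheme \<Rightarrow> ('l, 'r, 'm, 's) gbimodule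
      \<Rightarrow> ('l, 'r, 'n, 't) gbimodule \<Rightarrow> ('l, 's, 'm \<Rightarrow> 'n) gmodule" where
  "HOML_group R M N =
     \<lparr>carrier = {\<lambda>x\<in>carrier M. \<Oplus>\<^bsub>N\<^esub>d\<in>D. g d x | D g. finite D \<and> (\<forall>d\<in>D. g d \<in> HOML_gr R M N d)},
      monoid.mult = undefined, one = undefined,
      ring.zero = (\<lambda>x\<in>carrier M. \<zero>\<^bsub>N\<^esub>),
      ring.add = (\<lambda>f g. \<lambda>x\<in>carrier M. f x \<oplus>\<^bsub>N\<^esub> g x),
      smult = undefined,
      gr = HOML_gr R M N\<rparr>"

definition HOML ::
    "('l::ab_group_add, 'q, 'r, 'e) gmodule_scheme \<Rightarrow> ('l, 'q1, 's, 'e1) gmodule_scheme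
      \<Rightarrow> ('l, 'q2, 't, 'e2) gmodule_scheme \<Rightarrow> ('l, 'r, 'm, 's) gbimodule
      \<Rightarrow> ('l, 'r, 'n, 't) gbimodule \<Rightarrow> ('l, 's, 'm \<Rightarrow> 'n, 't) gbimodule" where
  "HOML R S T M N = (let H = HOML_group R M N in
     \<lparr>carrier = carrier H, monoid.mult = undefined, one = undefined, ring.zero = ring.zero H, ring.add = ring.add H,
      smult = (\<lambda>s f. \<lambda>x\<in>carrier M.
        \<Oplus>\<^bsub>N\<^esub>d\<in>hsupp S s. \<Oplus>\<^bsub>N\<^esub>e\<in>hsupp H f. \<Oplus>\<^bsub>N\<^esub>k\<in>hsupp M x.
          sgn_mult N (snd d * snd e + snd d * snd k)
            (hcomp H f e (rsmult M (hcomp M x k) (hcomp S s d)))),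
      gr = gr H,
      rsmult = (\<lambda>f t. \<lambda>x\<in>carrier M.
        \<Oplus>\<^bsub>N\<^esub>d\<in>hsupp T t. \<Oplus>\<^bsub>N\<^esub>k\<in>hsupp M x.
          sgn_mult N (snd d * snd k) (rsmult N (f (hcomp M x k)) (hcomp T t d)))\<rparr>)"

text \<open>
  \<open>frobenius_extension A B \<alpha> \<beta> \<delta>\<close>: \<open>A\<close> is an \<open>(\<alpha>, \<beta>)\<close>-Frobenius extension of \<open>B\<close> of degree
  \<open>\<delta> = (-\<lambda>, \<pi>)\<close>, so the shift in the target of \<open>HOML\<close> is by \<open>(- fst \<delta>, snd \<delta>)\<close>.
\<close>

definition frobenius_extension ::
    "('l::ab_group_add, 'r, 'a) gmodule \<Rightarrow> 'a set \<Rightarrow> ('a \<Rightarrow> 'a) \<Rightarrow> ('a \<Rightarrow> 'a) \<Rightarrow> 'l \<times> bit \<Rightarrow> bool" where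
  "frobenius_extension A B \<alpha> \<beta> \<delta> \<longleftrightarrow>
     (let B' = sub_structure A B in
       graded_superring A \<and> graded_subring B A \<and>
       graded_automorphism A \<alpha> \<and> graded_automorphism B' \<beta> \<and>
       finitely_generated B' (regular_bimodule A) \<and> projective B' (regular_bimodule A) \<and>
       bimodule_isomorphic A B' (regular_bimodule A)
         (HOML B' A B' (twisted_bimodule A \<beta> \<alpha>)
            (shift B' (- fst \<delta>, snd \<delta>) (regular_bimodule B'))))"

text \<open>
  \<open>M \<otimes>\<^sub>S N\<close> for a bimodule \<open>M\<close> with right action of \<open>S\<close> and a left \<open>S\<close>-module \<open>N\<close>: the quotient
  of the free abelian group on \<open>carrier M \<times> carrier N\<close> by the usual relations.
\<close>

abbreviation tensor_free ::
    "('l, 'r, 'm, 's) gbimodule \<Rightarrow> ('l, 's, 'n) gmodule \<Rightarrow> ('m \<times> 'n \<Rightarrow>\<^sub>0 int) monoid" where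
  "tensor_free M N \<equiv> free_Abelian_group (carrier M \<times> carrier N)"

definition tensor_relations ::
    "('s, 'e) ring_scheme \<Rightarrow> ('l, 'r, 'm, 's) gbimodule \<Rightarrow> ('l, 's, 'n) gmodule
      \<Rightarrow> ('m \<times> 'n \<Rightarrow>\<^sub>0 int) set" where
  "tensor_relations S M N = generate (tensor_free M N)
     ({frag_of (x \<oplus>\<^bsub>M\<^esub> x', y) - frag_of (x, y) - frag_of (x', y) | x x' y.
         x \<in> carrier M \<and> x' \<in> carrier M \<and> y \<in> carrier N} \<union>
      {frag_of (x, y \<oplus>\<^bsub>N\<^esub> y') - frag_of (x, y) - frag_of (x, y') | x y y'.
         x \<in> carrier M \<and> y \<in> carrier N \<and> y' \<in> carrier N} \<union>
      {frag_of (rsmult M x s, y) - frag_of (x, s \<odot>\<^bsub>N\<^esub> y) | x s y.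
         x \<in> carrier M \<and> s \<in> carrier S \<and> y \<in> carrier N})"

abbreviation tensor_group ::
    "('s, 'e) ring_scheme \<Rightarrow> ('l, 'r, 'm, 's) gbimodule \<Rightarrow> ('l, 's, 'n) gmodule
      \<Rightarrow> ('m \<times> 'n \<Rightarrow>\<^sub>0 int) set monoid" where
  "tensor_group S M N \<equiv> tensor_free M N Mod tensor_relations S M N"

definition pure_tensor ::
    "('s, 'e) ring_scheme \<Rightarrow> ('l, 'r, 'm, 's) gbimodule \<Rightarrow> ('l, 's, 'n) gmodule
      \<Rightarrow> 'm \<Rightarrow> 'n \<Rightarrow> ('m \<times> 'n \<Rightarrow>\<^sub>0 int) set" where
  "pure_tensor S M N x y = tensor_relations S M N #>\<^bsub>tensor_free M N\<^esub> frag_of (x, y)"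

text \<open>The map \<open>x \<otimes> y \<mapsto> g x \<otimes> h y\<close> into \<open>M \<otimes>\<^sub>S N\<close>, computed on coset representatives; the union is
  over equal cosets whenever the map is well defined.\<close>

definition tensor_induced ::
    "('s, 'e) ring_scheme \<Rightarrow> ('l, 'r, 'm, 's) gbimodule \<Rightarrow> ('l, 's, 'n) gmodule
      \<Rightarrow> ('m1 \<Rightarrow> 'm) \<Rightarrow> ('n1 \<Rightarrow> 'n) \<Rightarrow> ('m1 \<times> 'n1 \<Rightarrow>\<^sub>0 int) set \<Rightarrow> ('m \<times> 'n \<Rightarrow>\<^sub>0 int) set" where
  "tensor_induced S M N g h C =
     (\<Union>c\<in>C. tensor_relations S M N #>\<^bsub>tensor_free M N\<^esub>
        frag_extend (\<lambda>(x, y). frag_of (g x, h y)) c)"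

definition tensor ::
    "('s, 'e) ring_scheme \<Rightarrow> ('l::ab_group_add, 'r, 'm, 's) gbimodule \<Rightarrow> ('l, 's, 'n) gmodule
      \<Rightarrow> ('l, 'r, ('m \<times> 'n \<Rightarrow>\<^sub>0 int) set) gmodule" where
  "tensor S M N =
     \<lparr>carrier = carrier (tensor_group S M N), monoid.mult = undefined, one = undefined,
      ring.zero = \<one>\<^bsub>tensor_group S M N\<^esub>, ring.add = monoid.mult (tensor_group S M N),
      smult = (\<lambda>r. tensor_induced S M N (\<lambda>x. r \<odot>\<^bsub>M\<^esub> x) (\<lambda>y. y)),
      gr = (\<lambda>d. generate (tensor_group S M N)
              {pure_tensor S M N x y | x y. \<exists>e e'. d = e + e' \<and> x \<in> gr M e \<and> y \<in> gr N e'})\<rparr>"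

definition tensor_map ::
    "('s, 'e) ring_scheme \<Rightarrow> ('l::ab_group_add, 'r, 'm, 's) gbimodule
      \<Rightarrow> ('l, 's, 'n) gmodule \<Rightarrow> ('l, 's, 'n) gmodule \<Rightarrow> ('n \<Rightarrow> 'n)
      \<Rightarrow> ('m \<times> 'n \<Rightarrow>\<^sub>0 int) set \<Rightarrow> ('m \<times> 'n \<Rightarrow>\<^sub>0 int) set" where
  "tensor_map S M N N' h =
     (\<lambda>C\<in>carrier (tensor S M N). tensor_induced S M N' (\<lambda>x. x) h C)"

text \<open>
  \<open>R\<close>-mod over a type \<open>'n\<close> has as objects the graded left \<open>R\<close>-modules with carrier in \<open>'n\<close>, and
  as morphisms \<open>mod_hom\<close>. A functor is given by its object part and, for each source and target,
  its morphism part; the carrier type of the values may differ from that of the arguments.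
\<close>

definition module_functor ::
    "('l::ab_group_add, 'q1, 'r, 'e1) gmodule_scheme \<Rightarrow> ('l, 'q2, 's, 'e2) gmodule_scheme
      \<Rightarrow> (('l, 'r, 'n) gmodule \<Rightarrow> ('l, 's, 'n1) gmodule)
      \<Rightarrow> (('l, 'r, 'n) gmodule \<Rightarrow> ('l, 'r, 'n) gmodule \<Rightarrow> ('n \<Rightarrow> 'n) \<Rightarrow> ('n1 \<Rightarrow> 'n1)) \<Rightarrow> bool" where
  "module_functor R S Fo Fm \<longleftrightarrow>
     (\<forall>N. graded_left_module R N \<longrightarrow> graded_left_module S (Fo N)) \<and>
     (\<forall>N N'. graded_left_module R N \<and> graded_left_module R N' \<longrightarrow>
        (\<forall>f\<in>mod_hom R N N'. Fm N N' f \<in> mod_hom S (Fo N) (Fo N'))) \<and>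
     (\<forall>N. graded_left_module R N \<longrightarrow>
        Fm N N (\<lambda>x\<in>carrier N. x) = (\<lambda>x\<in>carrier (Fo N). x)) \<and>
     (\<forall>N N' N''. graded_left_module R N \<and> graded_left_module R N' \<and> graded_left_module R N'' \<longrightarrow>
        (\<forall>f\<in>mod_hom R N N'. \<forall>g\<in>mod_hom R N' N''.
           Fm N N'' (compose (carrier N) g f) =
             compose (carrier (Fo N)) (Fm N' N'' g) (Fm N N' f)))"

text \<open>\<open>adjoint_functors R S Fo Fm Go Gm\<close>: the functor \<open>F\<close> from \<open>R\<close>-mod to \<open>S\<close>-mod is left adjoint
  to the functor \<open>G\<close> from \<open>S\<close>-mod to \<open>R\<close>-mod (equivalently, \<open>G\<close> is right adjoint to \<open>F\<close>).\<close>

definition adjoint_functors ::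
    "('l::ab_group_add, 'q1, 'r, 'e1) gmodule_scheme \<Rightarrow> ('l, 'q2, 's, 'e2) gmodule_scheme
      \<Rightarrow> (('l, 'r, 'n) gmodule \<Rightarrow> ('l, 's, 'n1) gmodule)
      \<Rightarrow> (('l, 'r, 'n) gmodule \<Rightarrow> ('l, 'r, 'n) gmodule \<Rightarrow> ('n \<Rightarrow> 'n) \<Rightarrow> ('n1 \<Rightarrow> 'n1))
      \<Rightarrow> (('l, 's, 'm) gmodule \<Rightarrow> ('l, 'r, 'm1) gmodule)
      \<Rightarrow> (('l, 's, 'm) gmodule \<Rightarrow> ('l, 's, 'm) gmodule \<Rightarrow> ('m \<Rightarrow> 'm) \<Rightarrow> ('m1 \<Rightarrow> 'm1)) \<Rightarrow> bool" where
  "adjoint_functors R S Fo Fm Go Gm \<longleftrightarrow>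
     module_functor R S Fo Fm \<and> module_functor S R Go Gm \<and>
     (\<exists>\<Phi>.
       (\<forall>N M. graded_left_module R N \<and> graded_left_module S M \<longrightarrow>
          bij_betw (\<Phi> N M) (mod_hom S (Fo N) M) (mod_hom R N (Go M))) \<and>
       (\<forall>N N' M M'. graded_left_module R N \<and> graded_left_module R N' \<and>
           graded_left_module S M \<and> graded_left_module S M' \<longrightarrow>
          (\<forall>v\<in>mod_hom R N' N. \<forall>h\<in>mod_hom S (Fo N) M. \<forall>u\<in>mod_hom S M M'.
             \<Phi> N' M' (compose (carrier (Fo N')) u (compose (carrier (Fo N')) h (Fm N' N v))) =
               compose (carrier N') (Gm M M' u) (compose (carrier N') (\<Phi> N M h) v))))"

end

theory Submission
  imports Defs
begin

text \<open>
  As the kernel of \<open>tr\<^sub>B\<close> contains no nonzero left ideal, every linear form on \<open>B\<close> is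
  \<open>b \<mapsto> tr\<^sub>B (b y)\<close> for a unique \<open>y\<close>, so there is a unique \<open>E : A \<rightarrow> B\<close> with
  \<open>tr\<^sub>B (b E(x)) = tr\<^sub>A (\<rho>(b) x)\<close>, where \<open>\<rho>(b) = (-1)^((\<pi>\<^sub>A + \<pi>\<^sub>B) |b|) \<psi>\<^sub>B(b)\<close>. It satisfies
  \<open>E(\<rho>(b) x) = b E(x)\<close> and \<open>E(x \<psi>\<^sub>A(b)) = E(x) b\<close>. The bimodule isomorphism is \<open>a \<mapsto> a \<cdot> E\<close>: it is
  injective since \<open>tr\<^sub>B ((a \<cdot> E)(x)) = tr\<^sub>A (a x)\<close>, and surjective since \<open>tr\<^sub>B \<circ> f\<close> is a linear form
  on \<open>A\<close> for every \<open>f\<close> in the target.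

  Coordinate forms of a finite graded dual basis of the projective module \<open>A\<close> are represented by
  \<open>E\<close> as well, which gives homogeneous \<open>v, y\<^sub>v\<close> with \<open>x = \<Sum>\<^sub>v \<rho>(E(x \<psi>\<^sub>A(y\<^sub>v))) v\<close> and
  \<open>a = \<Sum>\<^sub>v y\<^sub>v E(v \<psi>\<^sub>A(a))\<close>. These are the triangle identities for the unit
  \<open>n \<mapsto> \<Sum>\<^sub>v y\<^sub>v \<otimes> (v \<otimes> n)\<close> and the counit \<open>x \<otimes> (a \<otimes> m) \<mapsto> E(x \<psi>\<^sub>A(a)) m\<close>.
\<close>

text \<open>The formulas with degrees are stated for homogeneous elements and extended additively
  through \<open>hcomp\<close>. Identities are therefore reduced to homogeneous arguments by
  observing that both sides are additive in each variable; this is why bare additive maps run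
  through the whole development.

  The degree of \<open>E\<close> is forced by \<open>tr\<^sub>B (E x) = tr\<^sub>A x\<close>: it is
  the difference of the degrees of the traces, so its parity is
  \<open>p\<^sub>B + p\<^sub>A\<close>. The right-hand rule for \<open>E\<close> is the delicate
  one. An element \<open>b\<close> can be moved past \<open>x\<close> only by cycling it around the
  trace of \<open>A\<close> and then around that of \<open>B\<close>, each turn costing a Nakayama
  automorphism and a sign. The signs agree except for the parity of \<open>E\<close>, and this
  discrepancy is what the sign in \<open>\<rho>\<close> absorbs.

  The adjunction is not routed through the description of \<open>A\<close> as a module of
  homomorphisms. In the pairing of \<open>x\<close> and \<open>a\<close> to
  \<open>E (x \<otimes> \<psi>\<^sub>A a)\<close> no sign occurs, so the conventions of
  \<open>HOML\<close> stay confined to the bimodule isomorphism.\<close>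

declare split_paired_All [simp del] split_paired_Ex [simp del]

section \<open>Additive maps and finite sums in abelian groups\<close>

lemma finsum_cong_struct:
  assumes "carrier N = carrier M" "ring.zero N = ring.zero M" "ring.add N = ring.add M"
  shows "finsum N f S = finsum M f S"
  using assms by (simp add: finsum_def finprod_def)

lemma a_inv_cong_struct:
  assumes "carrier N = carrier M" "ring.zero N = ring.zero M" "ring.add N = ring.add M"
  shows "a_inv N = a_inv M"
  using assms by (simp add: a_inv_def m_inv_def fun_eq_iff)

text \<open>Shifted and twisted bimodules keep the additive group of the module they come from and
  change only actions, grading or the ignored ring fields. The \<open>cong_struct\<close> lemmas
  carry sums, negatives and group axioms across such record changes.\<close>

lemma abelian_group_cong_struct:
  assumes "carrier N = carrier M" "ring.zero N = ring.zero M" "ring.add N = ring.add M" "abelian_group M"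
  shows "abelian_group N"
proof -
  interpret M: abelian_group M by fact
  show ?thesis
  proof (rule abelian_groupI, unfold assms(1-3))
    show "\<exists>y\<in>carrier M. y \<oplus>\<^bsub>M\<^esub> x = \<zero>\<^bsub>M\<^esub>" if "x \<in> carrier M" for x
      using that M.l_neg by (intro bexI[of _ "\<ominus>\<^bsub>M\<^esub> x"]) auto
  qed (simp_all add: M.a_ac)
qed

text \<open>Deliberately weaker than \<open>mod_hom\<close>: without extensionality or degree
  conditions, such maps compose as plain lambda terms, and each expression in a sign formula is seen
  to be additive by chaining \<open>addmap_comp\<close>.\<close>

definition addmap :: "('m, 'e) ring_scheme \<Rightarrow> ('n, 'f) ring_scheme \<Rightarrow> ('m \<Rightarrow> 'n) \<Rightarrow> bool" where
  "addmap M N f \<longleftrightarrow> f \<in> carrier M \<rightarrow> carrier N \<and>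
     (\<forall>x\<in>carrier M. \<forall>y\<in>carrier M. f (x \<oplus>\<^bsub>M\<^esub> y) = f x \<oplus>\<^bsub>N\<^esub> f y)"

lemma addmapI:
  assumes "\<And>x. x \<in> carrier M \<Longrightarrow> f x \<in> carrier N"
    and "\<And>x y. x \<in> carrier M \<Longrightarrow> y \<in> carrier M \<Longrightarrow> f (x \<oplus>\<^bsub>M\<^esub> y) = f x \<oplus>\<^bsub>N\<^esub> f y"
  shows "addmap M N f"
  using assms by (auto simp: addmap_def)

lemma addmap_closed: "addmap M N f \<Longrightarrow> x \<in> carrier M \<Longrightarrow> f x \<in> carrier N"
  by (auto simp: addmap_def)

lemma addmap_add:
  "addmap M N f \<Longrightarrow> x \<in> carrier M \<Longrightarrow> y \<in> carrier M \<Longrightarrow> f (x \<oplus>\<^bsub>M\<^esub> y) = f x \<oplus>\<^bsub>N\<^esub> f y"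
  by (auto simp: addmap_def)

lemma addmap_comp: "addmap M N f \<Longrightarrow> addmap N P g \<Longrightarrow> addmap M P (\<lambda>x. g (f x))"
  by (auto simp: addmap_def Pi_iff)

lemma addmap_cong:
  assumes "addmap M N f" "abelian_group M" "\<And>x. x \<in> carrier M \<Longrightarrow> g x = f x"
  shows "addmap M N g"
proof -
  interpret M: abelian_group M by fact
  show ?thesis using assms(1,3) by (auto intro!: addmapI simp: addmap_closed addmap_add)
qed

lemma addmap_id: "addmap M M (\<lambda>x. x)"
  by (auto simp: addmap_def)

lemma addmap_hom:
  assumes "addmap M N f" "abelian_group M" "abelian_group N"
  shows "group_hom (add_monoid M) (add_monoid N) f"
  using assms abelian_group.a_group[OF assms(2)] abelian_group.a_group[OF assms(3)]
  by (auto simp: group_hom_def group_hom_axioms_def hom_def addmap_def)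

lemma addmap_zero:
  assumes "addmap M N f" "abelian_group M" "abelian_group N"
  shows "f \<zero>\<^bsub>M\<^esub> = \<zero>\<^bsub>N\<^esub>"
  using group_hom.hom_one[OF addmap_hom[OF assms]] by simp

lemma addmap_neg:
  assumes "addmap M N f" "abelian_group M" "abelian_group N" "x \<in> carrier M"
  shows "f (\<ominus>\<^bsub>M\<^esub> x) = \<ominus>\<^bsub>N\<^esub> f x"
  using group_hom.hom_inv[OF addmap_hom[OF assms(1-3)]] assms(4) by (simp add: a_inv_def)

lemma addmap_minus:
  assumes "addmap M N f" "abelian_group M" "abelian_group N" "x \<in> carrier M" "y \<in> carrier M"
  shows "f (x \<ominus>\<^bsub>M\<^esub> y) = f x \<ominus>\<^bsub>N\<^esub> f y"
  using assms by (simp add: a_minus_def addmap_add addmap_neg abelian_group.a_inv_closed)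

lemma addmap_finsum:
  assumes "addmap M N f" "abelian_group M" "abelian_group N" "finite S" "g \<in> S \<rightarrow> carrier M"
  shows "f (finsum M g S) = finsum N (\<lambda>s. f (g s)) S"
proof -
  interpret M: abelian_group M by fact
  interpret N: abelian_group N by fact
  show ?thesis using assms(4,5)
  proof (induction S rule: finite_induct)
    case empty then show ?case using addmap_zero[OF assms(1-3)] by simp
  next
    case (insert s S)
    have "g s \<in> carrier M" "g \<in> S \<rightarrow> carrier M" using insert.prems by auto
    moreover from this have "f (g s) \<in> carrier N" "(\<lambda>s. f (g s)) \<in> S \<rightarrow> carrier N"
      using addmap_closed[OF assms(1)] by auto
    moreover have "f (finsum M g S) = finsum N (\<lambda>s. f (g s)) S" using insert.IH \<open>g \<in> S \<rightarrow> _\<close> by simp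
    ultimately show ?case
      using insert.hyps by (simp add: addmap_add[OF assms(1)])
  qed
qed

lemma addmap_sum:
  assumes "abelian_group M" "abelian_group N" "\<And>s. s \<in> S \<Longrightarrow> addmap M N (g s)"
  shows "addmap M N (\<lambda>x. finsum N (\<lambda>s. g s x) S)"
proof -
  interpret N: abelian_group N by fact
  show ?thesis
  proof (rule addmapI)
    fix x y assume xy: "x \<in> carrier M" "y \<in> carrier M"
    have cl: "g s z \<in> carrier N" if "s \<in> S" "z \<in> carrier M" for s z
      using addmap_closed[OF assms(3)[OF that(1)] that(2)] .
    have "finsum N (\<lambda>s. g s (x \<oplus>\<^bsub>M\<^esub> y)) S = finsum N (\<lambda>s. g s x \<oplus>\<^bsub>N\<^esub> g s y) S"
      using addmap_add[OF assms(3) xy] cl xy by (intro N.finsum_cong') auto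
    also have "\<dots> = finsum N (\<lambda>s. g s x) S \<oplus>\<^bsub>N\<^esub> finsum N (\<lambda>s. g s y) S"
      using cl xy by (intro N.finsum_addf) auto
    finally show "finsum N (\<lambda>s. g s (x \<oplus>\<^bsub>M\<^esub> y)) S = finsum N (\<lambda>s. g s x) S \<oplus>\<^bsub>N\<^esub> finsum N (\<lambda>s. g s y) S" .
  next
    fix x assume "x \<in> carrier M"
    then show "finsum N (\<lambda>s. g s x) S \<in> carrier N"
      using addmap_closed[OF assms(3)] by (auto intro!: N.finsum_closed)
  qed
qed

lemma finsum_delta:
  assumes "abelian_group M" "finite S" "s \<in> S" "x \<in> carrier M"
  shows "finsum M (\<lambda>t. if t = s then x else \<zero>\<^bsub>M\<^esub>) S = x"
  using abelian_monoid.finsum_singleton[OF abelian_group.axioms(1)[OF assms(1)] assms(3,2), of "\<lambda>_. x"] assms(4)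
  by (simp add: eq_commute)

lemma finsum_support:
  assumes "abelian_group M" "finite D" "C \<subseteq> D" "f \<in> D \<rightarrow> carrier M" "\<And>d. d \<in> D - C \<Longrightarrow> f d = \<zero>\<^bsub>M\<^esub>"
  shows "finsum M f D = finsum M f C"
proof -
  interpret M: abelian_group M by fact
  have "finsum M f (C \<union> (D - C)) = finsum M f C \<oplus>\<^bsub>M\<^esub> finsum M f (D - C)"
    using assms(2-4) finite_subset[OF assms(3,2)] by (intro M.finsum_Un_disjoint) auto
  moreover have "finsum M f (D - C) = \<zero>\<^bsub>M\<^esub>"
    using assms(5) by (intro M.add.finprod_one_eqI) auto
  moreover have "finsum M f C \<in> carrier M" using assms(3,4) by (intro M.finsum_closed) auto
  moreover have "C \<union> (D - C) = D" using assms by auto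
  ultimately show ?thesis by simp
qed

lemma finsum_swap:
  assumes "abelian_group M" "finite S" "finite T" "\<And>s t. s \<in> S \<Longrightarrow> t \<in> T \<Longrightarrow> f s t \<in> carrier M"
  shows "finsum M (\<lambda>s. finsum M (\<lambda>t. f s t) T) S = finsum M (\<lambda>t. finsum M (\<lambda>s. f s t) S) T"
proof -
  interpret M: abelian_group M by fact
  show ?thesis using assms(2,4)
  proof (induction S rule: finite_induct)
    case empty then show ?case by simp
  next
    case (insert s S)
    have "finsum M (\<lambda>t. finsum M (\<lambda>s. f s t) (insert s S)) T = finsum M (\<lambda>t. f s t \<oplus>\<^bsub>M\<^esub> finsum M (\<lambda>s. f s t) S) T"
      using insert by (intro M.finsum_cong') (auto intro!: M.finsum_closed M.finsum_insert)
    also have "\<dots> = finsum M (f s) T \<oplus>\<^bsub>M\<^esub> finsum M (\<lambda>t. finsum M (\<lambda>s. f s t) S) T"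
      using insert by (intro M.finsum_addf) (auto intro!: M.finsum_closed)
    moreover have "finsum M (\<lambda>s. finsum M (\<lambda>t. f s t) T) (insert s S)
        = finsum M (f s) T \<oplus>\<^bsub>M\<^esub> finsum M (\<lambda>s. finsum M (\<lambda>t. f s t) T) S"
      using insert by (intro M.finsum_insert) (auto intro!: M.finsum_closed)
    ultimately show ?case using insert by simp
  qed
qed

section \<open>Graded abelian groups\<close>

locale graded_group = abelian_group M
  for M :: "('l, 'r, 'm, 'e) gmodule_scheme" (structure) +
  assumes grading: "grading M"
begin

lemma gr_subgroup: "additive_subgroup (gr M d) M"
  using grading by (simp add: grading_def)

lemma gr_sub: "gr M d \<subseteq> carrier M"
  using additive_subgroup.a_subset[OF gr_subgroup] .

lemma gr_carrier: "x \<in> gr M d \<Longrightarrow> x \<in> carrier M"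
  using gr_sub[of d] by auto

lemma gr_add: "x \<in> gr M d \<Longrightarrow> y \<in> gr M d \<Longrightarrow> x \<oplus> y \<in> gr M d"
  using additive_subgroup.a_closed[OF gr_subgroup] .

lemma gr_zero: "\<zero> \<in> gr M d"
  using additive_subgroup.zero_closed[OF gr_subgroup] .

lemma gr_neg: "x \<in> gr M d \<Longrightarrow> \<ominus> x \<in> gr M d"
  using additive_subgroup.a_inv_closed[OF gr_subgroup]  abelian_group_axioms by blast

lemma gr_finsum: "finite S \<Longrightarrow> (\<And>s. s \<in> S \<Longrightarrow> f s \<in> gr M d) \<Longrightarrow> finsum M f S \<in> gr M d"
proof (induction S rule: finite_induct)
  case empty then show ?case by (simp add: gr_zero)
next
  case (insert s S)
  then have "finsum M f (insert s S) = f s \<oplus> finsum M f S"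
    by (intro finsum_insert) (auto intro: gr_carrier)
  then show ?case using insert by (auto intro: gr_add)
qed

lemma hcomp_decomposition: "x \<in> carrier M \<Longrightarrow> homogeneous_decomposition M x (hcomp M x)"
  unfolding hcomp_def using grading theI'[of "homogeneous_decomposition M x"] unfolding grading_def by blast

lemma hcomp_gr: "x \<in> carrier M \<Longrightarrow> hcomp M x d \<in> gr M d"
  using hcomp_decomposition[of x] by (simp add: homogeneous_decomposition_def)

lemma hcomp_closed: "x \<in> carrier M \<Longrightarrow> hcomp M x d \<in> carrier M"
  using hcomp_gr gr_carrier by blast

lemma finite_hsupp: "x \<in> carrier M \<Longrightarrow> finite (hsupp M x)"
  using hcomp_decomposition by (simp add: homogeneous_decomposition_def hsupp_def)

lemma hcomp_sum: "x \<in> carrier M \<Longrightarrow> x = finsum M (hcomp M x) (hsupp M x)"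
  using hcomp_decomposition by (simp add: homogeneous_decomposition_def hsupp_def)

lemma not_in_hsupp: "d \<notin> hsupp M x \<Longrightarrow> hcomp M x d = \<zero>"
  by (simp add: hsupp_def)

text \<open>Padding \<open>f\<close> by zero outside \<open>D\<close> yields a homogeneous
  decomposition, and these are unique. Degrees in \<open>D\<close> with a vanishing term are
  allowed, as they occur whenever sums are combined.\<close>

lemma hcomp_eqI:
  assumes "finite D" "\<And>d. d \<in> D \<Longrightarrow> f d \<in> gr M d" "x = finsum M f D"
  shows "hcomp M x d = (if d \<in> D then f d else \<zero>)"
proof -
  let ?f = "\<lambda>d. if d \<in> D then f d else \<zero>"
  have fc: "f \<in> D \<rightarrow> carrier M" using gr_carrier[OF assms(2)] by (rule Pi_I)
  have x: "x \<in> carrier M" using fc unfolding assms(3) by (rule finsum_closed)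
  have sub: "{d. ?f d \<noteq> \<zero>} \<subseteq> D" by auto
  have "finsum M f D = finsum M ?f D"
    using fc by (intro finsum_cong') auto
  also have "\<dots> = finsum M ?f {d. ?f d \<noteq> \<zero>}"
    using assms(1) sub fc by (intro finsum_support[OF abelian_group_axioms]) auto
  finally have "homogeneous_decomposition M x ?f"
    unfolding homogeneous_decomposition_def
    using assms(1,2) finite_subset[OF sub assms(1)] gr_zero \<open>finsum M f D = _\<close> assms(3) by auto
  then have "hcomp M x = ?f"
    using hcomp_decomposition[OF x] grading x unfolding grading_def by blast
  then show ?thesis by simp
qed

lemma hcomp_hom: "x \<in> gr M d \<Longrightarrow> hcomp M x e = (if e = d then x else \<zero>)"
  using hcomp_eqI[of "{d}" "\<lambda>_. x" x e] gr_carrier[of x d] by auto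

lemma hsupp_hom: "x \<in> gr M d \<Longrightarrow> hsupp M x = (if x = \<zero> then {} else {d})"
  by (auto simp: hsupp_def hcomp_hom)

lemma hcomp_add: "x \<in> carrier M \<Longrightarrow> y \<in> carrier M \<Longrightarrow> hcomp M (x \<oplus> y) d = hcomp M x d \<oplus> hcomp M y d"
proof -
  assume x: "x \<in> carrier M" and y: "y \<in> carrier M"
  let ?D = "hsupp M x \<union> hsupp M y"
  have f: "finite ?D" using x y finite_hsupp by auto
  have "x = finsum M (hcomp M x) ?D"
    using hcomp_sum[OF x] finsum_support[OF abelian_group_axioms f, of "hsupp M x" "hcomp M x"]
      hcomp_closed[OF x] by (auto simp: not_in_hsupp)
  moreover have "y = finsum M (hcomp M y) ?D"
    using hcomp_sum[OF y] finsum_support[OF abelian_group_axioms f, of "hsupp M y" "hcomp M y"]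
      hcomp_closed[OF y] by (auto simp: not_in_hsupp)
  ultimately have "x \<oplus> y = finsum M (\<lambda>d. hcomp M x d \<oplus> hcomp M y d) ?D"
    using hcomp_closed x y by (subst finsum_addf) auto
  then have "hcomp M (x \<oplus> y) d = (if d \<in> ?D then hcomp M x d \<oplus> hcomp M y d else \<zero>)"
    using f x y by (intro hcomp_eqI) (auto intro: gr_add hcomp_gr)
  then show ?thesis by (auto simp: not_in_hsupp)
qed

lemma addmap_hcomp: "addmap M M (\<lambda>x. hcomp M x d)"
  by (intro addmapI) (auto simp: hcomp_add hcomp_closed)

lemma addmap_hsum:
  assumes "addmap M N f" "abelian_group N" "x \<in> carrier M"
  shows "f x = finsum N (\<lambda>d. f (hcomp M x d)) (hsupp M x)"
  using addmap_finsum[OF assms(1) abelian_group_axioms assms(2) finite_hsupp[OF assms(3)], of "hcomp M x"]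
    hcomp_sum[OF assms(3)] hcomp_closed[OF assms(3)] by auto

text \<open>Both maps are determined by their values on the components of \<open>x\<close>. This is
  the formal counterpart of stating a rule for homogeneous elements and extending it additively;
  most identities with signs are proved through it.\<close>

lemma addmap_eqI:
  assumes "addmap M N f" "addmap M N g" "abelian_group N"
    and "\<And>d x. x \<in> gr M d \<Longrightarrow> f x = g x" and "x \<in> carrier M"
  shows "f x = g x"
proof -
  interpret N: abelian_group N by fact
  show ?thesis
    unfolding addmap_hsum[OF assms(1,3,5)] addmap_hsum[OF assms(2,3,5)]
    using assms(4)[OF hcomp_gr[OF assms(5)]] addmap_closed[OF assms(2) hcomp_closed[OF assms(5)]]
    by (intro N.finsum_cong') auto
qed

text \<open>The additive extension of a rule \<open>f d\<close> that depends on the degree, such as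
  a sign. The shifted action, the twist \<open>\<rho>\<close>, the parity map \<open>par\<close> and
  the functionals \<open>\<theta>\<close> all have this shape.\<close>

lemma addmap_gext:
  assumes N: "abelian_group N" and f: "\<And>d. addmap M N (f d)"
  shows "addmap M N (\<lambda>x. finsum N (\<lambda>d. f d (hcomp M x d)) (hsupp M x))"
    and "x \<in> gr M d \<Longrightarrow> finsum N (\<lambda>d. f d (hcomp M x d)) (hsupp M x) = f d x"
proof -
  interpret N: abelian_group N by fact
  note fc = addmap_closed[OF f]
  \<comment> \<open>The supports of \<open>x\<close>, \<open>y\<close> and
    \<open>x \<oplus> y\<close> differ, so all three sums are first taken over one common finite set
    of degrees.\<close>
  have sup: "finsum N (\<lambda>d. f d (hcomp M x d)) (hsupp M x) = finsum N (\<lambda>d. f d (hcomp M x d)) D"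
    if "x \<in> carrier M" "finite D" "hsupp M x \<subseteq> D" for x D
    using that fc[OF hcomp_closed[OF that(1)]] addmap_zero[OF f abelian_group_axioms N]
    by (intro finsum_support[OF N, symmetric]) (simp_all add: not_in_hsupp)
  show "finsum N (\<lambda>d. f d (hcomp M x d)) (hsupp M x) = f d x" if x: "x \<in> gr M d"
    using sup[of x "{d}"] gr_carrier[OF x] fc[of x d] by (simp add: hsupp_hom[OF x] hcomp_hom[OF x])
  show "addmap M N (\<lambda>x. finsum N (\<lambda>d. f d (hcomp M x d)) (hsupp M x))"
  proof (rule addmapI)
    fix x assume "x \<in> carrier M" then show "finsum N (\<lambda>d. f d (hcomp M x d)) (hsupp M x) \<in> carrier N"
      using fc hcomp_closed by (intro N.finsum_closed) blast
  next
    fix x y assume x: "x \<in> carrier M" and y: "y \<in> carrier M"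
    let ?D = "hsupp M x \<union> hsupp M y \<union> hsupp M (x \<oplus> y)"
    let ?s = "\<lambda>x. finsum N (\<lambda>d. f d (hcomp M x d))"
    have D: "finite ?D" using x y finite_hsupp by auto
    have "?s (x \<oplus> y) ?D = finsum N (\<lambda>d. f d (hcomp M x d) \<oplus>\<^bsub>N\<^esub> f d (hcomp M y d)) ?D"
      using x y fc by (intro N.finsum_cong') (simp_all add: Pi_iff hcomp_add hcomp_closed addmap_add[OF f])
    also have "\<dots> = ?s x ?D \<oplus>\<^bsub>N\<^esub> ?s y ?D"
      using x y fc by (intro N.finsum_addf) (simp_all add: Pi_iff hcomp_closed)
    finally show "?s (x \<oplus> y) (hsupp M (x \<oplus> y)) = ?s x (hsupp M x) \<oplus>\<^bsub>N\<^esub> ?s y (hsupp M y)"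
      using sup[OF x D] sup[OF y D] sup[OF a_closed[OF x y] D] by (simp add: le_supI1)
  qed
qed

end

text \<open>Additive projections force uniqueness: applying \<open>pr d\<close> to any decomposition
  of \<open>x\<close> leaves its term in degree \<open>d\<close>, so that term is
  \<open>pr d x\<close>. What remains to be supplied is existence.\<close>

lemma gradingI:
  fixes M :: "('l, 'r, 'm, 'e) gmodule_scheme"
  assumes M: "abelian_group M" and sub: "\<And>d. additive_subgroup (gr M d) M"
    and ex: "\<And>x. x \<in> carrier M \<Longrightarrow> \<exists>D f. finite D \<and> (\<forall>d\<in>D. f d \<in> gr M d) \<and> x = finsum M f D"
    and pr: "\<And>d. addmap M M (pr d)" "\<And>d x. x \<in> gr M d \<Longrightarrow> pr d x = x"
      "\<And>d e x. x \<in> gr M e \<Longrightarrow> e \<noteq> d \<Longrightarrow> pr d x = \<zero>\<^bsub>M\<^esub>"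
  shows "grading M"
  unfolding grading_def
proof (intro conjI allI ballI)
  interpret M: abelian_group M by fact
  have gc: "x \<in> gr M d \<Longrightarrow> x \<in> carrier M" for x d
    using additive_subgroup.a_subset[OF sub[of d]] by auto
  have gz: "\<zero>\<^bsub>M\<^esub> \<in> gr M d" for d
    using additive_subgroup.zero_closed[OF sub] .
  fix x assume "x \<in> carrier M"
  then obtain D f where D: "finite D" "\<forall>d\<in>D. f d \<in> gr M d" "x = finsum M f D" using ex by metis
  have fc: "f \<in> D \<rightarrow> carrier M" using D(2) gc by blast
  let ?f = "\<lambda>d. if d \<in> D then f d else \<zero>\<^bsub>M\<^esub>"
  have s: "{d. ?f d \<noteq> \<zero>\<^bsub>M\<^esub>} \<subseteq> D" by auto
  have "finsum M f D = finsum M ?f D"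
    using fc by (intro M.finsum_cong') auto
  also have "\<dots> = finsum M ?f {d. ?f d \<noteq> \<zero>\<^bsub>M\<^esub>}"
    using D(1) s fc by (intro finsum_support[OF M]) auto
  finally have 1: "homogeneous_decomposition M x ?f"
    unfolding homogeneous_decomposition_def using D gz finite_subset[OF s] by auto
  have "g d = pr d x" if "homogeneous_decomposition M x g" for g d
  proof -
    have g: "\<And>d. g d \<in> gr M d" "finite {d. g d \<noteq> \<zero>\<^bsub>M\<^esub>}" "x = finsum M g {d. g d \<noteq> \<zero>\<^bsub>M\<^esub>}"
      using that by (auto simp: homogeneous_decomposition_def)
    have gcar: "\<And>d. g d \<in> carrier M" using g(1) gc by blast
    \<comment> \<open>The degree \<open>d\<close> is added to the support so that its term, possibly
      zero, can be singled out from the sum.\<close>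
    let ?S = "insert d {d. g d \<noteq> \<zero>\<^bsub>M\<^esub>}"
    have "x = finsum M g ?S"
      using gcar g(2) by (subst g(3), intro finsum_support[symmetric] M) auto
    then have "pr d x = finsum M (\<lambda>e. pr d (g e)) ?S"
      using addmap_finsum[OF pr(1) M M, of ?S g] g(2) gcar by (auto simp: Pi_iff)
    also have "\<dots> = finsum M (\<lambda>e. if e = d then g d else \<zero>\<^bsub>M\<^esub>) ?S"
      using pr(2,3)[OF g(1)] gcar by (intro M.finsum_cong') auto
    also have "\<dots> = g d" using g(2) gcar by (intro finsum_delta M) auto
    finally show ?thesis by simp
  qed
  then have "g = (\<lambda>d. pr d x)" if "homogeneous_decomposition M x g" for g
    using that by auto
  then show "\<exists>!f. homogeneous_decomposition M x f" using 1 by metis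
qed (fact sub)

lemma graded_cong_struct:
  assumes "carrier N = carrier M" "ring.zero N = ring.zero M" "ring.add N = ring.add M" "gr N = gr M"
  shows "hcomp N = hcomp M" "hsupp N = hsupp M"
proof -
  have "homogeneous_decomposition N = homogeneous_decomposition M"
    using assms by (simp add: fun_eq_iff homogeneous_decomposition_def finsum_cong_struct[OF assms(1-3)])
  then show "hcomp N = hcomp M" by (simp add: fun_eq_iff hcomp_def)
  then show "hsupp N = hsupp M" using assms by (simp add: fun_eq_iff hsupp_def)
qed

text \<open>Component \<open>d\<close> of the new grading is component \<open>s d\<close> of the old
  one. The application is to translations of degrees, that is, to shifts.\<close>

lemma graded_group_regrade:
  fixes M :: "('l, 'r, 'm, 'e) gmodule_scheme" and N :: "('l, 'r2, 'm, 'e2) gmodule_scheme"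
  assumes "graded_group M"
    and "carrier N = carrier M" "ring.zero N = ring.zero M" "ring.add N = ring.add M"
    and "\<And>d. gr N d = gr M (s d)" "bij s"
  shows "graded_group N"
proof -
  interpret M: graded_group M by fact
  have N: "abelian_group N" using abelian_group_cong_struct[OF assms(2-4)] M.abelian_group_axioms by blast
  interpret N: abelian_group N by fact
  have fs: "finsum N = finsum M" by (intro ext finsum_cong_struct assms(2-4))
  have "grading N"
  proof (rule gradingI[where pr = "\<lambda>d x. hcomp M x (s d)"])
    show "additive_subgroup (gr N d) N" for d
    proof -
      have "additive_subgroup (gr M (s d)) M" using M.gr_subgroup .
      then show ?thesis
        unfolding additive_subgroup_def subgroup_def using a_inv_cong_struct[OF assms(2-4)] assms
        by (auto simp: a_inv_def)
    qed
    show "\<exists>D f. finite D \<and> (\<forall>d\<in>D. f d \<in> gr N d) \<and> x = finsum N f D" if "x \<in> carrier N" for x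
    proof -
      have x: "x \<in> carrier M" using that assms by simp
      let ?D = "inv_into UNIV s ` hsupp M x"
      have "finsum M (\<lambda>d. hcomp M x (s d)) ?D = finsum M (\<lambda>d. hcomp M x (s (inv_into UNIV s d))) (hsupp M x)"
        using assms(6) M.hcomp_closed[OF x]
        by (intro M.finsum_reindex) (auto simp: bij_def intro!: inj_on_inv_into)
      also have "\<dots> = x" using assms(6) M.hcomp_sum[OF x] by (simp add: bij_def surj_f_inv_f)
      finally show ?thesis using M.hcomp_gr[OF x] M.finite_hsupp[OF x] assms(5)
        by (intro exI[of _ ?D] exI[of _ "\<lambda>d. hcomp M x (s d)"]) (auto simp: fs)
    qed
    show "addmap N N (\<lambda>x. hcomp M x (s d))" for d
      using M.addmap_hcomp[of "s d"] assms by (simp add: addmap_def)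
    show "hcomp M x (s d) = x" if "x \<in> gr N d" for d x using that assms M.hcomp_hom by auto
    show "hcomp M x (s d) = \<zero>\<^bsub>N\<^esub>" if "x \<in> gr N e" "e \<noteq> d" for d e x
      using that assms M.hcomp_hom[of x "s e" "s d"] by (auto simp: bij_def inj_on_def)
  qed (fact N)
  then show ?thesis using N by (simp add: graded_group_def graded_group_axioms_def)
qed

section \<open>Multiplication by signs\<close>

lemma (in abelian_group) sgn_mult_closed: "x \<in> carrier G \<Longrightarrow> sgn_mult G p x \<in> carrier G"
  by (simp add: sgn_mult_def)

lemma (in abelian_group) sgn_mult_add:
  "x \<in> carrier G \<Longrightarrow> y \<in> carrier G \<Longrightarrow> sgn_mult G p (x \<oplus> y) = sgn_mult G p x \<oplus> sgn_mult G p y"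
  by (simp add: sgn_mult_def minus_add)

lemma (in abelian_group) sgn_mult_sgn_mult:
  "x \<in> carrier G \<Longrightarrow> sgn_mult G p (sgn_mult G q x) = sgn_mult G (p + q) x"
  by (cases p; cases q) (auto simp: sgn_mult_def)

lemma sgn_mult_0 [simp]: "sgn_mult G 0 x = x"
  by (simp add: sgn_mult_def)

lemma (in abelian_group) addmap_sgn_mult: "addmap G G (sgn_mult G p)"
  by (intro addmapI) (auto simp: sgn_mult_closed sgn_mult_add)

lemma addmap_sgn:
  assumes "addmap M N f" "abelian_group M" "abelian_group N" "x \<in> carrier M"
  shows "f (sgn_mult M p x) = sgn_mult N p (f x)"
  using addmap_neg[OF assms] by (simp add: sgn_mult_def)

lemma (in graded_group) sgn_mult_gr: "x \<in> gr M d \<Longrightarrow> sgn_mult M p x \<in> gr M d"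
  by (simp add: sgn_mult_def gr_neg)

section \<open>Tensor products\<close>

lemma (in abelian_group) eq_of_minus_zero:
  assumes "a \<in> carrier G" "b \<in> carrier G" "a \<ominus> b = \<zero>"
  shows "a = b"
  using minus_equality[of a "\<ominus> b"] assms by (simp add: a_minus_def)

lemma (in abelian_group) eq_add_of_minus_minus:
  assumes "a \<in> carrier G" "b \<in> carrier G" "c \<in> carrier G" "\<zero> = a \<ominus> b \<ominus> c"
  shows "a = b \<oplus> c"
proof -
  have "a \<ominus> (b \<oplus> c) = \<zero>" using assms(1-3) assms(4)[symmetric] by (simp add: a_minus_def minus_add a_assoc)
  then show ?thesis using eq_of_minus_zero[OF assms(1)] assms(2,3) by simp
qed

text \<open>The ungraded layer: closure of the two actions places the relators in the free abelian
  group, and the quotient then has its universal property. Module structure and grading are added in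
  \<open>graded_tensor\<close>.\<close>

locale tensor_pair = M: abelian_group M + N: abelian_group N
  for S :: "('s, 'e) ring_scheme"
    and M :: "('l::ab_group_add, 'r, 'm, 's) gbimodule" and N :: "('l, 's, 'n) gmodule" +
  assumes rs_closed: "x \<in> carrier M \<Longrightarrow> s \<in> carrier S \<Longrightarrow> rsmult M x s \<in> carrier M"
    and ls_closed: "s \<in> carrier S \<Longrightarrow> y \<in> carrier N \<Longrightarrow> s \<odot>\<^bsub>N\<^esub> y \<in> carrier N"
begin

abbreviation "G \<equiv> tensor_free M N"
abbreviation "H \<equiv> tensor_relations S M N"
abbreviation "T \<equiv> tensor S M N"
abbreviation "cl c \<equiv> H #>\<^bsub>G\<^esub> c"
abbreviation "pt \<equiv> pure_tensor S M N"

definition "rels =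
     {frag_of (x \<oplus>\<^bsub>M\<^esub> x', y) - frag_of (x, y) - frag_of (x', y) | x x' y.
         x \<in> carrier M \<and> x' \<in> carrier M \<and> y \<in> carrier N} \<union>
      {frag_of (x, y \<oplus>\<^bsub>N\<^esub> y') - frag_of (x, y) - frag_of (x, y') | x y y'.
         x \<in> carrier M \<and> y \<in> carrier N \<and> y' \<in> carrier N} \<union>
      {frag_of (rsmult M x s, y) - frag_of (x, s \<odot>\<^bsub>N\<^esub> y) | x s y.
         x \<in> carrier M \<and> s \<in> carrier S \<and> y \<in> carrier N}"

lemma relations_eq: "H = generate G rels"
  by (simp add: tensor_relations_def rels_def)

sublocale G: comm_group G
  by (rule abelian_free_Abelian_group)

lemma G_diff:
  assumes "a \<in> carrier G" "b \<in> carrier G" shows "a - b \<in> carrier G"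
  using assms keys_diff[of a b] by auto

lemma rels_subset: "rels \<subseteq> carrier G"
proof -
  have 1: "frag_of (x, y) \<in> carrier G" if "x \<in> carrier M" "y \<in> carrier N" for x y
    using that by simp
  show ?thesis
    unfolding rels_def
    by (auto simp del: carrier_free_Abelian_group_iff frag_of_in_free_Abelian_group
      intro!: G_diff 1 rs_closed ls_closed)
qed

lemma H_subgroup: "subgroup H G"
  unfolding relations_eq by (rule G.generate_is_subgroup[OF rels_subset])

lemma H_normal: "H \<lhd> G"
  using G.subgroup_imp_normal[OF H_subgroup] .

sublocale H: normal H G
  by (rule H_normal)

lemma carrier_T: "carrier T = cl ` carrier G"
  by (simp add: tensor_def carrier_FactGroup)

lemma zero_T: "\<zero>\<^bsub>T\<^esub> = H"
  by (simp add: tensor_def)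

lemma cl_add: "c \<in> carrier G \<Longrightarrow> c' \<in> carrier G \<Longrightarrow> cl c \<oplus>\<^bsub>T\<^esub> cl c' = cl (c + c')"
  using H.rcos_sum[of c c'] by (simp add: tensor_def)

lemma cl_in_H: "c \<in> H \<Longrightarrow> cl c = \<zero>\<^bsub>T\<^esub>"
  using G.coset_join2[OF _ H_subgroup] H.subset by (auto simp: zero_T)

lemma abelian_T: "abelian_group T"
proof -
  interpret Q: comm_group "tensor_group S M N"
    using G.abelian_FactGroup[OF H_subgroup] .
  have "\<exists>y\<in>carrier T. y \<oplus>\<^bsub>T\<^esub> x = \<zero>\<^bsub>T\<^esub>" if "x \<in> carrier T" for x
    using that Q.l_inv Q.inv_closed by (intro bexI[of _ "inv\<^bsub>tensor_group S M N\<^esub> x"])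
      (simp_all add: tensor_def)
  then show ?thesis
  proof (intro abelian_groupI, goal_cases)
    case (1 x y) then show ?case using Q.m_closed by (simp add: tensor_def)
  next
    case 2 then show ?case using Q.one_closed by (simp add: tensor_def)
  next
    case (3 x y z) then show ?case using Q.m_assoc by (simp add: tensor_def)
  next
    case (4 x y) then show ?case using Q.m_comm by (simp add: tensor_def)
  next
    case (5 x) then show ?case using Q.l_one by (simp add: tensor_def)
  qed auto
qed

sublocale T: abelian_group T
  by (rule abelian_T)

lemma cl_closed: "c \<in> carrier G \<Longrightarrow> cl c \<in> carrier T"
  by (simp add: carrier_T)

lemma cl_hom: "group_hom G (add_monoid T) cl"
  by unfold_locales (auto simp: hom_def cl_closed cl_add[symmetric] simp del: carrier_free_Abelian_group_iff)

lemma cl_neg: "c \<in> carrier G \<Longrightarrow> cl (- c) = \<ominus>\<^bsub>T\<^esub> cl c"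
  using group_hom.hom_inv[OF cl_hom, of c] by (simp add: a_inv_def)

lemma cl_diff:
  assumes "c \<in> carrier G" "c' \<in> carrier G" shows "cl (c - c') = cl c \<ominus>\<^bsub>T\<^esub> cl c'"
proof -
  have "- c' \<in> carrier G" using assms(2) by simp
  then have "cl (c + (- c')) = cl c \<oplus>\<^bsub>T\<^esub> cl (- c')" using cl_add[OF assms(1)] by simp
  then show ?thesis using cl_neg[OF assms(2)] by (simp add: a_minus_def)
qed

lemma pt_closed: "x \<in> carrier M \<Longrightarrow> y \<in> carrier N \<Longrightarrow> pt x y \<in> carrier T"
  by (auto simp: pure_tensor_def intro!: cl_closed)

lemma frag_in: "x \<in> carrier M \<Longrightarrow> y \<in> carrier N \<Longrightarrow> frag_of (x, y) \<in> carrier G"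
  by simp

lemma pt_add_left:
  assumes "x \<in> carrier M" "x' \<in> carrier M" "y \<in> carrier N"
  shows "pt (x \<oplus>\<^bsub>M\<^esub> x') y = pt x y \<oplus>\<^bsub>T\<^esub> pt x' y"
proof -
  have "frag_of (x \<oplus>\<^bsub>M\<^esub> x', y) - frag_of (x, y) - frag_of (x', y) \<in> H"
    unfolding relations_eq using assms by (intro generate.incl) (auto simp: rels_def)
  then have "\<zero>\<^bsub>T\<^esub> = cl (frag_of (x \<oplus>\<^bsub>M\<^esub> x', y) - frag_of (x, y) - frag_of (x', y))"
    using cl_in_H by simp
  also have "\<dots> = pt (x \<oplus>\<^bsub>M\<^esub> x') y \<ominus>\<^bsub>T\<^esub> pt x y \<ominus>\<^bsub>T\<^esub> pt x' y"
    using assms by (simp add: cl_diff G_diff frag_in pure_tensor_def del: carrier_free_Abelian_group_iff)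
  finally have "\<zero>\<^bsub>T\<^esub> = pt (x \<oplus>\<^bsub>M\<^esub> x') y \<ominus>\<^bsub>T\<^esub> pt x y \<ominus>\<^bsub>T\<^esub> pt x' y" .
  then show ?thesis using assms by (intro T.eq_add_of_minus_minus[of _ "pt _ _" "pt _ _"]) (auto simp: pt_closed)
qed

lemma pt_add_right:
  assumes "x \<in> carrier M" "y \<in> carrier N" "y' \<in> carrier N"
  shows "pt x (y \<oplus>\<^bsub>N\<^esub> y') = pt x y \<oplus>\<^bsub>T\<^esub> pt x y'"
proof -
  have "frag_of (x, y \<oplus>\<^bsub>N\<^esub> y') - frag_of (x, y) - frag_of (x, y') \<in> H"
    unfolding relations_eq using assms by (intro generate.incl) (auto simp: rels_def)
  then have "\<zero>\<^bsub>T\<^esub> = cl (frag_of (x, y \<oplus>\<^bsub>N\<^esub> y') - frag_of (x, y) - frag_of (x, y'))"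
    using cl_in_H by simp
  also have "\<dots> = pt x (y \<oplus>\<^bsub>N\<^esub> y') \<ominus>\<^bsub>T\<^esub> pt x y \<ominus>\<^bsub>T\<^esub> pt x y'"
    using assms by (simp add: cl_diff G_diff frag_in pure_tensor_def del: carrier_free_Abelian_group_iff)
  finally have "\<zero>\<^bsub>T\<^esub> = pt x (y \<oplus>\<^bsub>N\<^esub> y') \<ominus>\<^bsub>T\<^esub> pt x y \<ominus>\<^bsub>T\<^esub> pt x y'" .
  then show ?thesis using assms by (intro T.eq_add_of_minus_minus[of _ "pt _ _" "pt _ _"]) (auto simp: pt_closed)
qed

lemma pt_balanced:
  assumes "x \<in> carrier M" "s \<in> carrier S" "y \<in> carrier N"
  shows "pt (rsmult M x s) y = pt x (s \<odot>\<^bsub>N\<^esub> y)"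
proof -
  have "frag_of (rsmult M x s, y) - frag_of (x, s \<odot>\<^bsub>N\<^esub> y) \<in> H"
    unfolding relations_eq using assms by (intro generate.incl) (auto simp: rels_def)
  then have "\<zero>\<^bsub>T\<^esub> = cl (frag_of (rsmult M x s, y) - frag_of (x, s \<odot>\<^bsub>N\<^esub> y))"
    using cl_in_H by simp
  also have "\<dots> = pt (rsmult M x s) y \<ominus>\<^bsub>T\<^esub> pt x (s \<odot>\<^bsub>N\<^esub> y)"
    using assms rs_closed ls_closed by (simp add: cl_diff frag_in pure_tensor_def del: carrier_free_Abelian_group_iff)
  finally show ?thesis using assms T.eq_of_minus_zero[OF pt_closed pt_closed] rs_closed ls_closed by simp
qed

lemma addmap_pt_left: "y \<in> carrier N \<Longrightarrow> addmap M T (\<lambda>x. pt x y)"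
  by (intro addmapI) (auto simp: pt_closed pt_add_left)

lemma addmap_pt_right: "x \<in> carrier M \<Longrightarrow> addmap N T (pt x)"
  by (intro addmapI) (auto simp: pt_closed pt_add_right)

text \<open>The induction principle of the free abelian group passes from generators to differences,
  whence the shape of the last case.\<close>

lemma tensor_induct [consumes 1, case_names zero pure diff]:
  assumes "t \<in> carrier T" "P \<zero>\<^bsub>T\<^esub>"
    and "\<And>x y. x \<in> carrier M \<Longrightarrow> y \<in> carrier N \<Longrightarrow> P (pt x y)"
    and "\<And>t u. t \<in> carrier T \<Longrightarrow> u \<in> carrier T \<Longrightarrow> P t \<Longrightarrow> P u \<Longrightarrow> P (t \<ominus>\<^bsub>T\<^esub> u)"
  shows "P t"
proof -
  obtain c where c: "c \<in> carrier G" "t = cl c" using assms(1) by (auto simp: carrier_T simp del: carrier_free_Abelian_group_iff)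
  have "P (cl c)"
    using c(1)[simplified]
  proof (induction c rule: free_Abelian_group_induct[consumes 1])
    case 1
    have "cl 0 = \<zero>\<^bsub>T\<^esub>" using cl_in_H[of 0] H.one_closed by simp
    then show ?case using assms(2) by simp
  next
    case (2 x y)
    then show ?case using assms(4)[of "cl x" "cl y"] cl_closed[of x] cl_closed[of y] by (simp add: cl_diff)
  next
    case (3 a)
    then show ?case using assms(3) by (auto simp: pure_tensor_def)
  qed
  then show ?thesis using c(2) by simp
qed

text \<open>The map \<open>\<beta>\<close> extends over the free abelian group. Additivity in each
  argument and balancedness say precisely that the three kinds of relators are sent to zero, so the
  extension factors through the quotient.\<close>

lemma tensor_universal:
  assumes P: "abelian_group P"
    and l: "\<And>y. y \<in> carrier N \<Longrightarrow> addmap M P (\<lambda>x. \<beta> x y)"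
    and r: "\<And>x. x \<in> carrier M \<Longrightarrow> addmap N P (\<beta> x)"
    and bal: "\<And>x s y. x \<in> carrier M \<Longrightarrow> s \<in> carrier S \<Longrightarrow> y \<in> carrier N \<Longrightarrow>
      \<beta> (rsmult M x s) y = \<beta> x (s \<odot>\<^bsub>N\<^esub> y)"
  shows "\<exists>h. addmap T P h \<and> (\<forall>x\<in>carrier M. \<forall>y\<in>carrier N. h (pt x y) = \<beta> x y)"
proof -
  interpret P: abelian_group P by fact
  have "case_prod \<beta> ` (carrier M \<times> carrier N) \<subseteq> carrier (add_monoid P)"
    using addmap_closed[OF r] by auto
  from comm_group.free_Abelian_group_universal[OF P.a_comm_group this]
  obtain h where h: "h \<in> hom G (add_monoid P)"
    and hf: "\<And>x. x \<in> carrier M \<times> carrier N \<Longrightarrow> h (frag_of x) = case_prod \<beta> x" by metis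
  interpret h: group_hom G "add_monoid P" h
    using h by unfold_locales
  have hd: "h (a - b) = h a \<ominus>\<^bsub>P\<^esub> h b" if "a \<in> carrier G" "b \<in> carrier G" for a b
  proof -
    have b: "- b \<in> carrier G" using that by simp
    have "h (a + (- b)) = h a \<oplus>\<^bsub>P\<^esub> h (- b)" using h.hom_mult[OF that(1) b] by simp
    then show ?thesis using h.hom_inv[OF that(2)] that by (simp add: a_minus_def a_inv_def)
  qed
  have hf': "h (frag_of (x, y)) = \<beta> x y" if "x \<in> carrier M" "y \<in> carrier N" for x y
    using hf that by simp
  have \<beta>c: "\<beta> x y \<in> carrier P" if "x \<in> carrier M" "y \<in> carrier N" for x y
    using addmap_closed[OF r[OF that(1)] that(2)] .
  have "rels \<subseteq> kernel G (add_monoid P) h"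
  proof
    fix a assume a: "a \<in> rels"
    have aG: "a \<in> carrier G" by (rule subsetD[OF rels_subset a])
    have "h a = \<zero>\<^bsub>P\<^esub>"
      using a[unfolded rels_def]
    proof (elim UnE CollectE exE conjE)
      fix x x' y assume *: "a = frag_of (x \<oplus>\<^bsub>M\<^esub> x', y) - frag_of (x, y) - frag_of (x', y)"
        "x \<in> carrier M" "x' \<in> carrier M" "y \<in> carrier N"
      then have "h a = \<beta> (x \<oplus>\<^bsub>M\<^esub> x') y \<ominus>\<^bsub>P\<^esub> \<beta> x y \<ominus>\<^bsub>P\<^esub> \<beta> x' y"
        by (simp add: hd G_diff frag_in hf' del: carrier_free_Abelian_group_iff)
      also have "\<dots> = \<zero>\<^bsub>P\<^esub>" using * \<beta>c[of x y] \<beta>c[of x' y]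
        by (simp add: addmap_add[OF l] a_minus_def P.a_ac P.r_neg1 P.r_neg2 P.r_neg)
      finally show ?thesis .
    next
      fix x y y' assume *: "a = frag_of (x, y \<oplus>\<^bsub>N\<^esub> y') - frag_of (x, y) - frag_of (x, y')"
        "x \<in> carrier M" "y \<in> carrier N" "y' \<in> carrier N"
      then have "h a = \<beta> x (y \<oplus>\<^bsub>N\<^esub> y') \<ominus>\<^bsub>P\<^esub> \<beta> x y \<ominus>\<^bsub>P\<^esub> \<beta> x y'"
        by (simp add: hd G_diff frag_in hf' del: carrier_free_Abelian_group_iff)
      also have "\<dots> = \<zero>\<^bsub>P\<^esub>" using * \<beta>c[of x y] \<beta>c[of x y']
        by (simp add: addmap_add[OF r] a_minus_def P.a_ac P.r_neg1 P.r_neg2 P.r_neg)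
      finally show ?thesis .
    next
      fix x s y assume *: "a = frag_of (rsmult M x s, y) - frag_of (x, s \<odot>\<^bsub>N\<^esub> y)"
        "x \<in> carrier M" "s \<in> carrier S" "y \<in> carrier N"
      then have "h a = \<beta> (rsmult M x s) y \<ominus>\<^bsub>P\<^esub> \<beta> x (s \<odot>\<^bsub>N\<^esub> y)"
        by (simp add: hd frag_in hf' rs_closed ls_closed del: carrier_free_Abelian_group_iff)
      also have "\<dots> = \<zero>\<^bsub>P\<^esub>" using * \<beta>c[of x "s \<odot>\<^bsub>N\<^esub> y"]
        by (simp add: bal ls_closed a_minus_def P.r_neg)
      finally show ?thesis .
    qed
    then show "a \<in> kernel G (add_monoid P) h" using aG by (simp add: kernel_def)
  qed
  then have HK: "H \<subseteq> kernel G (add_monoid P) h"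
    unfolding relations_eq by (rule G.generate_subgroup_incl[OF _ h.subgroup_kernel])
  \<comment> \<open>Independence of the representative: two representatives of a coset differ by an
    element of \<open>H\<close>, on which \<open>h\<close> vanishes.\<close>
  have "h a = h b" if "a \<in> carrier G" "b \<in> carrier G" "cl a = cl b" for a b
  proof -
    have "a \<in> cl b" using G.rcos_self[OF that(1) H_subgroup] that(3) by simp
    then obtain u where u: "u \<in> H" "a = u \<otimes>\<^bsub>G\<^esub> b" by (auto simp: r_coset_def)
    have "h u = \<zero>\<^bsub>P\<^esub>" using HK u(1) by (auto simp: kernel_def)
    then show ?thesis using h.hom_mult[OF H.mem_carrier[OF u(1)] that(2)] u(2) h.hom_closed[OF that(2)] by simp
  qed
  then obtain g where g: "g \<in> hom (tensor_group S M N) (add_monoid P)" "\<And>x. x \<in> carrier G \<Longrightarrow> g (cl x) = h x"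
    using FactGroup_universal[OF h H_normal] by metis
  have "addmap T P g" using g(1) by (auto simp: addmap_def hom_def tensor_def)
  moreover have "g (pt x y) = \<beta> x y" if "x \<in> carrier M" "y \<in> carrier N" for x y
    using g(2)[OF frag_in[OF that]] hf'[OF that] by (simp add: pure_tensor_def)
  ultimately show ?thesis by blast
qed

lemma tensor_eqI:
  assumes "addmap T P f" "addmap T P g" "abelian_group P"
    and "\<And>x y. x \<in> carrier M \<Longrightarrow> y \<in> carrier N \<Longrightarrow> f (pt x y) = g (pt x y)"
    and "t \<in> carrier T"
  shows "f t = g t"
  using assms(5)
proof (induction t rule: tensor_induct)
  case zero
  then show ?case using addmap_zero[OF assms(1) abelian_T assms(3)] addmap_zero[OF assms(2) abelian_T assms(3)] by simp
next
  case (pure x y)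
  then show ?case using assms(4) by simp
next
  case (diff t u)
  then show ?case
    using addmap_minus[OF assms(1) abelian_T assms(3)] addmap_minus[OF assms(2) abelian_T assms(3)] by simp
qed

end

text \<open>Names the map of the universal property as a function of \<open>\<beta>\<close>, so that
  it can enter definitions. On the carrier it is unique by \<open>tensor_eqI\<close>; elsewhere its
  values are arbitrary.\<close>

definition tensor_lift where
  "tensor_lift S M N P \<beta> = (SOME h. addmap (tensor S M N) P h \<and>
     (\<forall>x\<in>carrier M. \<forall>y\<in>carrier N. h (pure_tensor S M N x y) = \<beta> x y))"

lemma (in tensor_pair) tensor_lift:
  assumes "abelian_group P"
    and "\<And>y. y \<in> carrier N \<Longrightarrow> addmap M P (\<lambda>x. \<beta> x y)"
    and "\<And>x. x \<in> carrier M \<Longrightarrow> addmap N P (\<beta> x)"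
    and "\<And>x s y. x \<in> carrier M \<Longrightarrow> s \<in> carrier S \<Longrightarrow> y \<in> carrier N \<Longrightarrow>
      \<beta> (rsmult M x s) y = \<beta> x (s \<odot>\<^bsub>N\<^esub> y)"
  shows "addmap T P (tensor_lift S M N P \<beta>)"
    and "x \<in> carrier M \<Longrightarrow> y \<in> carrier N \<Longrightarrow> tensor_lift S M N P \<beta> (pt x y) = \<beta> x y"
  using someI_ex[OF tensor_universal[OF assms]] unfolding tensor_lift_def by blast+

text \<open>\<open>tensor_induced\<close> is a union over all representatives of a coset. It is
  identified with the additive map \<open>f\<close> from the universal property: every
  representative contributes the same coset, so the union collapses to the value of
  \<open>f\<close>.\<close>

lemma tensor_induced:
  assumes "tensor_pair S M1 N1" "tensor_pair S M N"
    and g: "addmap M1 M g" and h: "addmap N1 N h"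
    and gs: "\<And>x s. x \<in> carrier M1 \<Longrightarrow> s \<in> carrier S \<Longrightarrow> g (rsmult M1 x s) = rsmult M (g x) s"
    and hs: "\<And>s y. s \<in> carrier S \<Longrightarrow> y \<in> carrier N1 \<Longrightarrow> h (s \<odot>\<^bsub>N1\<^esub> y) = s \<odot>\<^bsub>N\<^esub> h y"
  shows "addmap (tensor S M1 N1) (tensor S M N) (tensor_induced S M N g h)"
    and "x \<in> carrier M1 \<Longrightarrow> y \<in> carrier N1 \<Longrightarrow>
      tensor_induced S M N g h (pure_tensor S M1 N1 x y) = pure_tensor S M N (g x) (h y)"
proof -
  interpret D: tensor_pair S M1 N1 by fact
  interpret E: tensor_pair S M N by fact
  let ?\<beta> = "\<lambda>x y. E.pt (g x) (h y)"
  have gc: "\<And>x. x \<in> carrier M1 \<Longrightarrow> g x \<in> carrier M" and hc: "\<And>y. y \<in> carrier N1 \<Longrightarrow> h y \<in> carrier N"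
    using addmap_closed[OF g] addmap_closed[OF h] by auto
  have "\<exists>f. addmap D.T E.T f \<and> (\<forall>x\<in>carrier M1. \<forall>y\<in>carrier N1. f (D.pt x y) = ?\<beta> x y)"
  proof (rule D.tensor_universal)
    show "addmap M1 E.T (\<lambda>x. E.pt (g x) (h y))" if "y \<in> carrier N1" for y
      using addmap_comp[OF g E.addmap_pt_left[OF hc[OF that]]] .
    show "addmap N1 E.T (\<lambda>y. E.pt (g x) (h y))" if "x \<in> carrier M1" for x
      using addmap_comp[OF h E.addmap_pt_right[OF gc[OF that]]] .
    show "E.pt (g (rsmult M1 x s)) (h y) = E.pt (g x) (h (s \<odot>\<^bsub>N1\<^esub> y))"
      if "x \<in> carrier M1" "s \<in> carrier S" "y \<in> carrier N1" for x s y
      using that by (simp add: gs hs E.pt_balanced gc hc)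
  qed (rule E.abelian_T)
  then obtain f where f: "addmap D.T E.T f" "\<And>x y. x \<in> carrier M1 \<Longrightarrow> y \<in> carrier N1 \<Longrightarrow> f (D.pt x y) = ?\<beta> x y"
    by blast
  define k where "k = frag_extend (\<lambda>(x, y). frag_of (g x, h y))"
  have k: "k c \<in> carrier E.G \<and> f (D.cl c) = E.cl (k c)" if "c \<in> carrier D.G" for c
    using that[simplified]
  proof (induction c rule: free_Abelian_group_induct[consumes 1])
    case 1
    have "D.cl 0 = \<zero>\<^bsub>D.T\<^esub>" "E.cl 0 = \<zero>\<^bsub>E.T\<^esub>"
      using D.cl_in_H[of 0] D.H.one_closed E.cl_in_H[of 0] E.H.one_closed by simp_all
    then show ?case using addmap_zero[OF f(1) D.abelian_T E.abelian_T] by (simp add: k_def)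
  next
    case (2 a b)
    then have ab: "a \<in> carrier D.G" "b \<in> carrier D.G" by simp_all
    have "f (D.cl (a - b)) = f (D.cl a) \<ominus>\<^bsub>E.T\<^esub> f (D.cl b)"
      unfolding D.cl_diff[OF ab] using D.cl_closed[OF ab(1)] D.cl_closed[OF ab(2)]
      by (rule addmap_minus[OF f(1) D.abelian_T E.abelian_T])
    also have "\<dots> = E.cl (k a - k b)" using 2 E.cl_diff[of "k a" "k b"] by metis
    finally show ?case using 2 E.G_diff[of "k a" "k b"] by (simp add: k_def frag_extend_diff)
  next
    case (3 a)
    then obtain x y where "a = (x, y)" "x \<in> carrier M1" "y \<in> carrier N1" by auto
    then show ?case using f(2) gc hc E.frag_in by (simp add: k_def pure_tensor_def)
  qed
  have *: "tensor_induced S M N g h t = f t" if t: "t \<in> carrier D.T" for t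
  proof -
    obtain c where c: "c \<in> carrier D.G" "t = D.cl c"
      using t unfolding D.carrier_T by blast
    have "E.cl (k b) = f t" if "b \<in> t" for b
    proof -
      have "D.cl b = t" using that c D.G.repr_independence[of b D.H c] D.H_subgroup by simp
      moreover have "b \<in> carrier D.G"
        using that D.G.r_coset_subset_G[OF D.H.subset c(1)] unfolding c(2) by blast
      ultimately show ?thesis using k by metis
    qed
    moreover have "c \<in> t" using c D.G.rcos_self[OF c(1) D.H_subgroup] by simp
    ultimately show ?thesis unfolding tensor_induced_def k_def[symmetric] by blast
  qed
  show "addmap (tensor S M1 N1) (tensor S M N) (tensor_induced S M N g h)"
    by (rule addmap_cong[OF f(1) D.abelian_T *])
  show "x \<in> carrier M1 \<Longrightarrow> y \<in> carrier N1 \<Longrightarrow>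
      tensor_induced S M N g h (pure_tensor S M1 N1 x y) = pure_tensor S M N (g x) (h y)"
    using * f(2) D.pt_closed by simp
qed

section \<open>Graded modules and tensor functors\<close>

lemma addmap_plus:
  assumes "abelian_group N" "addmap M N f" "addmap M N g"
  shows "addmap M N (\<lambda>x. f x \<oplus>\<^bsub>N\<^esub> g x)"
proof -
  interpret N: abelian_group N by fact
  show ?thesis using assms(2,3) addmap_closed[OF assms(2)] addmap_closed[OF assms(3)]
    by (intro addmapI) (simp_all add: addmap_add N.a_ac)
qed

lemma mod_hom_addmap: "f \<in> mod_hom R M N \<Longrightarrow> addmap M N f"
  by (auto simp: mod_hom_def addmap_def)

lemma mod_hom_gr: "f \<in> mod_hom R M N \<Longrightarrow> x \<in> gr M d \<Longrightarrow> f x \<in> gr N d"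
  by (auto simp: mod_hom_def)

lemma mod_hom_smult:
  "f \<in> mod_hom R M N \<Longrightarrow> r \<in> carrier R \<Longrightarrow> x \<in> carrier M \<Longrightarrow> f (r \<odot>\<^bsub>M\<^esub> x) = r \<odot>\<^bsub>N\<^esub> f x"
  by (auto simp: mod_hom_def)

lemma mod_hom_closed: "f \<in> mod_hom R M N \<Longrightarrow> x \<in> carrier M \<Longrightarrow> f x \<in> carrier N"
  using addmap_closed[OF mod_hom_addmap] .

lemma mod_hom_eqI:
  assumes "f \<in> mod_hom R M N" "g \<in> mod_hom R M N" "\<And>x. x \<in> carrier M \<Longrightarrow> f x = g x"
  shows "f = g"
  using assms by (intro extensionalityI[of f "carrier M" g]) (auto simp: mod_hom_def PiE_def)

lemma graded_superring_group: "graded_superring R \<Longrightarrow> graded_group R"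
  by (simp add: graded_superring_def graded_group_def graded_group_axioms_def ring_def)

lemma graded_superring_ring: "graded_superring R \<Longrightarrow> ring R"
  by (simp add: graded_superring_def)

lemma graded_superring_mult:
  "graded_superring R \<Longrightarrow> x \<in> gr R d \<Longrightarrow> y \<in> gr R e \<Longrightarrow> x \<otimes>\<^bsub>R\<^esub> y \<in> gr R (d + e)"
  by (simp add: graded_superring_def)

locale graded_lmodule = graded_group M
  for R :: "('l::ab_group_add, 'q, 'r, 'e) gmodule_scheme" and M :: "('l, 'r, 'm, 'f) gmodule_scheme" +
  assumes glm: "graded_left_module R M"
begin

lemma smult_closed: "r \<in> carrier R \<Longrightarrow> x \<in> carrier M \<Longrightarrow> r \<odot>\<^bsub>M\<^esub> x \<in> carrier M"
  using glm by (simp add: graded_left_module_def)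

lemma smult_add_left: "r \<in> carrier R \<Longrightarrow> s \<in> carrier R \<Longrightarrow> x \<in> carrier M \<Longrightarrow>
    (r \<oplus>\<^bsub>R\<^esub> s) \<odot>\<^bsub>M\<^esub> x = r \<odot>\<^bsub>M\<^esub> x \<oplus>\<^bsub>M\<^esub> s \<odot>\<^bsub>M\<^esub> x"
  using glm by (simp add: graded_left_module_def)

lemma smult_add_right: "r \<in> carrier R \<Longrightarrow> x \<in> carrier M \<Longrightarrow> y \<in> carrier M \<Longrightarrow>
    r \<odot>\<^bsub>M\<^esub> (x \<oplus>\<^bsub>M\<^esub> y) = r \<odot>\<^bsub>M\<^esub> x \<oplus>\<^bsub>M\<^esub> r \<odot>\<^bsub>M\<^esub> y"
  using glm by (simp add: graded_left_module_def)

lemma smult_mult: "r \<in> carrier R \<Longrightarrow> s \<in> carrier R \<Longrightarrow> x \<in> carrier M \<Longrightarrow>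
    (r \<otimes>\<^bsub>R\<^esub> s) \<odot>\<^bsub>M\<^esub> x = r \<odot>\<^bsub>M\<^esub> (s \<odot>\<^bsub>M\<^esub> x)"
  using glm by (simp add: graded_left_module_def)

lemma smult_one: "x \<in> carrier M \<Longrightarrow> \<one>\<^bsub>R\<^esub> \<odot>\<^bsub>M\<^esub> x = x"
  using glm by (simp add: graded_left_module_def)

lemma smult_gr: "r \<in> gr R d \<Longrightarrow> x \<in> gr M e \<Longrightarrow> r \<odot>\<^bsub>M\<^esub> x \<in> gr M (d + e)"
  using glm by (simp add: graded_left_module_def)

lemma addmap_smult_left: "x \<in> carrier M \<Longrightarrow> addmap R M (\<lambda>r. r \<odot>\<^bsub>M\<^esub> x)"
  by (intro addmapI) (auto simp: smult_closed smult_add_left)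

lemma addmap_smult_right: "r \<in> carrier R \<Longrightarrow> addmap M M (\<lambda>x. r \<odot>\<^bsub>M\<^esub> x)"
  by (intro addmapI) (auto simp: smult_closed smult_add_right)

lemma hcomp_smult:
  assumes "r \<in> gr R e" "r \<in> carrier R" "x \<in> carrier M"
  shows "hcomp M (r \<odot>\<^bsub>M\<^esub> x) d = r \<odot>\<^bsub>M\<^esub> hcomp M x (d - e)"
proof (rule addmap_eqI[OF addmap_comp[OF addmap_smult_right[OF assms(2)] addmap_hcomp]
      addmap_comp[OF addmap_hcomp addmap_smult_right[OF assms(2)]] abelian_group_axioms _ assms(3)])
  fix c x assume x: "x \<in> gr M c"
  have "r \<odot>\<^bsub>M\<^esub> \<zero>\<^bsub>M\<^esub> = \<zero>\<^bsub>M\<^esub>"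
    using addmap_zero[OF addmap_smult_right[OF assms(2)]] abelian_group_axioms by blast
  then show "hcomp M (r \<odot>\<^bsub>M\<^esub> x) d = r \<odot>\<^bsub>M\<^esub> hcomp M x (d - e)"
    using hcomp_hom[OF smult_gr[OF assms(1) x], of d] hcomp_hom[OF x, of "d - e"] by (auto simp: algebra_simps)
qed

end

lemma graded_lmodule_iff: "graded_left_module R M \<longleftrightarrow> graded_lmodule R M"
  by (auto simp: graded_lmodule_def graded_lmodule_axioms_def graded_left_module_def graded_group_def
    graded_group_axioms_def)

lemma mod_homI:
  assumes "graded_left_module R M" "addmap M N f" "\<And>d x. x \<in> gr M d \<Longrightarrow> f x \<in> gr N d"
    and "\<And>r x. r \<in> carrier R \<Longrightarrow> x \<in> carrier M \<Longrightarrow> f (r \<odot>\<^bsub>M\<^esub> x) = r \<odot>\<^bsub>N\<^esub> f x"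
  shows "restrict f (carrier M) \<in> mod_hom R M N"
proof -
  interpret graded_lmodule R M using assms(1) by (simp add: graded_lmodule_iff)
  show ?thesis
    unfolding mod_hom_def using assms(3,4) addmap_closed[OF assms(2)] addmap_add[OF assms(2)] gr_carrier smult_closed
    by (simp add: split_paired_All)
qed

lemma mod_hom_compose:
  assumes "f \<in> mod_hom R M N" "g \<in> mod_hom R N P" "graded_left_module R M"
  shows "compose (carrier M) g f \<in> mod_hom R M P"
  unfolding compose_def
  by (rule mod_homI[OF assms(3) addmap_comp[OF mod_hom_addmap[OF assms(1)] mod_hom_addmap[OF assms(2)]]])
    (simp_all add: mod_hom_smult[OF assms(1)] mod_hom_smult[OF assms(2)] mod_hom_closed[OF assms(1)]
      mod_hom_gr[OF assms(1)] mod_hom_gr[OF assms(2)])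

definition graded_bimodule where
  "graded_bimodule R S M \<longleftrightarrow> graded_left_module R M \<and>
     (\<forall>x\<in>carrier M. \<forall>s\<in>carrier S. rsmult M x s \<in> carrier M) \<and>
     (\<forall>x\<in>carrier M. \<forall>y\<in>carrier M. \<forall>s\<in>carrier S.
        rsmult M (x \<oplus>\<^bsub>M\<^esub> y) s = rsmult M x s \<oplus>\<^bsub>M\<^esub> rsmult M y s) \<and>
     (\<forall>x\<in>carrier M. \<forall>s\<in>carrier S. \<forall>t\<in>carrier S.
        rsmult M x (s \<oplus>\<^bsub>S\<^esub> t) = rsmult M x s \<oplus>\<^bsub>M\<^esub> rsmult M x t) \<and>
     (\<forall>x\<in>carrier M. \<forall>s\<in>carrier S. \<forall>t\<in>carrier S.
        rsmult M x (s \<otimes>\<^bsub>S\<^esub> t) = rsmult M (rsmult M x s) t) \<and>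
     (\<forall>x\<in>carrier M. rsmult M x \<one>\<^bsub>S\<^esub> = x) \<and>
     (\<forall>d e. \<forall>x\<in>gr M d. \<forall>s\<in>gr S e. rsmult M x s \<in> gr M (d + e)) \<and>
     (\<forall>r\<in>carrier R. \<forall>x\<in>carrier M. \<forall>s\<in>carrier S. rsmult M (r \<odot>\<^bsub>M\<^esub> x) s = r \<odot>\<^bsub>M\<^esub> rsmult M x s)"

locale superring_bimodule =
  R: graded_group R + S: graded_group S + M: graded_lmodule R M
  for R :: "('l::ab_group_add, 'q, 'r, 'e) gmodule_scheme"
    and S :: "('l, 'q1, 's, 'e1) gmodule_scheme"
    and M :: "('l, 'r, 'm, 's) gbimodule" +
  assumes R: "graded_superring R" and S: "graded_superring S" and M: "graded_bimodule R S M"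
begin

lemma rsmult_closed: "x \<in> carrier M \<Longrightarrow> s \<in> carrier S \<Longrightarrow> rsmult M x s \<in> carrier M"
  using M by (simp add: graded_bimodule_def)

lemma addmap_rsmult_left: "s \<in> carrier S \<Longrightarrow> addmap M M (\<lambda>x. rsmult M x s)"
  using M by (simp add: graded_bimodule_def addmap_def)

lemma addmap_rsmult_right: "x \<in> carrier M \<Longrightarrow> addmap S M (rsmult M x)"
  using M by (simp add: graded_bimodule_def addmap_def)

lemma rsmult_gr: "x \<in> gr M d \<Longrightarrow> s \<in> gr S e \<Longrightarrow> rsmult M x s \<in> gr M (d + e)"
  using M by (simp add: graded_bimodule_def)

lemma rsmult_smult: "r \<in> carrier R \<Longrightarrow> x \<in> carrier M \<Longrightarrow> s \<in> carrier S \<Longrightarrow>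
    rsmult M (r \<odot>\<^bsub>M\<^esub> x) s = r \<odot>\<^bsub>M\<^esub> rsmult M x s"
  using M by (simp add: graded_bimodule_def)

end

lemma superring_bimoduleI:
  assumes "graded_superring R" "graded_superring S" "graded_bimodule R S M"
  shows "superring_bimodule R S M"
  using assms graded_superring_group[OF assms(1)] graded_superring_group[OF assms(2)]
  by (auto simp: superring_bimodule_def superring_bimodule_axioms_def graded_bimodule_def graded_lmodule_iff)

section \<open>The grading of a tensor product\<close>

locale graded_tensor = superring_bimodule R S M + N: graded_lmodule S N
  for R :: "('l::ab_group_add, 'q, 'r, 'e) gmodule_scheme"
    and S :: "('l, 'q1, 's, 'e1) gmodule_scheme"
    and M :: "('l, 'r, 'm, 's) gbimodule" and N :: "('l, 's, 'n) gmodule"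
begin

sublocale tensor_pair S M N
  by unfold_locales (auto intro: rsmult_closed N.smult_closed)

text \<open>The component of degree \<open>d\<close> of a pure tensor, written down before the
  tensor product is known to be graded. Its lift is the projection that \<open>gradingI\<close> asks
  for.\<close>

definition hcomp_pt :: "'l \<times> bit \<Rightarrow> 'm \<Rightarrow> 'n \<Rightarrow> ('m \<times> 'n \<Rightarrow>\<^sub>0 int) set" where
  "hcomp_pt d x y = finsum T (\<lambda>e. pt (hcomp M x e) (hcomp N y (d - e))) (hsupp M x)"

lemma hcomp_pt_left: "y \<in> carrier N \<Longrightarrow> addmap M T (\<lambda>x. hcomp_pt d x y)"
  unfolding hcomp_pt_def by (rule M.addmap_gext(1)[OF abelian_T addmap_pt_left[OF N.hcomp_closed]])

lemma hcomp_pt_hom: "x \<in> gr M e \<Longrightarrow> y \<in> carrier N \<Longrightarrow> hcomp_pt d x y = pt x (hcomp N y (d - e))"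
  unfolding hcomp_pt_def
  by (rule M.addmap_gext(2)[where f = "\<lambda>e x. pt x (hcomp N y (d - e))",
        OF abelian_T addmap_pt_left[OF N.hcomp_closed]])

lemma hcomp_pt_right: "x \<in> carrier M \<Longrightarrow> addmap N T (hcomp_pt d x)"
  unfolding hcomp_pt_def
  by (rule addmap_sum[OF N.abelian_group_axioms abelian_T])
     (rule addmap_comp[OF N.addmap_hcomp addmap_pt_right[OF M.hcomp_closed]])

text \<open>For \<open>x\<close> and \<open>s\<close> homogeneous of degrees \<open>e\<close> and
  \<open>c\<close>, both sides select the component of \<open>y\<close> in degree
  \<open>d - e - c\<close>, as multiplication by \<open>s\<close> raises degrees by
  \<open>c\<close>. The general case is additive in \<open>x\<close> and in
  \<open>s\<close>.\<close>

lemma hcomp_pt_balanced: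
  assumes x: "x \<in> carrier M" and s: "s \<in> carrier S" and y: "y \<in> carrier N"
  shows "hcomp_pt d (rsmult M x s) y = hcomp_pt d x (s \<odot>\<^bsub>N\<^esub> y)"
proof (rule M.addmap_eqI[OF addmap_comp[OF addmap_rsmult_left[OF s] hcomp_pt_left[OF y]]
         hcomp_pt_left[OF N.smult_closed[OF s y]] abelian_T _ x])
  fix e x assume x: "x \<in> gr M e"
  then have xc: "x \<in> carrier M" by (rule M.gr_carrier)
  show "hcomp_pt d (rsmult M x s) y = hcomp_pt d x (s \<odot>\<^bsub>N\<^esub> y)"
  proof (rule S.addmap_eqI[OF addmap_comp[OF addmap_rsmult_right[OF xc] hcomp_pt_left[OF y]]
        addmap_comp[OF N.addmap_smult_left[OF y] hcomp_pt_right[OF xc]] abelian_T _ s])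
    fix c s assume s: "s \<in> gr S c"
    then have sc: "s \<in> carrier S" by (rule S.gr_carrier)
    have "hcomp_pt d (rsmult M x s) y = pt (rsmult M x s) (hcomp N y (d - (e + c)))"
      by (rule hcomp_pt_hom[OF rsmult_gr[OF x s] y])
    also have "\<dots> = pt x (s \<odot>\<^bsub>N\<^esub> hcomp N y (d - e - c))"
      using pt_balanced[OF xc sc N.hcomp_closed[OF y]] by (simp add: diff_diff_eq)
    also have "\<dots> = hcomp_pt d x (s \<odot>\<^bsub>N\<^esub> y)"
      unfolding hcomp_pt_hom[OF x N.smult_closed[OF sc y]] N.hcomp_smult[OF s sc y] ..
    finally show "hcomp_pt d (rsmult M x s) y = hcomp_pt d x (s \<odot>\<^bsub>N\<^esub> y)" .
  qed
qed

definition "pr d = tensor_lift S M N T (hcomp_pt d)"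

lemma addmap_pr: "addmap T T (pr d)"
  unfolding pr_def by (intro tensor_lift abelian_T hcomp_pt_left hcomp_pt_right hcomp_pt_balanced)

lemma pr_pt:
  assumes "x \<in> gr M e" "y \<in> gr N e'"
  shows "pr d (pt x y) = (if d = e + e' then pt x y else \<zero>\<^bsub>T\<^esub>)"
proof -
  have x: "x \<in> carrier M" and y: "y \<in> carrier N" using assms M.gr_carrier N.gr_carrier by auto
  have "pr d (pt x y) = hcomp_pt d x y"
    unfolding pr_def by (intro tensor_lift abelian_T hcomp_pt_left hcomp_pt_right hcomp_pt_balanced x y)
  also have "\<dots> = pt x (hcomp N y (d - e))"
    by (rule hcomp_pt_hom[OF assms(1) y])
  finally show ?thesis
    using N.hcomp_hom[OF assms(2), of "d - e"] addmap_zero[OF addmap_pt_right[OF x] N.abelian_group_axioms abelian_T]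
    by (auto simp: algebra_simps)
qed

text \<open>\<open>tensor\<close> takes the generated subgroup in the quotient group, whereas the
  subgroup facts used later concern \<open>add_monoid T\<close>. The two records have different
  types, so the generated sets are compared by induction.\<close>

lemma gr_T: "gr T d = generate (add_monoid T) {pt x y | x y. \<exists>e e'. d = e + e' \<and> x \<in> gr M e \<and> y \<in> gr N e'}"
proof -
  have inv: "m_inv (tensor_group S M N) = m_inv (add_monoid T)"
    by (simp add: fun_eq_iff m_inv_def tensor_def)
  have "generate (tensor_group S M N) U = generate (add_monoid T) U" for U
  proof (intro subset_antisym subsetI)
    fix a assume "a \<in> generate (tensor_group S M N) U" then show "a \<in> generate (add_monoid T) U"
    proof induction
      case one
      then show ?case using generate.one[of "add_monoid T" U] by (simp add: tensor_def)
    next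
      case (eng a b)
      then show ?case using generate.eng[of a "add_monoid T" U b] by (simp add: tensor_def)
    qed (auto intro: generate.incl generate.inv simp: inv)
  next
    fix a assume "a \<in> generate (add_monoid T) U" then show "a \<in> generate (tensor_group S M N) U"
    proof induction
      case one
      then show ?case using generate.one[of "tensor_group S M N" U] by (simp add: tensor_def)
    next
      case (eng a b)
      then show ?case using generate.eng[of a "tensor_group S M N" U b] by (simp add: tensor_def)
    qed (auto intro: generate.incl generate.inv simp: inv[symmetric])
  qed
  then show ?thesis by (auto simp: tensor_def[of S M N])
qed

lemma pt_gr: "x \<in> gr M e \<Longrightarrow> y \<in> gr N e' \<Longrightarrow> d = e + e' \<Longrightarrow> pt x y \<in> gr T d"
  unfolding gr_T by (rule generate.incl) blast

lemma gr_T_subgroup: "additive_subgroup (gr T d) T"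
  unfolding additive_subgroup_def gr_T
  by (rule T.add.generate_is_subgroup) (auto intro: pt_closed M.gr_carrier N.gr_carrier)

lemma gr_T_induct:
  assumes t: "t \<in> gr T d" and "P \<zero>\<^bsub>T\<^esub>"
    and pure: "\<And>x y e e'. d = e + e' \<Longrightarrow> x \<in> gr M e \<Longrightarrow> y \<in> gr N e' \<Longrightarrow> P (pt x y)"
    and neg: "\<And>t. t \<in> carrier T \<Longrightarrow> P t \<Longrightarrow> P (\<ominus>\<^bsub>T\<^esub> t)"
    and add: "\<And>t u. t \<in> carrier T \<Longrightarrow> u \<in> carrier T \<Longrightarrow> P t \<Longrightarrow> P u \<Longrightarrow> P (t \<oplus>\<^bsub>T\<^esub> u)"
  shows "P t"
proof -
  have c: "pt x y \<in> carrier T" if "x \<in> gr M e" "y \<in> gr N e'" for x y e e'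
    using that by (intro pt_closed M.gr_carrier N.gr_carrier)
  have "t \<in> carrier T \<and> P t"
    using t unfolding gr_T
  proof induction
    case one then show ?case using assms(2) by simp
  next
    case (incl h) then show ?case using pure c by blast
  next
    case (inv h)
    then have "h \<in> carrier T \<and> P h" using pure c by blast
    then show ?case using neg T.a_inv_closed by (auto simp: a_inv_def[symmetric])
  next
    case (eng a b) then show ?case using add by simp
  qed
  then show ?thesis by simp
qed

lemma gr_T_eq:
  assumes "addmap T P f" "addmap T P g" "abelian_group P" "t \<in> gr T d"
    and "\<And>x y e e'. d = e + e' \<Longrightarrow> x \<in> gr M e \<Longrightarrow> y \<in> gr N e' \<Longrightarrow> f (pt x y) = g (pt x y)"
  shows "f t = g t"
  using assms(4)
  by (rule gr_T_induct)
    (simp_all add: addmap_zero[OF assms(1) abelian_T assms(3)] addmap_zero[OF assms(2) abelian_T assms(3)]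
      addmap_neg[OF assms(1) abelian_T assms(3)] addmap_neg[OF assms(2) abelian_T assms(3)]
      addmap_add[OF assms(1)] addmap_add[OF assms(2)] assms(5))

lemma addmap_gr_T:
  assumes "addmap T P f" "abelian_group P" "additive_subgroup U P" "t \<in> gr T d"
    and "\<And>x y e e'. d = e + e' \<Longrightarrow> x \<in> gr M e \<Longrightarrow> y \<in> gr N e' \<Longrightarrow> f (pt x y) \<in> U"
  shows "f t \<in> U"
  using assms(4)
proof (rule gr_T_induct)
  interpret P: abelian_group P by fact
  interpret U: additive_subgroup U P by fact
  show "f \<zero>\<^bsub>T\<^esub> \<in> U" using addmap_zero[OF assms(1) abelian_T assms(2)] by simp
  show "f (\<ominus>\<^bsub>T\<^esub> t) \<in> U" if "t \<in> carrier T" "f t \<in> U" for t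
    using that addmap_neg[OF assms(1) abelian_T assms(2)] U.a_inv_closed by auto
  show "f (t \<oplus>\<^bsub>T\<^esub> u) \<in> U" if "t \<in> carrier T" "u \<in> carrier T" "f t \<in> U" "f u \<in> U" for t u
    using that addmap_add[OF assms(1)] U.a_closed by simp
qed (rule assms(5))

text \<open>Uniqueness comes from \<open>pr\<close>, which fixes tensors of degree \<open>d\<close>
  and kills those of any other degree. For existence, a pure tensor is expanded into components in
  both arguments, and finite sums of homogeneous tensors are closed under differences.\<close>

lemma grading_T: "grading T"
proof (rule gradingI[where pr = pr, OF abelian_T gr_T_subgroup])
  show "addmap T T (pr d)" for d by (rule addmap_pr)
  show "pr d t = t" if "t \<in> gr T d" for d t
    using gr_T_eq[OF addmap_pr addmap_id abelian_T that] pr_pt by metis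
  show "pr d t = \<zero>\<^bsub>T\<^esub>" if "t \<in> gr T e" "e \<noteq> d" for d e t
  proof -
    have z: "addmap T T (\<lambda>t. \<zero>\<^bsub>T\<^esub>)" by (intro addmapI) auto
    show ?thesis using gr_T_eq[OF addmap_pr z abelian_T that(1)] pr_pt that(2) by metis
  qed
next
  let ?Q = "\<lambda>x. \<exists>D f. finite D \<and> (\<forall>d\<in>D. f d \<in> gr T d) \<and> x = finsum T f D"
  have gz: "\<zero>\<^bsub>T\<^esub> \<in> gr T d" for d using additive_subgroup.zero_closed[OF gr_T_subgroup] .
  have gc: "t \<in> gr T d \<Longrightarrow> t \<in> carrier T" for t d using additive_subgroup.a_subset[OF gr_T_subgroup[of d]] by auto
  have hom: "?Q t" if "t \<in> gr T d" for t d
    using that gc by (intro exI[of _ "{d}"] exI[of _ "\<lambda>_. t"]) (auto simp: T.finsum_singleton)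
  have Qzero: "?Q \<zero>\<^bsub>T\<^esub>" by (intro exI[of _ "{}"]) auto
  have add: "?Q (t \<oplus>\<^bsub>T\<^esub> u)" if Q: "?Q t" "?Q u" for t u
  proof -
    obtain D f where D: "finite D" "\<forall>d\<in>D. f d \<in> gr T d" "t = finsum T f D" using Q(1) by blast
    obtain E g where E: "finite E" "\<forall>d\<in>E. g d \<in> gr T d" "u = finsum T g E" using Q(2) by blast
    let ?f = "\<lambda>d. if d \<in> D then f d else \<zero>\<^bsub>T\<^esub>" and ?g = "\<lambda>d. if d \<in> E then g d else \<zero>\<^bsub>T\<^esub>"
    have fc: "f \<in> D \<rightarrow> carrier T" "g \<in> E \<rightarrow> carrier T" using D E gc by blast+
    have "t = finsum T ?f D" unfolding D(3) using fc by (intro T.finsum_cong') auto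
    also have "\<dots> = finsum T ?f (D \<union> E)"
      using fc D E by (intro finsum_support[symmetric] abelian_T) auto
    finally have t: "t = finsum T ?f (D \<union> E)" .
    have "u = finsum T ?g E" unfolding E(3) using fc by (intro T.finsum_cong') auto
    also have "\<dots> = finsum T ?g (D \<union> E)"
      using fc D E by (intro finsum_support[symmetric] abelian_T) auto
    finally have u: "u = finsum T ?g (D \<union> E)" .
    have "t \<oplus>\<^bsub>T\<^esub> u = finsum T (\<lambda>d. ?f d \<oplus>\<^bsub>T\<^esub> ?g d) (D \<union> E)"
      unfolding t u using fc by (intro T.finsum_addf[symmetric]) auto
    moreover have "\<forall>d\<in>D \<union> E. ?f d \<oplus>\<^bsub>T\<^esub> ?g d \<in> gr T d"
      using D(2) E(2) gz additive_subgroup.a_closed[OF gr_T_subgroup] by auto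
    ultimately show ?thesis using D(1) E(1) by (intro exI[of _ "D \<union> E"] exI[of _ "\<lambda>d. ?f d \<oplus>\<^bsub>T\<^esub> ?g d"]) auto
  qed
  have sum: "?Q (finsum T f I)" if "finite I" "\<And>i. i \<in> I \<Longrightarrow> f i \<in> carrier T \<and> ?Q (f i)" for f and I :: "'z set"
    using that
  proof (induction I rule: finite_induct)
    case empty then show ?case using Qzero by simp
  next
    case (insert i I)
    have "f i \<in> carrier T" "f \<in> I \<rightarrow> carrier T" using insert.prems by auto
    then have eq: "finsum T f (insert i I) = f i \<oplus>\<^bsub>T\<^esub> finsum T f I" using insert.hyps by simp
    have "?Q (f i)" using insert.prems by blast
    moreover have "?Q (finsum T f I)" using insert.IH insert.prems by blast
    ultimately show ?case unfolding eq by (rule add)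
  qed
  have neg: "?Q (\<ominus>\<^bsub>T\<^esub> t)" if "?Q t" for t
  proof -
    obtain D f where D: "finite D" "\<forall>d\<in>D. f d \<in> gr T d" "t = finsum T f D" using \<open>?Q t\<close> by blast
    have "addmap T T (\<lambda>t. \<ominus>\<^bsub>T\<^esub> t)" by (intro addmapI) (auto simp: T.minus_add)
    moreover have "f \<in> D \<rightarrow> carrier T" using D gc by blast
    ultimately have "\<ominus>\<^bsub>T\<^esub> t = finsum T (\<lambda>d. \<ominus>\<^bsub>T\<^esub> f d) D"
      unfolding D(3) using addmap_finsum[of T T "\<lambda>t. \<ominus>\<^bsub>T\<^esub> t" D f] abelian_T D(1) by blast
    moreover have "\<forall>d\<in>D. \<ominus>\<^bsub>T\<^esub> f d \<in> gr T d"
      using D(2) additive_subgroup.a_inv_closed[OF gr_T_subgroup] by auto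
    ultimately show ?thesis using D(1) by (intro exI[of _ D] exI[of _ "\<lambda>d. \<ominus>\<^bsub>T\<^esub> f d"]) auto
  qed
  show "?Q t" if "t \<in> carrier T" for t
    using that
  proof (induction t rule: tensor_induct)
    case zero show ?case by (rule Qzero)
  next
    case (pure x y)
    have "pt x y = finsum T (\<lambda>d. pt (hcomp M x d) y) (hsupp M x)"
      by (rule M.addmap_hsum[OF addmap_pt_left[OF pure(2)] abelian_T pure(1)])
    also have "\<dots> = finsum T (\<lambda>d. finsum T (\<lambda>e. pt (hcomp M x d) (hcomp N y e)) (hsupp N y)) (hsupp M x)"
      using N.addmap_hsum[OF addmap_pt_right[OF M.hcomp_closed[OF pure(1)]] abelian_T pure(2)]
        pt_closed[OF M.hcomp_closed[OF pure(1)] N.hcomp_closed[OF pure(2)]]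
      by (intro T.finsum_cong') (auto intro!: T.finsum_closed)
    also have "?Q \<dots>"
    proof (intro sum conjI M.finite_hsupp N.finite_hsupp pure T.finsum_closed Pi_I pt_closed
        M.hcomp_closed N.hcomp_closed)
      fix d e show "?Q (pt (hcomp M x d) (hcomp N y e))"
        by (rule hom[OF pt_gr[OF M.hcomp_gr[OF pure(1)] N.hcomp_gr[OF pure(2)] refl]])
    qed
    finally show ?case .
  next
    case (diff t u) show ?case unfolding a_minus_def by (rule add[OF diff(3) neg[OF diff(4)]])
  qed
qed

sublocale T: graded_group T
  by (simp add: graded_group_def graded_group_axioms_def abelian_T grading_T)

lemma tp: "tensor_pair S M N"
  by unfold_locales

lemma smult_T:
  assumes "r \<in> carrier R"
  shows "addmap T T (\<lambda>t. r \<odot>\<^bsub>T\<^esub> t)"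
    and "x \<in> carrier M \<Longrightarrow> y \<in> carrier N \<Longrightarrow> r \<odot>\<^bsub>T\<^esub> pt x y = pt (r \<odot>\<^bsub>M\<^esub> x) y"
proof -
  have e: "(\<odot>\<^bsub>T\<^esub>) r = tensor_induced S M N (\<lambda>x. r \<odot>\<^bsub>M\<^esub> x) (\<lambda>y. y)" by (simp add: tensor_def)
  show "addmap T T (\<lambda>t. r \<odot>\<^bsub>T\<^esub> t)"
    unfolding e using assms
    by (intro tensor_induced(1)[OF tp tp] M.addmap_smult_right addmap_id) (auto simp: rsmult_smult)
  show "r \<odot>\<^bsub>T\<^esub> pt x y = pt (r \<odot>\<^bsub>M\<^esub> x) y" if "x \<in> carrier M" "y \<in> carrier N"
    unfolding e using assms that
    by (intro tensor_induced(2)[OF tp tp] M.addmap_smult_right addmap_id) (auto simp: rsmult_smult)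
qed

lemma graded_left_module_T: "graded_left_module R T"
  unfolding graded_left_module_def
proof (intro conjI ballI allI abelian_T grading_T)
  interpret R: ring R using R by (rule graded_superring_ring)
  show sc: "r \<odot>\<^bsub>T\<^esub> t \<in> carrier T" if "r \<in> carrier R" "t \<in> carrier T" for r t
    using addmap_closed[OF smult_T(1)[OF that(1)] that(2)] .
  show "(r \<oplus>\<^bsub>R\<^esub> s) \<odot>\<^bsub>T\<^esub> t = r \<odot>\<^bsub>T\<^esub> t \<oplus>\<^bsub>T\<^esub> s \<odot>\<^bsub>T\<^esub> t"
    if "r \<in> carrier R" "s \<in> carrier R" "t \<in> carrier T" for r s t
    using that
    by (intro tensor_eqI[where t = t, OF smult_T(1)[of "r \<oplus>\<^bsub>R\<^esub> s"]
          addmap_plus[OF abelian_T smult_T(1)[of r] smult_T(1)[of s]] abelian_T])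
      (simp_all add: smult_T(2) M.smult_add_left pt_add_left M.smult_closed)
  show "r \<odot>\<^bsub>T\<^esub> (t \<oplus>\<^bsub>T\<^esub> u) = r \<odot>\<^bsub>T\<^esub> t \<oplus>\<^bsub>T\<^esub> r \<odot>\<^bsub>T\<^esub> u"
    if "r \<in> carrier R" "t \<in> carrier T" "u \<in> carrier T" for r t u
    using addmap_add[OF smult_T(1)[OF that(1)] that(2,3)] .
  show "(r \<otimes>\<^bsub>R\<^esub> s) \<odot>\<^bsub>T\<^esub> t = r \<odot>\<^bsub>T\<^esub> (s \<odot>\<^bsub>T\<^esub> t)"
    if "r \<in> carrier R" "s \<in> carrier R" "t \<in> carrier T" for r s t
    using that
    by (intro tensor_eqI[where t = t, OF smult_T(1)[of "r \<otimes>\<^bsub>R\<^esub> s"]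
          addmap_comp[OF smult_T(1)[of s] smult_T(1)[of r]] abelian_T])
      (simp_all add: smult_T(2) M.smult_mult M.smult_closed)
  show "\<one>\<^bsub>R\<^esub> \<odot>\<^bsub>T\<^esub> t = t" if "t \<in> carrier T" for t
    using that
    by (intro tensor_eqI[where t = t, OF smult_T(1)[of "\<one>\<^bsub>R\<^esub>"] addmap_id abelian_T])
      (simp_all add: smult_T(2) M.smult_one)
  show "r \<odot>\<^bsub>T\<^esub> t \<in> gr T (d + e)" if "r \<in> gr R d" "t \<in> gr T e" for r t d e
  proof (rule addmap_gr_T[OF smult_T(1) abelian_T gr_T_subgroup that(2)])
    show r: "r \<in> carrier R" using that(1) by (rule R.gr_carrier)
    fix x y c c' assume *: "e = c + c'" "x \<in> gr M c" "y \<in> gr N c'"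
    show "r \<odot>\<^bsub>T\<^esub> pt x y \<in> gr T (d + e)"
      unfolding smult_T(2)[OF r M.gr_carrier[OF *(2)] N.gr_carrier[OF *(3)]] *(1)
      by (rule pt_gr[OF M.smult_gr[OF that(1) *(2)] *(3)]) (simp add: algebra_simps)
  qed
qed

end

section \<open>Functoriality of the tensor product\<close>

context superring_bimodule
begin

lemma graded_tensorI: "graded_left_module S N \<Longrightarrow> graded_tensor R S M N"
  using superring_bimodule_axioms by (simp add: graded_tensor_def graded_lmodule_iff)

lemma tensor_map:
  assumes "graded_left_module S N" "graded_left_module S N'" "h \<in> mod_hom S N N'"
  shows "tensor_map S M N N' h \<in> mod_hom R (tensor S M N) (tensor S M N')"
    and "x \<in> carrier M \<Longrightarrow> y \<in> carrier N \<Longrightarrow>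
      tensor_map S M N N' h (pure_tensor S M N x y) = pure_tensor S M N' x (h y)"
proof -
  interpret N: graded_tensor R S M N using graded_tensorI[OF assms(1)] .
  interpret N': graded_tensor R S M N' using graded_tensorI[OF assms(2)] .
  note hm = mod_hom_addmap[OF assms(3)]
  have 1: "addmap N.T N'.T (tensor_induced S M N' (\<lambda>x. x) h)"
    by (intro tensor_induced(1)[OF N.tp N'.tp addmap_id hm]) (auto simp: mod_hom_smult[OF assms(3)])
  have 2: "tensor_induced S M N' (\<lambda>x. x) h (N.pt x y) = N'.pt x (h y)" if "x \<in> carrier M" "y \<in> carrier N" for x y
    using that by (intro tensor_induced(2)[OF N.tp N'.tp addmap_id hm]) (auto simp: mod_hom_smult[OF assms(3)])
  then show "x \<in> carrier M \<Longrightarrow> y \<in> carrier N \<Longrightarrow> tensor_map S M N N' h (N.pt x y) = N'.pt x (h y)"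
    by (simp add: tensor_map_def N.pt_closed)
  show "tensor_map S M N N' h \<in> mod_hom R N.T N'.T"
    unfolding tensor_map_def
  proof (rule mod_homI[OF N.graded_left_module_T 1])
    show "tensor_induced S M N' (\<lambda>x. x) h t \<in> gr N'.T d" if "t \<in> gr N.T d" for d t
      by (rule N.addmap_gr_T[OF 1 N'.abelian_T N'.gr_T_subgroup that])
        (auto simp: 2 M.gr_carrier N.N.gr_carrier intro!: N'.pt_gr mod_hom_gr[OF assms(3)])
    show "tensor_induced S M N' (\<lambda>x. x) h (r \<odot>\<^bsub>N.T\<^esub> t) = r \<odot>\<^bsub>N'.T\<^esub> tensor_induced S M N' (\<lambda>x. x) h t"
      if "r \<in> carrier R" "t \<in> carrier N.T" for r t
      using that
      by (intro N.tensor_eqI[where t = t, OF addmap_comp[OF N.smult_T(1)[of r] 1]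
            addmap_comp[OF 1 N'.smult_T(1)[of r]] N'.abelian_T])
        (simp_all add: 2 N.smult_T(2) N'.smult_T(2) M.smult_closed mod_hom_closed[OF assms(3)])
  qed
qed

lemma module_functor_tensor:
  "module_functor S R (tensor S M :: ('l, 's, 'n) gmodule \<Rightarrow> _) (tensor_map S M)"
  unfolding module_functor_def
proof (intro conjI allI impI ballI)
  show "graded_left_module R (tensor S M N)" if "graded_left_module S N" for N :: "('l, 's, 'n) gmodule"
    using graded_tensor.graded_left_module_T[OF graded_tensorI[OF that]] .
next
  fix N N' :: "('l, 's, 'n) gmodule" and f
  assume "graded_left_module S N \<and> graded_left_module S N'" "f \<in> mod_hom S N N'"
  then show "tensor_map S M N N' f \<in> mod_hom R (tensor S M N) (tensor S M N')"
    using tensor_map(1) by blast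
next
  fix N :: "('l, 's, 'n) gmodule" assume N: "graded_left_module S N"
  interpret N: graded_tensor R S M N using graded_tensorI[OF N] .
  have i: "restrict (\<lambda>x. x) (carrier N) \<in> mod_hom S N N"
    by (rule mod_homI[OF N addmap_id]) auto
  have j: "restrict (\<lambda>x. x) (carrier N.T) \<in> mod_hom R N.T N.T"
    by (rule mod_homI[OF N.graded_left_module_T addmap_id]) auto
  show "tensor_map S M N N (restrict (\<lambda>x. x) (carrier N)) = restrict (\<lambda>x. x) (carrier N.T)"
  proof (rule mod_hom_eqI[OF tensor_map(1)[OF N N i] j])
    fix t assume "t \<in> carrier N.T"
    then show "tensor_map S M N N (restrict (\<lambda>x. x) (carrier N)) t = restrict (\<lambda>x. x) (carrier N.T) t"
      by (intro N.tensor_eqI[where t = t, OF mod_hom_addmap[OF tensor_map(1)[OF N N i]] mod_hom_addmap[OF j] N.abelian_T])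
        (simp_all add: tensor_map(2)[OF N N i] N.pt_closed)
  qed
next
  fix N N' N'' :: "('l, 's, 'n) gmodule" and f g
  assume a: "graded_left_module S N \<and> graded_left_module S N' \<and> graded_left_module S N''"
    and f: "f \<in> mod_hom S N N'" and g: "g \<in> mod_hom S N' N''"
  have N: "graded_left_module S N" and N': "graded_left_module S N'" and N'': "graded_left_module S N''"
    using a by auto
  interpret N: graded_tensor R S M N using graded_tensorI[OF N] .
  interpret N': graded_tensor R S M N' using graded_tensorI[OF N'] .
  interpret N'': graded_tensor R S M N'' using graded_tensorI[OF N''] .
  note gf = mod_hom_compose[OF f g N]
  note 1 = mod_hom_compose[OF tensor_map(1)[OF N N' f] tensor_map(1)[OF N' N'' g] N.graded_left_module_T]
  show "tensor_map S M N N'' (compose (carrier N) g f) =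
    compose (carrier N.T) (tensor_map S M N' N'' g) (tensor_map S M N N' f)"
  proof (rule mod_hom_eqI[OF tensor_map(1)[OF N N'' gf] 1])
    fix t assume "t \<in> carrier N.T"
    then show "tensor_map S M N N'' (compose (carrier N) g f) t =
        compose (carrier N.T) (tensor_map S M N' N'' g) (tensor_map S M N N' f) t"
      by (intro N.tensor_eqI[where t = t, OF mod_hom_addmap[OF tensor_map(1)[OF N N'' gf]] mod_hom_addmap[OF 1] N''.abelian_T])
        (simp_all add: tensor_map(2)[OF N N'' gf] tensor_map(2)[OF N N' f] tensor_map(2)[OF N' N'' g]
          N.pt_closed compose_eq mod_hom_closed[OF f])
  qed
qed

end

section \<open>Adjunction from a dual pair of bimodules\<close>

text \<open>A dual pair of bimodules: \<open>ev\<close> is a bimodule map from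
  \<open>K \<otimes> L\<close> over \<open>A\<close> to \<open>B\<close>, the sum of the
  \<open>u i \<otimes> v i\<close> in \<open>L \<otimes> K\<close> over \<open>B\<close> is the
  coevaluation at one, and \<open>dual_L\<close> and \<open>dual_K\<close> are the triangle
  identities. The degrees of \<open>u i\<close> and \<open>v i\<close> are opposite, so this sum has
  degree zero. That it commutes with \<open>A\<close> is not an axiom but follows from the triangle
  identities.\<close>

locale dual_pair = K: superring_bimodule B A K + L: superring_bimodule A B L
  for A :: "('l::ab_group_add, 'q, 'a, 'e) gmodule_scheme"
    and B :: "('l, 'q1, 'b, 'e1) gmodule_scheme"
    and K :: "('l, 'b, 'k, 'a) gbimodule" and L :: "('l, 'a, 'j, 'b) gbimodule" +
  fixes ev :: "'k \<Rightarrow> 'j \<Rightarrow> 'b" and I :: "'i set" and u :: "'i \<Rightarrow> 'j" and v :: "'i \<Rightarrow> 'k"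
    and du :: "'i \<Rightarrow> 'l \<times> bit"
  assumes ev_left: "l \<in> carrier L \<Longrightarrow> addmap K B (\<lambda>x. ev x l)"
    and ev_right: "x \<in> carrier K \<Longrightarrow> addmap L B (ev x)"
    and ev_smult: "b \<in> carrier B \<Longrightarrow> x \<in> carrier K \<Longrightarrow> l \<in> carrier L \<Longrightarrow>
      ev (b \<odot>\<^bsub>K\<^esub> x) l = b \<otimes>\<^bsub>B\<^esub> ev x l"
    and ev_rsmult: "b \<in> carrier B \<Longrightarrow> x \<in> carrier K \<Longrightarrow> l \<in> carrier L \<Longrightarrow>
      ev x (rsmult L l b) = ev x l \<otimes>\<^bsub>B\<^esub> b"
    and ev_balanced: "a \<in> carrier A \<Longrightarrow> x \<in> carrier K \<Longrightarrow> l \<in> carrier L \<Longrightarrow>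
      ev (rsmult K x a) l = ev x (a \<odot>\<^bsub>L\<^esub> l)"
    and ev_gr: "x \<in> gr K d \<Longrightarrow> l \<in> gr L e \<Longrightarrow> ev x l \<in> gr B (d + e)"
    and finite_I: "finite I"
    and u_gr: "i \<in> I \<Longrightarrow> u i \<in> gr L (du i)"
    and v_gr: "i \<in> I \<Longrightarrow> v i \<in> gr K (- du i)"
    and dual_L: "l \<in> carrier L \<Longrightarrow> l = finsum L (\<lambda>i. rsmult L (u i) (ev (v i) l)) I"
    and dual_K: "x \<in> carrier K \<Longrightarrow> x = finsum K (\<lambda>i. ev x (u i) \<odot>\<^bsub>K\<^esub> v i) I"
begin

lemma u_closed: "i \<in> I \<Longrightarrow> u i \<in> carrier L"
  using L.M.gr_carrier[OF u_gr] .

lemma v_closed: "i \<in> I \<Longrightarrow> v i \<in> carrier K"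
  using K.M.gr_carrier[OF v_gr] .

lemma ev_closed: "x \<in> carrier K \<Longrightarrow> l \<in> carrier L \<Longrightarrow> ev x l \<in> carrier B"
  using addmap_closed[OF ev_right] .

text \<open>The counit \<open>x \<otimes> (l \<otimes> m) \<mapsto> ev x l m\<close> with
  \<open>x\<close> kept as a parameter. Each value then needs just one lift over
  \<open>L \<otimes> M\<close>; additivity and balancedness in \<open>x\<close> are proved
  afterwards.\<close>

definition counit_at :: "('l, 'b, 'm) gmodule \<Rightarrow> 'k \<Rightarrow> ('j \<times> 'm \<Rightarrow>\<^sub>0 int) set \<Rightarrow> 'm" where
  "counit_at M x = tensor_lift B L M M (\<lambda>l m. ev x l \<odot>\<^bsub>M\<^esub> m)"

end

locale dual_pair_modules = dual_pair A B K L ev I u v du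
  + N: graded_tensor B A K N + M: graded_tensor A B L M
  for A :: "('l::ab_group_add, 'q, 'a, 'e) gmodule_scheme"
    and B :: "('l, 'q1, 'b, 'e1) gmodule_scheme"
    and K :: "('l, 'b, 'k, 'a) gbimodule" and L :: "('l, 'a, 'j, 'b) gbimodule"
    and ev :: "'k \<Rightarrow> 'j \<Rightarrow> 'b" and I :: "'i set" and u :: "'i \<Rightarrow> 'j" and v :: "'i \<Rightarrow> 'k"
    and du :: "'i \<Rightarrow> 'l \<times> bit"
    and N :: "('l, 'a, 'n) gmodule" and M :: "('l, 'b, 'm) gmodule"
begin

abbreviation "FN \<equiv> tensor A K N"
abbreviation "GM \<equiv> tensor B L M"
abbreviation "\<epsilon> \<equiv> counit_at M"

lemma counit_at:
  assumes x: "x \<in> carrier K"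
  shows "addmap GM M (\<epsilon> x)"
    and "l \<in> carrier L \<Longrightarrow> m \<in> carrier M \<Longrightarrow> \<epsilon> x (M.pt l m) = ev x l \<odot>\<^bsub>M\<^esub> m"
proof -
  have 1: "addmap L M (\<lambda>l. ev x l \<odot>\<^bsub>M\<^esub> m)" if "m \<in> carrier M" for m
    by (rule addmap_comp[OF ev_right[OF x] M.N.addmap_smult_left[OF that]])
  have 2: "addmap M M (\<lambda>m. ev x l \<odot>\<^bsub>M\<^esub> m)" if "l \<in> carrier L" for l
    by (rule M.N.addmap_smult_right[OF ev_closed[OF x that]])
  have 3: "ev x (rsmult L l b) \<odot>\<^bsub>M\<^esub> m = ev x l \<odot>\<^bsub>M\<^esub> (b \<odot>\<^bsub>M\<^esub> m)"
    if "l \<in> carrier L" "b \<in> carrier B" "m \<in> carrier M" for l b m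
    using that x by (simp add: ev_rsmult M.N.smult_mult ev_closed)
  show "addmap GM M (\<epsilon> x)"
    unfolding counit_at_def by (rule M.tensor_lift(1)[where \<beta> = "\<lambda>l m. ev x l \<odot>\<^bsub>M\<^esub> m", OF M.N.abelian_group_axioms 1 2 3])
  show "\<epsilon> x (M.pt l m) = ev x l \<odot>\<^bsub>M\<^esub> m" if "l \<in> carrier L" "m \<in> carrier M"
    unfolding counit_at_def using that
    by (intro M.tensor_lift(2)[where \<beta> = "\<lambda>l m. ev x l \<odot>\<^bsub>M\<^esub> m", OF M.N.abelian_group_axioms 1 2 3])
qed

lemma counit_at_gr: "x \<in> gr K d \<Longrightarrow> t \<in> gr GM e \<Longrightarrow> \<epsilon> x t \<in> gr M (d + e)"
proof -
  assume x: "x \<in> gr K d" and t: "t \<in> gr GM e"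
  note xc = K.M.gr_carrier[OF x]
  show ?thesis
  proof (rule M.addmap_gr_T[OF counit_at(1)[OF xc] M.N.abelian_group_axioms M.N.gr_subgroup t])
    fix l m c c' assume *: "e = c + c'" "l \<in> gr L c" "m \<in> gr M c'"
    have "ev x l \<odot>\<^bsub>M\<^esub> m \<in> gr M ((d + c) + c')"
      by (rule M.N.smult_gr[OF ev_gr[OF x *(2)] *(3)])
    then show "\<epsilon> x (M.pt l m) \<in> gr M (d + e)"
      using counit_at(2)[OF xc L.M.gr_carrier[OF *(2)] M.N.gr_carrier[OF *(3)]] *(1) by (simp add: add.assoc)
  qed
qed

lemma counit_at_left:
  assumes "t \<in> carrier GM" shows "addmap K M (\<lambda>x. \<epsilon> x t)"
proof (rule addmapI)
  show "\<epsilon> x t \<in> carrier M" if "x \<in> carrier K" for x using addmap_closed[OF counit_at(1)[OF that] assms] .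
  show "\<epsilon> (x \<oplus>\<^bsub>K\<^esub> y) t = \<epsilon> x t \<oplus>\<^bsub>M\<^esub> \<epsilon> y t" if "x \<in> carrier K" "y \<in> carrier K" for x y
    using that assms
    by (intro M.tensor_eqI[where t = t, OF counit_at(1)[of "x \<oplus>\<^bsub>K\<^esub> y"]
          addmap_plus[OF M.N.abelian_group_axioms counit_at(1)[of x] counit_at(1)[of y]] M.N.abelian_group_axioms])
      (simp_all add: Pi_iff counit_at(2) addmap_add[OF ev_left] M.N.smult_add_left ev_closed)
qed

lemma counit_at_smult:
  assumes "b \<in> carrier B" "x \<in> carrier K" "t \<in> carrier GM"
  shows "\<epsilon> (b \<odot>\<^bsub>K\<^esub> x) t = b \<odot>\<^bsub>M\<^esub> \<epsilon> x t"
  using assms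
  by (intro M.tensor_eqI[where t = t, OF counit_at(1)[of "b \<odot>\<^bsub>K\<^esub> x"]
        addmap_comp[OF counit_at(1)[of x] M.N.addmap_smult_right[of b]] M.N.abelian_group_axioms])
    (simp_all add: Pi_iff counit_at(2) ev_smult M.N.smult_mult ev_closed K.M.smult_closed)

lemma counit_at_balanced:
  assumes "a \<in> carrier A" "x \<in> carrier K" "t \<in> carrier GM"
  shows "\<epsilon> (rsmult K x a) t = \<epsilon> x (a \<odot>\<^bsub>GM\<^esub> t)"
  using assms
  by (intro M.tensor_eqI[where t = t, OF counit_at(1)[of "rsmult K x a"]
        addmap_comp[OF M.smult_T(1)[of a] counit_at(1)[of x]] M.N.abelian_group_axioms])
    (simp_all add: Pi_iff counit_at(2) ev_balanced K.rsmult_closed M.smult_T(2) L.M.smult_closed)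

text \<open>The identity \<open>dual_L\<close> tensored with \<open>M\<close>: on a pure tensor the
  scalar \<open>ev (v i) l\<close> is moved across the tensor sign to \<open>u i\<close>.\<close>

lemma sum_counit_at:
  assumes "t \<in> carrier GM"
  shows "finsum GM (\<lambda>i. M.pt (u i) (\<epsilon> (v i) t)) I = t"
proof (rule M.tensor_eqI[OF _ addmap_id M.abelian_T _ assms])
  show "addmap GM GM (\<lambda>t. finsum GM (\<lambda>i. M.pt (u i) (\<epsilon> (v i) t)) I)"
    by (rule addmap_sum[OF M.abelian_T M.abelian_T],
        rule addmap_comp[OF counit_at(1)[OF v_closed] M.addmap_pt_right[OF u_closed]])
  fix l m assume l: "l \<in> carrier L" and m: "m \<in> carrier M"
  have "finsum GM (\<lambda>i. M.pt (u i) (\<epsilon> (v i) (M.pt l m))) I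
      = finsum GM (\<lambda>i. M.pt (rsmult L (u i) (ev (v i) l)) m) I"
    using l m by (intro M.T.finsum_cong')
      (simp_all add: Pi_iff counit_at(2) v_closed u_closed M.pt_balanced M.N.smult_closed ev_closed M.pt_closed L.rsmult_closed)
  also have "\<dots> = M.pt (finsum L (\<lambda>i. rsmult L (u i) (ev (v i) l)) I) m"
    by (rule addmap_finsum[OF M.addmap_pt_left[OF m] L.M.abelian_group_axioms M.abelian_T finite_I, symmetric])
      (use l in \<open>simp add: Pi_iff u_closed v_closed ev_closed L.rsmult_closed\<close>)
  finally show "finsum GM (\<lambda>i. M.pt (u i) (\<epsilon> (v i) (M.pt l m))) I = M.pt l m"
    using dual_L[OF l] by simp
qed

definition transpose where
  "transpose h = (\<lambda>n\<in>carrier N. finsum GM (\<lambda>i. M.pt (u i) (h (N.pt (v i) n))) I)"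

definition untranspose where
  "untranspose g = (\<lambda>t\<in>carrier FN. tensor_lift A K N M (\<lambda>x n. \<epsilon> x (g n)) t)"

text \<open>Linearity over \<open>A\<close> is the point, since neither \<open>u i\<close> nor
  \<open>v i\<close> alone is compatible with \<open>a\<close>. The same matrix \<open>c i j\<close>
  expresses \<open>v i a\<close> through the \<open>v j\<close> (by \<open>dual_K\<close>) and
  \<open>a u j\<close> through the \<open>u i\<close> (by \<open>dual_L\<close>); exchanging the two
  sums carries \<open>a\<close> from one tensor factor to the other.\<close>

lemma transpose_hom:
  assumes h: "h \<in> mod_hom B FN M"
  shows "transpose h \<in> mod_hom A N GM"
  unfolding transpose_def
proof (rule mod_homI[OF N.N.glm])
  note ha = mod_hom_addmap[OF h]
  note hc = mod_hom_closed[OF h]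
  show "addmap N GM (\<lambda>n. finsum GM (\<lambda>i. M.pt (u i) (h (N.pt (v i) n))) I)"
    by (rule addmap_sum[OF N.N.abelian_group_axioms M.abelian_T])
      (rule addmap_comp[OF addmap_comp[OF N.addmap_pt_right[OF v_closed] ha] M.addmap_pt_right[OF u_closed]])
  show "finsum GM (\<lambda>i. M.pt (u i) (h (N.pt (v i) n))) I \<in> gr GM d" if n: "n \<in> gr N d" for d n
  proof (rule M.T.gr_finsum[OF finite_I])
    fix i assume i: "i \<in> I"
    have "h (N.pt (v i) n) \<in> gr M (- du i + d)"
      by (rule mod_hom_gr[OF h N.pt_gr[OF v_gr[OF i] n refl]])
    then show "M.pt (u i) (h (N.pt (v i) n)) \<in> gr GM d"
      by (rule M.pt_gr[OF u_gr[OF i]]) simp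
  qed
  show "finsum GM (\<lambda>i. M.pt (u i) (h (N.pt (v i) (a \<odot>\<^bsub>N\<^esub> n)))) I
      = a \<odot>\<^bsub>GM\<^esub> finsum GM (\<lambda>i. M.pt (u i) (h (N.pt (v i) n))) I"
    if a: "a \<in> carrier A" and n: "n \<in> carrier N" for a n
  proof -
    define c where "c i j = ev (v i) (a \<odot>\<^bsub>L\<^esub> u j)" for i j
    have cc: "c i j \<in> carrier B" if "i \<in> I" "j \<in> I" for i j
      using that a by (simp add: c_def ev_closed v_closed u_closed L.M.smult_closed)
    have hn: "h (N.pt (v j) n) \<in> carrier M" if "j \<in> I" for j
      using that n by (simp add: hc N.pt_closed v_closed)
    have "h (N.pt (v i) (a \<odot>\<^bsub>N\<^esub> n)) = finsum M (\<lambda>j. c i j \<odot>\<^bsub>M\<^esub> h (N.pt (v j) n)) I" if i: "i \<in> I" for i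
    proof -
      have va: "rsmult K (v i) a \<in> carrier K" using i a by (simp add: K.rsmult_closed v_closed)
      have "finsum K (\<lambda>j. ev (rsmult K (v i) a) (u j) \<odot>\<^bsub>K\<^esub> v j) I = finsum K (\<lambda>j. c i j \<odot>\<^bsub>K\<^esub> v j) I"
        using i a cc K.M.smult_closed v_closed
        by (intro K.M.finsum_cong') (simp_all add: Pi_iff c_def ev_balanced u_closed)
      then have "rsmult K (v i) a = finsum K (\<lambda>j. c i j \<odot>\<^bsub>K\<^esub> v j) I"
        using dual_K[OF va] by simp
      then have "h (N.pt (v i) (a \<odot>\<^bsub>N\<^esub> n)) = h (N.pt (finsum K (\<lambda>j. c i j \<odot>\<^bsub>K\<^esub> v j) I) n)"
        using N.pt_balanced[OF v_closed[OF i] a n] by simp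
      also have "\<dots> = finsum M (\<lambda>j. h (N.pt (c i j \<odot>\<^bsub>K\<^esub> v j) n)) I"
        by (rule addmap_finsum[OF addmap_comp[OF N.addmap_pt_left[OF n] ha] K.M.abelian_group_axioms
              M.N.abelian_group_axioms finite_I]) (use i in \<open>simp add: Pi_iff K.M.smult_closed cc v_closed\<close>)
      also have "\<dots> = finsum M (\<lambda>j. c i j \<odot>\<^bsub>M\<^esub> h (N.pt (v j) n)) I"
        using i n by (intro M.N.finsum_cong')
          (simp_all add: Pi_iff N.smult_T(2)[symmetric] cc v_closed mod_hom_smult[OF h] N.pt_closed hn M.N.smult_closed)
      finally show ?thesis .
    qed
    then have "finsum GM (\<lambda>i. M.pt (u i) (h (N.pt (v i) (a \<odot>\<^bsub>N\<^esub> n)))) I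
        = finsum GM (\<lambda>i. finsum GM (\<lambda>j. M.pt (u i) (c i j \<odot>\<^bsub>M\<^esub> h (N.pt (v j) n))) I) I"
      using a n
      by (intro M.T.finsum_cong') (simp_all add: Pi_iff M.T.finsum_closed M.pt_closed u_closed M.N.smult_closed cc hn
        addmap_finsum[OF M.addmap_pt_right[OF u_closed] M.N.abelian_group_axioms M.abelian_T finite_I])
    also have "\<dots> = finsum GM (\<lambda>j. finsum GM (\<lambda>i. M.pt (u i) (c i j \<odot>\<^bsub>M\<^esub> h (N.pt (v j) n))) I) I"
      by (rule finsum_swap[OF M.abelian_T finite_I finite_I]) (simp add: M.pt_closed u_closed M.N.smult_closed cc hn)
    also have "\<dots> = finsum GM (\<lambda>j. a \<odot>\<^bsub>GM\<^esub> M.pt (u j) (h (N.pt (v j) n))) I"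
    proof (rule M.T.finsum_cong'[OF refl])
      show "(\<lambda>j. a \<odot>\<^bsub>GM\<^esub> M.pt (u j) (h (N.pt (v j) n))) \<in> I \<rightarrow> carrier GM"
        using a by (simp add: M.smult_T(2) u_closed hn M.pt_closed L.M.smult_closed)
      fix j assume j: "j \<in> I"
      have "finsum GM (\<lambda>i. M.pt (u i) (c i j \<odot>\<^bsub>M\<^esub> h (N.pt (v j) n))) I
          = finsum GM (\<lambda>i. M.pt (rsmult L (u i) (c i j)) (h (N.pt (v j) n))) I"
        using j by (intro M.T.finsum_cong') (simp_all add: Pi_iff M.pt_balanced M.N.smult_closed u_closed cc hn M.pt_closed L.rsmult_closed)
      also have "\<dots> = M.pt (finsum L (\<lambda>i. rsmult L (u i) (c i j)) I) (h (N.pt (v j) n))"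
        by (rule addmap_finsum[OF M.addmap_pt_left[OF hn[OF j]] L.M.abelian_group_axioms M.abelian_T finite_I, symmetric])
          (simp add: Pi_iff L.rsmult_closed u_closed cc j)
      also have "finsum L (\<lambda>i. rsmult L (u i) (c i j)) I = a \<odot>\<^bsub>L\<^esub> u j"
        unfolding c_def by (rule dual_L[symmetric]) (simp add: L.M.smult_closed a u_closed j)
      also have "M.pt (a \<odot>\<^bsub>L\<^esub> u j) (h (N.pt (v j) n)) = a \<odot>\<^bsub>GM\<^esub> M.pt (u j) (h (N.pt (v j) n))"
        using j a by (simp add: M.smult_T(2) u_closed hn)
      finally show "finsum GM (\<lambda>i. M.pt (u i) (c i j \<odot>\<^bsub>M\<^esub> h (N.pt (v j) n))) I
        = a \<odot>\<^bsub>GM\<^esub> M.pt (u j) (h (N.pt (v j) n))" .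
    qed
    also have "\<dots> = a \<odot>\<^bsub>GM\<^esub> finsum GM (\<lambda>i. M.pt (u i) (h (N.pt (v i) n))) I"
      by (rule addmap_finsum[OF M.smult_T(1)[OF a] M.abelian_T M.abelian_T finite_I, symmetric])
        (simp add: Pi_iff M.pt_closed u_closed hn)
    finally show ?thesis .
  qed
qed

text \<open>The value prescribed on pure tensors is balanced over \<open>A\<close> because
  \<open>g\<close> is linear and the counit satisfies \<open>counit_at_balanced\<close>.\<close>

lemma untranspose:
  assumes g: "g \<in> mod_hom A N GM"
  shows "x \<in> carrier K \<Longrightarrow> n \<in> carrier N \<Longrightarrow> untranspose g (N.pt x n) = \<epsilon> x (g n)"
    and "untranspose g \<in> mod_hom B FN M"
proof -
  note gc = mod_hom_closed[OF g]
  have 1: "addmap K M (\<lambda>x. \<epsilon> x (g n))" if "n \<in> carrier N" for n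
    by (rule counit_at_left[OF gc[OF that]])
  have 2: "addmap N M (\<lambda>n. \<epsilon> x (g n))" if "x \<in> carrier K" for x
    by (rule addmap_comp[OF mod_hom_addmap[OF g] counit_at(1)[OF that]])
  have 3: "\<epsilon> (rsmult K x a) (g n) = \<epsilon> x (g (a \<odot>\<^bsub>N\<^esub> n))"
    if "x \<in> carrier K" "a \<in> carrier A" "n \<in> carrier N" for x a n
    using that by (simp add: mod_hom_smult[OF g] counit_at_balanced gc)
  let ?f = "tensor_lift A K N M (\<lambda>x n. \<epsilon> x (g n))"
  have f: "addmap FN M ?f" and fp: "\<And>x n. x \<in> carrier K \<Longrightarrow> n \<in> carrier N \<Longrightarrow> ?f (N.pt x n) = \<epsilon> x (g n)"
    by (rule N.tensor_lift[where \<beta> = "\<lambda>x n. \<epsilon> x (g n)", OF M.N.abelian_group_axioms 1 2 3]; assumption)+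
  show "x \<in> carrier K \<Longrightarrow> n \<in> carrier N \<Longrightarrow> untranspose g (N.pt x n) = \<epsilon> x (g n)"
    by (simp add: untranspose_def fp N.pt_closed)
  show "untranspose g \<in> mod_hom B FN M"
    unfolding untranspose_def
  proof (rule mod_homI[OF N.graded_left_module_T f])
    show "?f t \<in> gr M d" if "t \<in> gr FN d" for t d
    proof (rule N.addmap_gr_T[OF f M.N.abelian_group_axioms M.N.gr_subgroup that])
      fix x n e e' assume *: "d = e + e'" "x \<in> gr K e" "n \<in> gr N e'"
      show "?f (N.pt x n) \<in> gr M d"
        unfolding fp[OF K.M.gr_carrier[OF *(2)] N.N.gr_carrier[OF *(3)]] *(1)
        by (rule counit_at_gr[OF *(2) mod_hom_gr[OF g *(3)]])
    qed
    show "?f (b \<odot>\<^bsub>FN\<^esub> t) = b \<odot>\<^bsub>M\<^esub> ?f t" if "b \<in> carrier B" "t \<in> carrier FN" for b t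
      using that
      by (intro N.tensor_eqI[where t = t, OF addmap_comp[OF N.smult_T(1)[of b] f]
            addmap_comp[OF f M.N.addmap_smult_right[of b]] M.N.abelian_group_axioms])
        (simp_all add: Pi_iff N.smult_T(2) fp K.M.smult_closed counit_at_smult gc)
  qed
qed

text \<open>After the counit is applied to the unit, the scalars \<open>ev x (u i)\<close> return to
  the side of \<open>K\<close>, and \<open>dual_K\<close> recombines the sum to
  \<open>x\<close>.\<close>

lemma untranspose_transpose:
  assumes h: "h \<in> mod_hom B FN M" shows "untranspose (transpose h) = h"
proof (rule mod_hom_eqI[OF untranspose(2)[OF transpose_hom[OF h]] h])
  note ha = mod_hom_addmap[OF h]
  note ut = untranspose[OF transpose_hom[OF h]]
  fix t assume "t \<in> carrier FN"
  then show "untranspose (transpose h) t = h t"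
  proof (rule N.tensor_eqI[where t = t, OF mod_hom_addmap[OF ut(2)] ha M.N.abelian_group_axioms, rotated])
    fix x n assume x: "x \<in> carrier K" and n: "n \<in> carrier N"
    have hn: "h (N.pt (v j) n) \<in> carrier M" if "j \<in> I" for j
      using that n by (simp add: mod_hom_closed[OF h] N.pt_closed v_closed)
    have "untranspose (transpose h) (N.pt x n) = \<epsilon> x (finsum GM (\<lambda>i. M.pt (u i) (h (N.pt (v i) n))) I)"
      unfolding ut(1)[OF x n] by (simp add: transpose_def n)
    also have "\<dots> = finsum M (\<lambda>i. \<epsilon> x (M.pt (u i) (h (N.pt (v i) n)))) I"
      by (rule addmap_finsum[OF counit_at(1)[OF x] M.abelian_T M.N.abelian_group_axioms finite_I])
        (simp add: Pi_iff M.pt_closed u_closed hn)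
    also have "\<dots> = finsum M (\<lambda>i. h (N.pt (ev x (u i) \<odot>\<^bsub>K\<^esub> v i) n)) I"
      using x n by (intro M.N.finsum_cong')
        (simp_all add: Pi_iff counit_at(2) u_closed hn N.smult_T(2)[symmetric] mod_hom_smult[OF h] ev_closed
          v_closed N.pt_closed M.N.smult_closed)
    also have "\<dots> = h (N.pt (finsum K (\<lambda>i. ev x (u i) \<odot>\<^bsub>K\<^esub> v i) I) n)"
      by (rule addmap_finsum[OF addmap_comp[OF N.addmap_pt_left[OF n] ha] K.M.abelian_group_axioms
            M.N.abelian_group_axioms finite_I, symmetric])
        (simp add: Pi_iff K.M.smult_closed ev_closed x u_closed v_closed)
    also have "\<dots> = h (N.pt x n)" using dual_K[OF x] by simp
    finally show "untranspose (transpose h) (N.pt x n) = h (N.pt x n)" .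
  qed
qed

text \<open>The other triangle identity, applied to the element \<open>g n\<close> in the form
  \<open>sum_counit_at\<close>.\<close>

lemma transpose_untranspose:
  assumes g: "g \<in> mod_hom A N GM" shows "transpose (untranspose g) = g"
proof (rule mod_hom_eqI[OF transpose_hom[OF untranspose(2)[OF g]] g])
  fix n assume n: "n \<in> carrier N"
  have gn: "g n \<in> carrier GM" by (rule mod_hom_closed[OF g n])
  have "transpose (untranspose g) n = finsum GM (\<lambda>i. M.pt (u i) (\<epsilon> (v i) (g n))) I"
    using n gn unfolding transpose_def restrict_apply'[OF n]
    by (intro M.T.finsum_cong')
      (simp_all add: Pi_iff untranspose(1)[OF g] v_closed u_closed M.pt_closed addmap_closed[OF counit_at(1)])
  then show "transpose (untranspose g) n = g n" using sum_counit_at[OF gn] by simp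
qed

lemma bij_transpose: "bij_betw transpose (mod_hom B FN M) (mod_hom A N GM)"
  using transpose_hom untranspose(2) untranspose_transpose transpose_untranspose
  by (intro bij_betw_byWitness[where f' = untranspose]) auto

end

context dual_pair
begin

lemma dual_pair_modulesI:
  assumes "graded_left_module A N" "graded_left_module B M"
  shows "dual_pair_modules A B K L ev I u v du N M"
  using dual_pair_axioms K.graded_tensorI[OF assms(1)] L.graded_tensorI[OF assms(2)]
  by (simp add: dual_pair_modules_def)

theorem adjoint_functors_tensor:
  "adjoint_functors A B
     (tensor A K :: ('l, 'a, 'n) gmodule \<Rightarrow> _) (tensor_map A K)
     (tensor B L :: ('l, 'b, 'm) gmodule \<Rightarrow> _) (tensor_map B L)"
  unfolding adjoint_functors_def
proof (intro conjI exI allI impI ballI)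
  show "module_functor A B (tensor A K :: ('l, 'a, 'n) gmodule \<Rightarrow> _) (tensor_map A K)"
    by (rule K.module_functor_tensor)
  show "module_functor B A (tensor B L :: ('l, 'b, 'm) gmodule \<Rightarrow> _) (tensor_map B L)"
    by (rule L.module_functor_tensor)
  \<comment> \<open>The transposition is exported with \<open>N\<close> and \<open>M\<close> as
    arguments, so one term serves as the bijection for all pairs of modules.\<close>
  let ?\<Phi> = "dual_pair_modules.transpose A B K L I u v"
  fix N :: "('l, 'a, 'n) gmodule" and M :: "('l, 'b, 'm) gmodule"
  assume "graded_left_module A N \<and> graded_left_module B M"
  then interpret dual_pair_modules A B K L ev I u v du N M
    by (intro dual_pair_modulesI) auto
  show "bij_betw (?\<Phi> N M) (mod_hom B (tensor A K N) M) (mod_hom A N (tensor B L M))"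
    using bij_transpose .
next
  fix N N' :: "('l, 'a, 'n) gmodule" and M M' :: "('l, 'b, 'm) gmodule" and w h k
  assume *: "graded_left_module A N \<and> graded_left_module A N' \<and> graded_left_module B M \<and> graded_left_module B M'"
    and w: "w \<in> mod_hom A N' N" and h: "h \<in> mod_hom B (tensor A K N) M" and k: "k \<in> mod_hom B M M'"
  let ?\<Phi> = "dual_pair_modules.transpose A B K L I u v"
  interpret P: dual_pair_modules A B K L ev I u v du N M using * by (intro dual_pair_modulesI) auto
  interpret P': dual_pair_modules A B K L ev I u v du N' M' using * by (intro dual_pair_modulesI) auto
  have glm: "graded_left_module A N" "graded_left_module A N'" "graded_left_module B M" "graded_left_module B M'"
    using * by auto
  note Kw = K.tensor_map[OF glm(2,1) w]
  note Lk = L.tensor_map[OF glm(3,4) k]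
  show "?\<Phi> N' M' (compose (carrier (tensor A K N')) k (compose (carrier (tensor A K N')) h (tensor_map A K N' N w)))
      = compose (carrier N') (tensor_map B L M M' k) (compose (carrier N') (?\<Phi> N M h) w)"
  proof (rule extensionalityI[of _ "carrier N'"])
    fix n assume n: "n \<in> carrier N'"
    have wn: "w n \<in> carrier N" by (rule mod_hom_closed[OF w n])
    have hn: "h (P.N.pt (v i) (w n)) \<in> carrier M" if "i \<in> I" for i
      using that wn by (simp add: mod_hom_closed[OF h] P.N.pt_closed v_closed)
    \<comment> \<open>Naturality in both variables at once: \<open>w\<close> acts inside the tensors
      \<open>v i \<otimes> w n\<close>, and the additive map induced by \<open>k\<close> passes
      through the finite sum of the unit.\<close>
    have "?\<Phi> N' M' (compose (carrier P'.FN) k (compose (carrier P'.FN) h (tensor_map A K N' N w))) n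
       = finsum P'.GM (\<lambda>i. tensor_map B L M M' k (P.M.pt (u i) (h (P.N.pt (v i) (w n))))) I"
      unfolding P'.transpose_def restrict_apply'[OF n] using n
      by (intro P'.M.T.finsum_cong') (simp_all add: Pi_iff compose_eq P'.N.pt_closed v_closed Kw(2) Lk(2) u_closed hn
          P'.M.pt_closed mod_hom_closed[OF k])
    also have "\<dots> = tensor_map B L M M' k (finsum P.GM (\<lambda>i. P.M.pt (u i) (h (P.N.pt (v i) (w n)))) I)"
      by (rule addmap_finsum[OF mod_hom_addmap[OF Lk(1)] P.M.abelian_T P'.M.abelian_T finite_I, symmetric])
        (simp add: Pi_iff P.M.pt_closed u_closed hn)
    also have "\<dots> = compose (carrier N') (tensor_map B L M M' k) (compose (carrier N') (?\<Phi> N M h) w) n"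
      using n wn by (simp add: compose_eq P.transpose_def)
    finally show "?\<Phi> N' M' (compose (carrier P'.FN) k (compose (carrier P'.FN) h (tensor_map A K N' N w))) n
      = compose (carrier N') (tensor_map B L M M' k) (compose (carrier N') (?\<Phi> N M h) w) n" .
  qed (simp_all add: Pi_iff P'.transpose_def)
qed

end

section \<open>Frobenius graded superalgebras\<close>

lemma neg_diff_eq_iff: "- c - b = a \<longleftrightarrow> a + b + c = 0" for a b c :: "'g::ab_group_add"
  by (simp add: diff_eq_eq neg_eq_iff_add_eq_0 add.commute)

text \<open>Comparing degrees in \<open>\<one> x = x\<close> for homogeneous \<open>x\<close> shows
  that the component of degree zero of the unit is a left unit on homogeneous elements, hence on
  everything; applied to the unit itself it gives equality.\<close>

lemma graded_superring_one:
  assumes "graded_superring R"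
  shows "\<one>\<^bsub>R\<^esub> \<in> gr R 0"
proof -
  interpret ring R using assms by (rule graded_superring_ring)
  interpret R: graded_group R using assms by (rule graded_superring_group)
  let ?e = "hcomp R \<one>\<^bsub>R\<^esub>"
  have ec: "?e d \<in> carrier R" for d by (simp add: R.hcomp_closed)
  have "?e 0 \<otimes>\<^bsub>R\<^esub> x = x" if x: "x \<in> gr R d" for x d
  proof -
    have xc: "x \<in> carrier R" using x by (rule R.gr_carrier)
    have rm: "addmap R R (\<lambda>y. y \<otimes>\<^bsub>R\<^esub> x)" using xc by (intro addmapI) (auto simp: l_distr)
    have a: "addmap R R (\<lambda>y. hcomp R (y \<otimes>\<^bsub>R\<^esub> x) d)" "addmap R R (\<lambda>y. hcomp R y 0 \<otimes>\<^bsub>R\<^esub> x)"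
      using addmap_comp[OF rm R.addmap_hcomp] addmap_comp[OF R.addmap_hcomp rm] .
    have "hcomp R (\<one>\<^bsub>R\<^esub> \<otimes>\<^bsub>R\<^esub> x) d = ?e 0 \<otimes>\<^bsub>R\<^esub> x"
    proof (rule R.addmap_eqI[OF a abelian_group_axioms _ one_closed])
      fix c y assume y: "y \<in> gr R c"
      show "hcomp R (y \<otimes>\<^bsub>R\<^esub> x) d = hcomp R y 0 \<otimes>\<^bsub>R\<^esub> x"
        using R.hcomp_hom[OF graded_superring_mult[OF assms y x], of d] R.hcomp_hom[OF y, of 0] xc
        by auto
    qed
    then show ?thesis using xc R.hcomp_hom[OF x] by simp
  qed
  moreover have "addmap R R (\<lambda>x. ?e 0 \<otimes>\<^bsub>R\<^esub> x)"
    using ec by (intro addmapI) (auto simp: r_distr)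
  ultimately have "?e 0 \<otimes>\<^bsub>R\<^esub> \<one>\<^bsub>R\<^esub> = \<one>\<^bsub>R\<^esub>"
    using R.addmap_eqI[OF _ addmap_id abelian_group_axioms _ one_closed] by blast
  then show ?thesis using R.hcomp_gr[OF one_closed, of 0] ec by simp
qed

lemma hcomp_addmap:
  assumes "graded_group M" "graded_group N" "addmap M N f" "\<And>d x. x \<in> gr M d \<Longrightarrow> f x \<in> gr N d"
    and x: "x \<in> carrier M"
  shows "hcomp N (f x) d = f (hcomp M x d)"
proof -
  interpret M: graded_group M by fact
  interpret N: graded_group N by fact
  show ?thesis
  proof (rule M.addmap_eqI[OF addmap_comp[OF assms(3) N.addmap_hcomp] addmap_comp[OF M.addmap_hcomp assms(3)]
        N.abelian_group_axioms _ x])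
    fix c x assume "x \<in> gr M c"
    then show "hcomp N (f x) d = f (hcomp M x d)"
      using M.hcomp_hom N.hcomp_hom[OF assms(4)] addmap_zero[OF assms(3) M.abelian_group_axioms N.abelian_group_axioms]
      by auto
  qed
qed

text \<open>The component of \<open>x\<close> of degree \<open>d\<close> has the same image as
  \<open>x\<close>, so injectivity makes them equal. In this way preimages under
  \<open>\<psi>\<close> and \<open>\<rho>\<close> inherit degrees.\<close>

lemma gr_addmap_cancel:
  assumes "graded_group M" "graded_group N" "addmap M N f" "\<And>d x. x \<in> gr M d \<Longrightarrow> f x \<in> gr N d"
    and "inj_on f (carrier M)" "x \<in> carrier M" "f x \<in> gr N d"
  shows "x \<in> gr M d"
proof -
  interpret M: graded_group M by fact
  interpret N: graded_group N by fact
  have "f (hcomp M x d) = f x"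
    using hcomp_addmap[OF assms(1-4,6), of d] N.hcomp_hom[OF assms(7), of d] by simp
  then have "hcomp M x d = x" using inj_onD[OF assms(5)] M.hcomp_closed assms(6) by blast
  then show ?thesis using M.hcomp_gr[OF assms(6), of d] by simp
qed

locale frobenius_algebra =
  fixes F :: "('k, 'e) ring_scheme" and A :: "('l::ab_group_add, 'k, 'a, 'f) gmodule_scheme" (structure)
    and \<delta> :: "'l \<times> bit" and tr :: "'a \<Rightarrow> 'k" and \<psi> :: "'a \<Rightarrow> 'a"
  assumes F: "field F" and frob: "frobenius_superalgebra F A \<delta> tr"
    and nakayama: "nakayama_automorphism F A tr \<psi>"
begin

lemma superalgebra: "graded_superalgebra F A"
  using frob by (simp add: frobenius_superalgebra_def)

lemma superring: "graded_superring A"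
  using superalgebra by (simp add: graded_superalgebra_def)

sublocale F: field F by (rule F)

sublocale A: ring A by (rule graded_superring_ring[OF superring])

sublocale A: graded_group A by (rule graded_superring_group[OF superring])

sublocale FA: module F A
  using superalgebra by (simp add: graded_superalgebra_def)

lemma smult_mult: 
  assumes "c \<in> carrier F" "x \<in> carrier A" "y \<in> carrier A"
  shows "(c \<odot> x) \<otimes> y = c \<odot> (x \<otimes> y)" "x \<otimes> (c \<odot> y) = c \<odot> (x \<otimes> y)"
  using superalgebra assms by (auto simp: graded_superalgebra_def)

lemma mult_gr: "x \<in> gr A d \<Longrightarrow> y \<in> gr A e \<Longrightarrow> x \<otimes> y \<in> gr A (d + e)"
  using graded_superring_mult[OF superring] .

lemma one_gr: "\<one> \<in> gr A 0"
  using graded_superring_one[OF superring] .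

lemma smult_gr: "c \<in> carrier F \<Longrightarrow> x \<in> gr A d \<Longrightarrow> c \<odot> x \<in> gr A d"
  using superalgebra by (auto simp: graded_superalgebra_def)

lemma addmap_mult_left: "x \<in> carrier A \<Longrightarrow> addmap A A (\<lambda>y. x \<otimes> y)"
  by (intro addmapI) (auto simp: A.r_distr)

lemma addmap_mult_right: "y \<in> carrier A \<Longrightarrow> addmap A A (\<lambda>x. x \<otimes> y)"
  by (intro addmapI) (auto simp: A.l_distr)

lemma tr_closed: "x \<in> carrier A \<Longrightarrow> tr x \<in> carrier F"
  using frob by (auto simp: frobenius_superalgebra_def)

lemma addmap_tr: "addmap A F tr"
  using frob by (auto simp: frobenius_superalgebra_def addmap_def)

lemma tr_smult: "c \<in> carrier F \<Longrightarrow> x \<in> carrier A \<Longrightarrow> tr (c \<odot> x) = c \<otimes>\<^bsub>F\<^esub> tr x"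
  using frob by (auto simp: frobenius_superalgebra_def)

lemma tr_gr: "x \<in> gr A d \<Longrightarrow> d + \<delta> \<noteq> 0 \<Longrightarrow> tr x = \<zero>\<^bsub>F\<^esub>"
  using frob unfolding frobenius_superalgebra_def by (metis singletonD)

lemma tr_zero: "tr \<zero> = \<zero>\<^bsub>F\<^esub>"
  using addmap_zero[OF addmap_tr A.abelian_group_axioms F.abelian_group_axioms] .

lemma automorphism: "graded_automorphism A \<psi>"
  using nakayama by (simp add: nakayama_automorphism_def)

lemma bij_\<psi>: "bij_betw \<psi> (carrier A) (carrier A)"
  using automorphism by (simp add: graded_automorphism_def ring_iso_def)

lemma \<psi>_closed: "x \<in> carrier A \<Longrightarrow> \<psi> x \<in> carrier A"
  using bij_betwE[OF bij_\<psi>] by blast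

lemma \<psi>_mult: "x \<in> carrier A \<Longrightarrow> y \<in> carrier A \<Longrightarrow> \<psi> (x \<otimes> y) = \<psi> x \<otimes> \<psi> y"
  using automorphism by (simp add: graded_automorphism_def ring_iso_def ring_hom_def)

lemma \<psi>_one: "\<psi> \<one> = \<one>"
  using automorphism by (simp add: graded_automorphism_def ring_iso_def ring_hom_def)

lemma addmap_\<psi>: "addmap A A \<psi>"
  using automorphism \<psi>_closed by (auto simp: graded_automorphism_def ring_iso_def ring_hom_def addmap_def)

lemma \<psi>_gr: "x \<in> gr A d \<Longrightarrow> \<psi> x \<in> gr A d"
  using automorphism by (simp add: graded_automorphism_def)

lemma \<psi>_smult: "c \<in> carrier F \<Longrightarrow> x \<in> carrier A \<Longrightarrow> \<psi> (c \<odot> x) = c \<odot> \<psi> x"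
  using nakayama by (simp add: nakayama_automorphism_def)

lemma \<psi>_inj: "x \<in> carrier A \<Longrightarrow> y \<in> carrier A \<Longrightarrow> \<psi> x = \<psi> y \<Longrightarrow> x = y"
  using bij_\<psi> by (auto simp: bij_betw_def inj_on_def)

lemma \<psi>_surj: "y \<in> carrier A \<Longrightarrow> \<exists>x\<in>carrier A. y = \<psi> x"
  using bij_\<psi> by (auto simp: bij_betw_def)

lemma \<psi>_gr_cancel: "x \<in> carrier A \<Longrightarrow> \<psi> x \<in> gr A d \<Longrightarrow> x \<in> gr A d"
  using gr_addmap_cancel[OF A.graded_group_axioms A.graded_group_axioms addmap_\<psi> \<psi>_gr] bij_\<psi>
  by (auto simp: bij_betw_def)

lemma \<psi>_surj_gr: "y \<in> gr A d \<Longrightarrow> \<exists>x\<in>gr A d. y = \<psi> x"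
  using \<psi>_surj[OF A.gr_carrier] \<psi>_gr_cancel by metis

lemma tr_mult: "x \<in> gr A d \<Longrightarrow> y \<in> gr A e \<Longrightarrow>
    tr (x \<otimes> y) = sgn_mult F (snd d * snd e) (tr (y \<otimes> \<psi> x))"
  using nakayama unfolding nakayama_automorphism_def by blast

lemma tr_mult_hom: "x \<in> gr A d \<Longrightarrow> y \<in> gr A e \<Longrightarrow> d + e + \<delta> \<noteq> 0 \<Longrightarrow> tr (x \<otimes> y) = \<zero>\<^bsub>F\<^esub>"
  using tr_gr[OF mult_gr] .

text \<open>The left ideal \<open>A y\<close> lies in the kernel of the trace, and it contains
  \<open>y\<close> because \<open>A\<close> has a unit.\<close>

lemma right_nondegenerate:
  assumes y: "y \<in> carrier A" and "\<And>x. x \<in> carrier A \<Longrightarrow> tr (x \<otimes> y) = \<zero>\<^bsub>F\<^esub>"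
  shows "y = \<zero>"
proof -
  let ?I = "(\<lambda>x. x \<otimes> y) ` carrier A"
  have "subgroup ?I (add_monoid A)"
  proof (rule A.add.subgroupI)
    show "?I \<noteq> {}" using A.zero_closed by blast
    show "\<ominus> a \<in> ?I" if "a \<in> ?I" for a
    proof -
      obtain x where "x \<in> carrier A" "a = x \<otimes> y" using \<open>a \<in> ?I\<close> by blast
      then show ?thesis using y by (intro image_eqI[of _ _ "\<ominus> x"]) (auto simp: A.l_minus)
    qed
    show "a \<oplus> b \<in> ?I" if "a \<in> ?I" "b \<in> ?I" for a b
    proof -
      obtain x z where "x \<in> carrier A" "a = x \<otimes> y" "z \<in> carrier A" "b = z \<otimes> y"
        using \<open>a \<in> ?I\<close> \<open>b \<in> ?I\<close> by blast
      then show ?thesis using y by (intro image_eqI[of _ _ "x \<oplus> z"]) (auto simp: A.l_distr)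
    qed
  qed (use y in auto)
  moreover have "r \<otimes> a \<in> ?I" if r: "r \<in> carrier A" and "a \<in> ?I" for r a
  proof -
    obtain x where "x \<in> carrier A" "a = x \<otimes> y" using \<open>a \<in> ?I\<close> by blast
    then show ?thesis using y r by (intro image_eqI[of _ _ "r \<otimes> x"]) (auto simp: A.m_assoc)
  qed
  ultimately have "left_ideal ?I A" by (simp add: left_ideal_def additive_subgroup_def)
  moreover have "?I \<subseteq> {x \<in> carrier A. tr x = \<zero>\<^bsub>F\<^esub>}" using assms by auto
  ultimately have "?I = {\<zero>}" using frob unfolding frobenius_superalgebra_def by blast
  moreover have "y \<in> ?I" using y by (intro image_eqI[of _ _ "\<one>"]) auto
  ultimately show ?thesis by blast
qed

lemma right_cancel:
  assumes "y \<in> carrier A" "z \<in> carrier A"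
    and "\<And>x d. x \<in> gr A d \<Longrightarrow> tr (x \<otimes> y) = tr (x \<otimes> z)"
  shows "y = z"
proof -
  have eq: "tr (x \<otimes> y) = tr (x \<otimes> z)" if "x \<in> carrier A" for x
    by (rule A.addmap_eqI[OF addmap_comp[OF addmap_mult_right[OF assms(1)] addmap_tr]
          addmap_comp[OF addmap_mult_right[OF assms(2)] addmap_tr] F.abelian_group_axioms assms(3) that])
  have "y \<ominus> z = \<zero>"
  proof (rule right_nondegenerate)
    fix x assume x: "x \<in> carrier A"
    have "tr (x \<otimes> (y \<ominus> z)) = tr (x \<otimes> y) \<ominus>\<^bsub>F\<^esub> tr (x \<otimes> z)"
      by (rule addmap_minus[OF addmap_comp[OF addmap_mult_left[OF x] addmap_tr] A.abelian_group_axioms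
            F.abelian_group_axioms assms(1,2)])
    then show "tr (x \<otimes> (y \<ominus> z)) = \<zero>\<^bsub>F\<^esub>"
      using eq[OF x] x assms by (simp add: tr_closed)
  qed (use assms in auto)
  then show ?thesis using assms(1,2) A.eq_of_minus_zero by blast
qed

text \<open>Only one homogeneous component of \<open>x\<close> pairs with a homogeneous \<open>y\<close>; for this component the
  Nakayama automorphism turns the pairing around.\<close>

lemma left_nondegenerate:
  assumes x: "x \<in> carrier A" and 0: "\<And>y. y \<in> carrier A \<Longrightarrow> tr (x \<otimes> y) = \<zero>\<^bsub>F\<^esub>"
  shows "x = \<zero>"
proof -
  have pick: "tr (x \<otimes> y) = tr (hcomp A x (- \<delta> - e) \<otimes> y)"
    if x: "x \<in> carrier A" and y: "y \<in> gr A e" for x y e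
  proof -
    note yc = A.gr_carrier[OF y]
    note am = addmap_comp[OF addmap_mult_right[OF yc] addmap_tr]
    show ?thesis
    proof (rule A.addmap_eqI[OF am addmap_comp[OF A.addmap_hcomp am] F.abelian_group_axioms _ x])
      fix c x assume x: "x \<in> gr A c"
      show "tr (x \<otimes> y) = tr (hcomp A x (- \<delta> - e) \<otimes> y)"
      proof (cases "c + e + \<delta> = 0")
        case True
        then have "- \<delta> - e = c" unfolding neg_diff_eq_iff .
        then show ?thesis using A.hcomp_hom[OF x, of c] by simp
      next
        case False
        then have "- \<delta> - e \<noteq> c" unfolding neg_diff_eq_iff .
        then show ?thesis using tr_mult_hom[OF x y False] A.hcomp_hom[OF x, of "- \<delta> - e"] yc tr_zero by simp
      qed
    qed
  qed
  have z: "hcomp A x d = \<zero>" for d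
  proof -
    let ?x = "hcomp A x d"
    have xg: "?x \<in> gr A d" by (rule A.hcomp_gr[OF x])
    have xc: "?x \<in> carrier A" by (rule A.hcomp_closed[OF x])
    have "\<psi> ?x = \<zero>"
    proof (rule right_cancel[OF \<psi>_closed[OF xc] A.zero_closed])
      fix y e assume y: "y \<in> gr A e"
      note yc = A.gr_carrier[OF y]
      have "tr (?x \<otimes> y) = \<zero>\<^bsub>F\<^esub>"
      proof (cases "d + e + \<delta> = 0")
        case True
        then have "- \<delta> - e = d" unfolding neg_diff_eq_iff .
        then show ?thesis using pick[OF x y] 0[OF yc] by simp
      qed (rule tr_mult_hom[OF xg y])
      then have "sgn_mult F (snd d * snd e) (tr (y \<otimes> \<psi> ?x)) = \<zero>\<^bsub>F\<^esub>"
        using tr_mult[OF xg y] by simp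
      then have "tr (y \<otimes> \<psi> ?x) = \<zero>\<^bsub>F\<^esub>"
        using tr_closed[OF A.m_closed[OF yc \<psi>_closed[OF xc]]] F.minus_minus[of "tr (y \<otimes> \<psi> ?x)"]
        by (auto simp: sgn_mult_def split: if_splits)
      then show "tr (y \<otimes> \<psi> ?x) = tr (y \<otimes> \<zero>)" using yc tr_zero by simp
    qed
    then show ?thesis
      using \<psi>_inj[OF xc A.zero_closed] addmap_zero[OF addmap_\<psi> A.abelian_group_axioms A.abelian_group_axioms] by simp
  qed
  then have "hsupp A x = {}" by (simp add: hsupp_def)
  then show ?thesis using A.hcomp_sum[OF x] by simp
qed

section \<open>Representation of linear forms by the trace\<close>

definition linear_form :: "('a \<Rightarrow> 'k) \<Rightarrow> bool" where
  "linear_form \<phi> \<longleftrightarrow> addmap A F \<phi> \<and> (\<forall>c\<in>carrier F. \<forall>x\<in>carrier A. \<phi> (c \<odot> x) = c \<otimes>\<^bsub>F\<^esub> \<phi> x)"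

lemma linear_form_tr: "y \<in> carrier A \<Longrightarrow> linear_form (\<lambda>x. tr (x \<otimes> y))"
  using addmap_comp[OF addmap_mult_right addmap_tr] by (simp add: linear_form_def smult_mult tr_smult)

text \<open>\<open>tame P\<close> says that the transpose of \<open>P\<close> maps every linear form into the image of
  \<open>y \<mapsto> (x \<mapsto> tr (x y))\<close>. Such maps fixing more and more generators are built one generator at a
  time; once all generators are fixed, \<open>P\<close> is the identity.\<close>

definition tame :: "('a \<Rightarrow> 'a) \<Rightarrow> bool" where
  "tame P \<longleftrightarrow> addmap A A P \<and> (\<forall>c\<in>carrier F. \<forall>x\<in>carrier A. P (c \<odot> x) = c \<odot> P x) \<and>
     (\<forall>\<phi>. linear_form \<phi> \<longrightarrow> (\<exists>y\<in>carrier A. \<forall>x\<in>carrier A. \<phi> (P x) = tr (x \<otimes> y)))"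

lemma tame_fixing:
  assumes "finite S" "S \<subseteq> carrier A"
  shows "\<exists>P. tame P \<and> (\<forall>s\<in>S. P s = s)"
  using assms
proof (induction S rule: finite_induct)
  case empty
  have "tame (\<lambda>x. \<zero>)"
    unfolding tame_def linear_form_def
  proof (intro conjI allI impI ballI)
    fix \<phi> assume "addmap A F \<phi> \<and> (\<forall>c\<in>carrier F. \<forall>x\<in>carrier A. \<phi> (c \<odot> x) = c \<otimes>\<^bsub>F\<^esub> \<phi> x)"
    then have "\<phi> \<zero> = \<zero>\<^bsub>F\<^esub>"
      using addmap_zero[OF _ A.abelian_group_axioms F.abelian_group_axioms] by blast
    then show "\<exists>y\<in>carrier A. \<forall>x\<in>carrier A. \<phi> \<zero> = tr (x \<otimes> y)"
      using tr_zero by (intro bexI[of _ "\<zero>"]) auto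
  qed (auto simp: addmap_def FA.smult_r_null)
  then show ?case by blast
next
  case (insert t S)
  then obtain P where P: "tame P" and PS: "\<forall>s\<in>S. P s = s" by blast
  have t: "t \<in> carrier A" and S: "S \<subseteq> carrier A" using insert.prems by auto
  have Pa: "addmap A A P" and Pl: "\<And>c x. c \<in> carrier F \<Longrightarrow> x \<in> carrier A \<Longrightarrow> P (c \<odot> x) = c \<odot> P x"
    and Pf: "\<And>\<phi>. linear_form \<phi> \<Longrightarrow> \<exists>y\<in>carrier A. \<forall>x\<in>carrier A. \<phi> (P x) = tr (x \<otimes> y)"
    using P by (auto simp: tame_def)
  note Pc = addmap_closed[OF Pa]
  \<comment> \<open>The defect of \<open>P\<close> at the new generator. When it is nonzero, left
    nondegeneracy provides an element pairing nontrivially with it, and a correction of rank one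
    repairs \<open>P\<close> at \<open>t\<close>.\<close>
  define t' where "t' = t \<ominus> P t"
  have t': "t' \<in> carrier A" using t Pc by (simp add: t'_def)
  show ?case
  proof (cases "t' = \<zero>")
    case True
    then have "P t = t" using A.eq_of_minus_zero[OF t Pc[OF t]] by (simp add: t'_def)
    then show ?thesis using P PS by blast
  next
    case False
    then obtain z where z: "z \<in> carrier A" "tr (t' \<otimes> z) \<noteq> \<zero>\<^bsub>F\<^esub>"
      using left_nondegenerate[OF t'] by blast
    define k where "k = tr (t' \<otimes> z)"
    have "k \<in> Units F" using z t' by (simp add: k_def F.field_Units tr_closed)
    then have k: "inv\<^bsub>F\<^esub> k \<in> carrier F" "inv\<^bsub>F\<^esub> k \<otimes>\<^bsub>F\<^esub> k = \<one>\<^bsub>F\<^esub>" by auto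
    define y where "y = inv\<^bsub>F\<^esub> k \<odot> z"
    have y: "y \<in> carrier A" using k z by (simp add: y_def)
    have ty: "tr (t' \<otimes> y) = \<one>\<^bsub>F\<^esub>"
      using k z t' by (simp add: y_def smult_mult tr_smult k_def[symmetric])
    \<comment> \<open>This form vanishes on every element fixed by \<open>P\<close> and takes the
      value one at \<open>t\<close>, as \<open>y\<close> is normalised against \<open>t'\<close>.
      Both of its terms are represented by the trace, the second because \<open>P\<close> is tame,
      so the form is represented as well.\<close>
    define \<chi> where "\<chi> x = tr (x \<otimes> y) \<ominus>\<^bsub>F\<^esub> tr (P x \<otimes> y)" for x
    have \<chi>: "\<chi> x = tr ((x \<ominus> P x) \<otimes> y)" if "x \<in> carrier A" for x
      unfolding \<chi>_def
      by (rule addmap_minus[OF addmap_comp[OF addmap_mult_right[OF y] addmap_tr] A.abelian_group_axioms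
            F.abelian_group_axioms that Pc[OF that], symmetric])
    obtain w where w: "w \<in> carrier A" "\<forall>x\<in>carrier A. tr (P x \<otimes> y) = tr (x \<otimes> w)"
      using Pf[OF linear_form_tr[OF y]] by blast
    have \<chi>w: "\<chi> x = tr (x \<otimes> (y \<ominus> w))" if "x \<in> carrier A" for x
    proof -
      have "\<chi> x = tr (x \<otimes> y) \<ominus>\<^bsub>F\<^esub> tr (x \<otimes> w)" using w that by (simp add: \<chi>_def)
      then show ?thesis
        using addmap_minus[OF addmap_comp[OF addmap_mult_left[OF that] addmap_tr] A.abelian_group_axioms
            F.abelian_group_axioms y w(1)] by simp
    qed
    have yw: "y \<ominus> w \<in> carrier A" using y w by simp
    have \<chi>c: "\<chi> x \<in> carrier F" if "x \<in> carrier A" for x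
      using that yw by (simp add: \<chi>w tr_closed)
    have \<chi>a: "\<chi> (x \<oplus> x') = \<chi> x \<oplus>\<^bsub>F\<^esub> \<chi> x'" if "x \<in> carrier A" "x' \<in> carrier A" for x x'
      using that yw by (simp add: \<chi>w A.l_distr addmap_add[OF addmap_tr])
    have \<chi>s: "\<chi> (c \<odot> x) = c \<otimes>\<^bsub>F\<^esub> \<chi> x" if "c \<in> carrier F" "x \<in> carrier A" for c x
      using that yw by (simp add: \<chi>w smult_mult tr_smult)
    \<comment> \<open>Adding \<open>\<chi> x\<close> times \<open>t'\<close> leaves the generators
      already fixed alone and moves \<open>P t\<close> to \<open>t\<close>.\<close>
    define Q where "Q x = P x \<oplus> \<chi> x \<odot> t'" for x
    have Qa: "addmap A A Q"
      by (intro addmapI) (simp_all add: Q_def Pc \<chi>c t' addmap_add[OF Pa] \<chi>a FA.smult_l_distr A.a_ac)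
    have Ql: "Q (c \<odot> x) = c \<odot> Q x" if "c \<in> carrier F" "x \<in> carrier A" for c x
      using that t' by (simp add: Q_def Pl \<chi>s \<chi>c Pc FA.smult_r_distr FA.smult_assoc1)
    have Qf: "\<exists>y\<in>carrier A. \<forall>x\<in>carrier A. \<phi> (Q x) = tr (x \<otimes> y)" if \<phi>: "linear_form \<phi>" for \<phi>
    proof -
      have \<phi>a: "addmap A F \<phi>" and \<phi>s: "\<And>c x. c \<in> carrier F \<Longrightarrow> x \<in> carrier A \<Longrightarrow> \<phi> (c \<odot> x) = c \<otimes>\<^bsub>F\<^esub> \<phi> x"
        using \<phi> by (auto simp: linear_form_def)
      obtain q where q: "q \<in> carrier A" "\<forall>x\<in>carrier A. \<phi> (P x) = tr (x \<otimes> q)"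
        using Pf[OF \<phi>] by blast
      have \<phi>t: "\<phi> t' \<in> carrier F" using addmap_closed[OF \<phi>a t'] .
      let ?y = "q \<oplus> \<phi> t' \<odot> (y \<ominus> w)"
      have "\<phi> (Q x) = tr (x \<otimes> ?y)" if x: "x \<in> carrier A" for x
      proof -
        have "\<phi> (Q x) = tr (x \<otimes> q) \<oplus>\<^bsub>F\<^esub> \<chi> x \<otimes>\<^bsub>F\<^esub> \<phi> t'"
          using x q t' by (simp add: Q_def addmap_add[OF \<phi>a] Pc \<chi>c \<phi>s)
        also have "\<chi> x \<otimes>\<^bsub>F\<^esub> \<phi> t' = tr (x \<otimes> (\<phi> t' \<odot> (y \<ominus> w)))"
          using x yw \<phi>t by (simp add: \<chi>w smult_mult tr_smult F.m_comm tr_closed)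
        finally show ?thesis
          using x yw \<phi>t q by (simp add: A.r_distr addmap_add[OF addmap_tr])
      qed
      then show ?thesis using q yw \<phi>t by (intro bexI[of _ ?y]) auto
    qed
    have "tame Q" using Qa Ql Qf by (simp add: tame_def)
    moreover have "Q s = s" if "s \<in> S" for s
    proof -
      have s: "s \<in> carrier A" "P s = s" using that S PS by auto
      then have "\<chi> s = \<zero>\<^bsub>F\<^esub>" using \<chi>[of s] y tr_zero by (simp add: a_minus_def A.r_neg)
      then show ?thesis using s t' by (simp add: Q_def FA.smult_l_null)
    qed
    moreover have "Q t = t"
    proof -
      have "\<chi> t = \<one>\<^bsub>F\<^esub>" using \<chi>[OF t] ty by (simp add: t'_def)
      then have "Q t = P t \<oplus> (t \<ominus> P t)" using t' by (simp add: Q_def t'_def)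
      also have "\<dots> = t" using t Pc[OF t] by (simp add: a_minus_def A.a_ac A.r_neg A.r_neg1 A.r_neg2)
      finally show ?thesis .
    qed
    ultimately show ?thesis by blast
  qed
qed

text \<open>A tame map that fixes a spanning set is the identity, and tameness of the identity is
  the assertion. This takes the place of comparing the dimensions of \<open>A\<close> and of its
  dual.\<close>

lemma linear_form_representable:
  assumes "linear_form \<phi>"
  shows "\<exists>y\<in>carrier A. \<forall>x\<in>carrier A. \<phi> x = tr (x \<otimes> y)"
proof -
  have "finitely_generated F A" using frob by (simp add: frobenius_superalgebra_def)
  then obtain S where S: "finite S" "S \<subseteq> carrier A"
    and gen: "\<And>x. x \<in> carrier A \<Longrightarrow> \<exists>c. c \<in> S \<rightarrow> carrier F \<and> x = (\<Oplus>s\<in>S. c s \<odot> s)"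
    unfolding finitely_generated_def by blast
  obtain P where P: "tame P" "\<forall>s\<in>S. P s = s" using tame_fixing[OF S] by blast
  have "P x = x" if x: "x \<in> carrier A" for x
  proof -
    obtain c where c: "c \<in> S \<rightarrow> carrier F" "x = (\<Oplus>s\<in>S. c s \<odot> s)" using gen[OF x] by blast
    have cs: "c s \<in> carrier F" "s \<in> carrier A" if "s \<in> S" for s using c(1) S(2) that by auto
    have Pa: "addmap A A P" using P(1) by (simp add: tame_def)
    have "P x = (\<Oplus>s\<in>S. P (c s \<odot> s))"
      unfolding c(2) using cs
      by (intro addmap_finsum[OF Pa A.abelian_group_axioms A.abelian_group_axioms S(1)]) auto
    also have "\<dots> = x"
      unfolding c(2) using cs P by (intro A.finsum_cong') (auto simp: tame_def)
    finally show ?thesis .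
  qed
  moreover obtain y where "y \<in> carrier A" "\<forall>x\<in>carrier A. \<phi> (P x) = tr (x \<otimes> y)"
    using P(1) assms unfolding tame_def by blast
  ultimately show ?thesis by auto
qed

text \<open>A homogeneous \<open>x\<close> of degree \<open>d\<close> pairs only with the component
  of \<open>y\<close> in degree \<open>- d - \<delta>\<close>. A form living in degrees with
  \<open>d + c = 0\<close> therefore sees just the component in degree \<open>c - \<delta>\<close>,
  and cancellation identifies \<open>y\<close> with it.\<close>

lemma linear_form_representable_gr:
  assumes "y \<in> carrier A" "\<And>x d. x \<in> gr A d \<Longrightarrow> d + c \<noteq> 0 \<Longrightarrow> tr (x \<otimes> y) = \<zero>\<^bsub>F\<^esub>"
  shows "y \<in> gr A (c - \<delta>)"
proof -
  let ?y = "hcomp A y (c - \<delta>)"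
  have yc: "?y \<in> carrier A" and yg: "?y \<in> gr A (c - \<delta>)" using A.hcomp_closed[OF assms(1)] A.hcomp_gr[OF assms(1)] by auto
  have "y = ?y"
  proof (rule right_cancel[OF assms(1) yc])
    fix x d assume x: "x \<in> gr A d"
    note xc = A.gr_carrier[OF x]
    show "tr (x \<otimes> y) = tr (x \<otimes> ?y)"
    proof (cases "d + c = 0")
      case False
      then have "d + (c - \<delta>) + \<delta> \<noteq> 0" by (simp add: algebra_simps)
      then show ?thesis using assms(2)[OF x False] tr_mult_hom[OF x yg] by simp
    next
      case True
      note am = addmap_comp[OF addmap_mult_left[OF xc] addmap_tr]
      show ?thesis
      proof (rule A.addmap_eqI[OF am addmap_comp[OF A.addmap_hcomp am] F.abelian_group_axioms _ assms(1)])
        fix e y assume y: "y \<in> gr A e"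
        show "tr (x \<otimes> y) = tr (x \<otimes> hcomp A y (c - \<delta>))"
        proof (cases "e = c - \<delta>")
          case True then show ?thesis using A.hcomp_hom[OF y, of "c - \<delta>"] by simp
        next
          case False
          then have "d + e + \<delta> \<noteq> 0" using True
            by (metis add.assoc add_left_cancel add_diff_cancel_right')
          then show ?thesis using False A.hcomp_hom[OF y, of "c - \<delta>"] tr_mult_hom[OF x y] xc tr_zero by simp
        qed
      qed
    qed
  qed
  then show ?thesis using yg by simp
qed

end

text \<open>Exponents of signs stay sums and products in the ring of two elements, so that
  distributivity applies to them.\<close>

declare add_bit_eq_xor [simp del] mult_bit_eq_and [simp del]

section \<open>The Frobenius homomorphism of a pair of Frobenius superalgebras\<close>

lemma sub_structure_simps [simp]:
  "carrier (sub_structure A B) = B"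
  "monoid.mult (sub_structure A B) = monoid.mult A" "one (sub_structure A B) = one A"
  "ring.zero (sub_structure A B) = ring.zero A" "ring.add (sub_structure A B) = ring.add A"
  "smult (sub_structure A B) = smult A" "gr (sub_structure A B) d = gr A d \<inter> B"
  by (simp_all add: sub_structure_def)

lemma twisted_bimodule_simps [simp]:
  "carrier (twisted_bimodule A \<beta> \<alpha>) = carrier A"
  "ring.zero (twisted_bimodule A \<beta> \<alpha>) = ring.zero A" "ring.add (twisted_bimodule A \<beta> \<alpha>) = ring.add A"
  "smult (twisted_bimodule A \<beta> \<alpha>) = (\<lambda>b x. \<beta> b \<otimes>\<^bsub>A\<^esub> x)" "gr (twisted_bimodule A \<beta> \<alpha>) = gr A"
  "rsmult (twisted_bimodule A \<beta> \<alpha>) = (\<lambda>x a. x \<otimes>\<^bsub>A\<^esub> \<alpha> a)"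
  by (simp_all add: twisted_bimodule_def)

lemma shift_simps [simp]:
  "carrier (shift R \<delta> M) = carrier M"
  "ring.zero (shift R \<delta> M) = ring.zero M" "ring.add (shift R \<delta> M) = ring.add M"
  "rsmult (shift R \<delta> M) = rsmult M"
  by (simp_all add: shift_def)

text \<open>The definition subtracts in the first coordinate and adds in the second; for parities
  these are the same, so the shift becomes a single subtraction of degrees.\<close>

lemma gr_shift: "gr (shift R \<delta> M) d = gr M (d - \<delta>)"
proof -
  obtain l p m q where "\<delta> = (l, p)" "d = (m, q)" by (cases \<delta>; cases d)
  then show ?thesis by (cases p; cases q) (simp_all add: shift_def)
qed

lemma sgn_mult_cong_struct:
  assumes "carrier N = carrier M" "ring.zero N = ring.zero M" "ring.add N = ring.add M"
  shows "sgn_mult N = sgn_mult M"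
  by (simp add: fun_eq_iff sgn_mult_def a_inv_cong_struct[OF assms])

locale frobenius_pair =
  fixes F :: "('k, 'e) ring_scheme" and A :: "('l::ab_group_add, 'k, 'a) gmodule" (structure) and B :: "'a set"
    and tr\<^sub>A tr\<^sub>B :: "'a \<Rightarrow> 'k" and \<psi>\<^sub>A \<psi>\<^sub>B :: "'a \<Rightarrow> 'a" and l\<^sub>A l\<^sub>B :: 'l and p\<^sub>A p\<^sub>B :: bit
  assumes F: "field F"
    and frobA: "frobenius_superalgebra F A (- l\<^sub>A, p\<^sub>A) tr\<^sub>A"
    and nakA: "nakayama_automorphism F A tr\<^sub>A \<psi>\<^sub>A"
    and subalgebra: "graded_subalgebra F B A"
    and frobB: "frobenius_superalgebra F (sub_structure A B) (- l\<^sub>B, p\<^sub>B) tr\<^sub>B"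
    and nakB: "nakayama_automorphism F (sub_structure A B) tr\<^sub>B \<psi>\<^sub>B"
begin

abbreviation "B' \<equiv> sub_structure A B"

sublocale A: frobenius_algebra F A "(- l\<^sub>A, p\<^sub>A)" tr\<^sub>A \<psi>\<^sub>A
  by (rule frobenius_algebra.intro[OF F frobA nakA])

sublocale B: frobenius_algebra F B' "(- l\<^sub>B, p\<^sub>B)" tr\<^sub>B \<psi>\<^sub>B
  by (rule frobenius_algebra.intro[OF F frobB nakB])

text \<open>The degree of \<open>E\<close>. Since \<open>tr\<^sub>B (E x) = tr\<^sub>A x\<close>
  will hold, it has to be the degree of \<open>tr\<^sub>A\<close> minus that of
  \<open>tr\<^sub>B\<close>; subtracting parities amounts to adding them.\<close>

definition "\<delta> = (l\<^sub>B - l\<^sub>A, p\<^sub>B + p\<^sub>A)"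

lemma \<delta>: "(- l\<^sub>A, p\<^sub>A) - (- l\<^sub>B, p\<^sub>B) = \<delta>"
proof -
  have "p - q = q + p" for p q :: bit by (cases p; cases q) simp_all
  then show ?thesis unfolding \<delta>_def by (simp only: diff_Pair minus_diff_minus minus_diff_eq)
qed

lemma B_subset: "B \<subseteq> carrier A"
  using subalgebra subringE(1) by (auto simp: graded_subalgebra_def graded_subring_def)

lemma B_A: "b \<in> B \<Longrightarrow> b \<in> carrier A"
  using B_subset by auto

lemma grB: "b \<in> gr B' d \<Longrightarrow> b \<in> gr A d" "b \<in> gr B' d \<Longrightarrow> b \<in> B"
  by auto

lemma B_closed:
  "b \<in> B \<Longrightarrow> c \<in> B \<Longrightarrow> b \<otimes> c \<in> B" "b \<in> B \<Longrightarrow> c \<in> B \<Longrightarrow> b \<oplus> c \<in> B" "\<one> \<in> B" "\<zero> \<in> B"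
  "b \<in> B \<Longrightarrow> \<psi>\<^sub>B b \<in> B" "k \<in> carrier F \<Longrightarrow> b \<in> B \<Longrightarrow> k \<odot> b \<in> B"
  using B.A.m_closed B.A.a_closed B.A.one_closed B.A.zero_closed B.\<psi>_closed B.FA.smult_closed by simp_all

lemma incl: "addmap B' A (\<lambda>b. b)"
  by (intro addmapI) (auto simp: B_A)

lemma sgn_B: "b \<in> B \<Longrightarrow> sgn_mult B' q b = sgn_mult A q b"
  using addmap_sgn[OF incl B.A.abelian_group_axioms A.A.abelian_group_axioms] by simp

lemma sgn_B_closed: "b \<in> B \<Longrightarrow> sgn_mult A q b \<in> B"
  using B.A.sgn_mult_closed[of b q] by (simp add: sgn_B)

lemma sgn_mult_mult:
  assumes "x \<in> carrier A" "y \<in> carrier A"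
  shows "sgn_mult A q x \<otimes> y = sgn_mult A q (x \<otimes> y)" "x \<otimes> sgn_mult A q y = sgn_mult A q (x \<otimes> y)"
  using addmap_sgn[OF A.addmap_mult_right[OF assms(2)] A.A.abelian_group_axioms A.A.abelian_group_axioms assms(1)]
    addmap_sgn[OF A.addmap_mult_left[OF assms(1)] A.A.abelian_group_axioms A.A.abelian_group_axioms assms(2)] by auto

lemma tr_sgn: "x \<in> carrier A \<Longrightarrow> tr\<^sub>A (sgn_mult A q x) = sgn_mult F q (tr\<^sub>A x)"
  using addmap_sgn[OF A.addmap_tr A.A.abelian_group_axioms A.F.abelian_group_axioms] .

text \<open>The left action on the shifted twisted bimodule is multiplication by \<open>\<rho> b\<close>; absorbing the
  sign of the shift into \<open>\<rho>\<close> makes the Frobenius homomorphism \<open>E\<close> below strictly linear.\<close>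

definition \<rho> :: "'a \<Rightarrow> 'a" where
  "\<rho> b = finsum B' (\<lambda>d. sgn_mult B' (snd \<delta> * snd d) (\<psi>\<^sub>B (hcomp B' b d))) (hsupp B' b)"

lemma addmap_\<rho>: "addmap B' B' \<rho>"
  unfolding \<rho>_def
  by (rule B.A.addmap_gext(1)[OF B.A.abelian_group_axioms addmap_comp[OF B.addmap_\<psi> B.A.addmap_sgn_mult]])

lemma \<rho>_closed: "b \<in> B \<Longrightarrow> \<rho> b \<in> B"
  using addmap_closed[OF addmap_\<rho>] by simp

lemma \<rho>_A: "b \<in> B \<Longrightarrow> \<rho> b \<in> carrier A"
  using \<rho>_closed B_A by blast

lemma \<rho>_hom:
  assumes "b \<in> gr B' d" shows "\<rho> b = sgn_mult A (snd \<delta> * snd d) (\<psi>\<^sub>B b)"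
proof -
  have "\<rho> b = sgn_mult B' (snd \<delta> * snd d) (\<psi>\<^sub>B b)"
    unfolding \<rho>_def
    by (rule B.A.addmap_gext(2)[where f = "\<lambda>d b. sgn_mult B' (snd \<delta> * snd d) (\<psi>\<^sub>B b)",
          OF B.A.abelian_group_axioms addmap_comp[OF B.addmap_\<psi> B.A.addmap_sgn_mult] assms])
  then show ?thesis using sgn_B B_closed(5) grB(2)[OF assms] by simp
qed

lemma \<rho>_gr: "b \<in> gr B' d \<Longrightarrow> \<rho> b \<in> gr B' d"
  using B.\<psi>_gr B.A.sgn_mult_gr[OF B.\<psi>_gr] sgn_B[OF B_closed(5)[OF grB(2)]] by (simp only: \<rho>_hom)

lemma \<rho>_one: "\<rho> \<one> = \<one>"
  using \<rho>_hom[of "\<one>" 0] B.one_gr B.\<psi>_one by simp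

text \<open>The exponent of the sign in \<open>\<rho>\<close> is additive in the degree, hence the
  sign is multiplicative.\<close>

lemma \<rho>_mult:
  assumes "b \<in> B" "c \<in> B" shows "\<rho> (b \<otimes> c) = \<rho> b \<otimes> \<rho> c"
proof -
  have r: "addmap B' B' (\<lambda>b. \<rho> (b \<otimes>\<^bsub>B'\<^esub> c))" "addmap B' B' (\<lambda>b. \<rho> b \<otimes>\<^bsub>B'\<^esub> \<rho> c)" if "c \<in> B" for c
    using addmap_comp[OF B.addmap_mult_right addmap_\<rho>] addmap_comp[OF addmap_\<rho> B.addmap_mult_right] that \<rho>_closed
    by simp_all
  have l: "addmap B' B' (\<lambda>c. \<rho> (b \<otimes>\<^bsub>B'\<^esub> c))" "addmap B' B' (\<lambda>c. \<rho> b \<otimes>\<^bsub>B'\<^esub> \<rho> c)" if "b \<in> B" for b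
    using addmap_comp[OF B.addmap_mult_left addmap_\<rho>] addmap_comp[OF addmap_\<rho> B.addmap_mult_left] that \<rho>_closed
    by simp_all
  have "\<rho> (b \<otimes>\<^bsub>B'\<^esub> c) = \<rho> b \<otimes>\<^bsub>B'\<^esub> \<rho> c"
  proof (rule B.A.addmap_eqI[OF r[OF assms(2)] B.A.abelian_group_axioms])
    fix d b assume b: "b \<in> gr B' d"
    note bB = grB(2)[OF b]
    show "\<rho> (b \<otimes>\<^bsub>B'\<^esub> c) = \<rho> b \<otimes>\<^bsub>B'\<^esub> \<rho> c"
    proof (rule B.A.addmap_eqI[OF l[OF bB] B.A.abelian_group_axioms])
      fix e c assume c: "c \<in> gr B' e"
      note cB = grB(2)[OF c]
      have "\<rho> (b \<otimes> c) = sgn_mult A (snd \<delta> * snd (d + e)) (\<psi>\<^sub>B b \<otimes> \<psi>\<^sub>B c)"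
        using \<rho>_hom[OF B.mult_gr[OF b c]] B.\<psi>_mult[of b c] bB cB by simp
      also have "\<dots> = \<rho> b \<otimes> \<rho> c"
        unfolding \<rho>_hom[OF b] \<rho>_hom[OF c] using bB cB
        by (simp add: sgn_mult_mult A.A.sgn_mult_closed A.A.sgn_mult_sgn_mult B_closed(5) B_A distrib_left add.commute)
      finally show "\<rho> (b \<otimes>\<^bsub>B'\<^esub> c) = \<rho> b \<otimes>\<^bsub>B'\<^esub> \<rho> c" by simp
    qed (use assms in auto)
  qed (use assms in auto)
  then show ?thesis by simp
qed

text \<open>Both signs carry the same exponent, as \<open>\<rho>\<close> preserves degrees, and
  cancel. Injectivity and surjectivity of \<open>\<rho>\<close> are then read off from those of the
  square of \<open>\<psi>\<^sub>B\<close>.\<close>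

lemma \<rho>_\<rho>: "b \<in> B \<Longrightarrow> \<rho> (\<rho> b) = \<psi>\<^sub>B (\<psi>\<^sub>B b)"
proof (rule B.A.addmap_eqI[OF addmap_comp[OF addmap_\<rho> addmap_\<rho>] addmap_comp[OF B.addmap_\<psi> B.addmap_\<psi>]
      B.A.abelian_group_axioms])
  fix d b assume b: "b \<in> gr B' d"
  note bB = grB(2)[OF b]
  have 1: "\<psi>\<^sub>B (sgn_mult A q b) = sgn_mult A q (\<psi>\<^sub>B b)" for q
    using addmap_sgn[OF B.addmap_\<psi> B.A.abelian_group_axioms B.A.abelian_group_axioms, of b q] bB
    by (simp add: sgn_B B_closed(5))
  have 2: "\<psi>\<^sub>B (sgn_mult A q (\<psi>\<^sub>B b)) = sgn_mult A q (\<psi>\<^sub>B (\<psi>\<^sub>B b))" for q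
    using addmap_sgn[OF B.addmap_\<psi> B.A.abelian_group_axioms B.A.abelian_group_axioms, of "\<psi>\<^sub>B b" q] bB
    by (simp add: sgn_B B_closed(5))
  show "\<rho> (\<rho> b) = \<psi>\<^sub>B (\<psi>\<^sub>B b)"
    using \<rho>_hom[OF \<rho>_gr[OF b]] bB unfolding \<rho>_hom[OF b]
    by (simp add: 2 A.A.sgn_mult_sgn_mult B_A B_closed(5))
qed simp

lemma \<rho>_inj: "inj_on \<rho> B"
proof (rule inj_onI)
  fix b c assume *: "b \<in> B" "c \<in> B" "\<rho> b = \<rho> c"
  then have "\<psi>\<^sub>B (\<psi>\<^sub>B b) = \<psi>\<^sub>B (\<psi>\<^sub>B c)" using \<rho>_\<rho> by metis
  then show "b = c" using *(1,2) B.\<psi>_inj[of "\<psi>\<^sub>B b" "\<psi>\<^sub>B c"] B.\<psi>_inj[of b c] B_closed(5) by simp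
qed

lemma \<rho>_surj: assumes "c \<in> B" shows "\<exists>b\<in>B. c = \<rho> b"
proof -
  obtain b where "b \<in> B" "c = \<psi>\<^sub>B (\<psi>\<^sub>B b)"
    using B.\<psi>_surj[of c] B.\<psi>_surj assms by (metis sub_structure_simps(1))
  then show ?thesis using \<rho>_\<rho> \<rho>_closed by metis
qed

lemma \<rho>_smult: assumes "k \<in> carrier F" "b \<in> B" shows "\<rho> (k \<odot> b) = k \<odot> \<rho> b"
proof -
  have kB: "addmap B' B' (\<lambda>b. k \<odot>\<^bsub>B'\<^esub> b)" using assms(1) B.FA.smult_r_distr B.FA.smult_closed by (intro addmapI) auto
  have kA: "addmap A A (\<lambda>b. k \<odot> b)" using assms(1) by (intro addmapI) (auto simp: A.FA.smult_r_distr)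
  have "\<rho> (k \<odot>\<^bsub>B'\<^esub> b) = k \<odot>\<^bsub>B'\<^esub> \<rho> b"
  proof (rule B.A.addmap_eqI[OF addmap_comp[OF kB addmap_\<rho>] addmap_comp[OF addmap_\<rho> kB] B.A.abelian_group_axioms])
    fix d b assume b: "b \<in> gr B' d"
    note bB = grB(2)[OF b]
    have "\<rho> (k \<odot> b) = sgn_mult A (snd \<delta> * snd d) (k \<odot> \<psi>\<^sub>B b)"
      using \<rho>_hom[OF B.smult_gr[OF assms(1) b]] B.\<psi>_smult[OF assms(1), of b] bB by simp
    also have "\<dots> = k \<odot> \<rho> b"
      unfolding \<rho>_hom[OF b] using bB
        addmap_sgn[OF kA A.A.abelian_group_axioms A.A.abelian_group_axioms, of "\<psi>\<^sub>B b"] by (simp add: B_A B_closed(5))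
    finally show "\<rho> (k \<odot>\<^bsub>B'\<^esub> b) = k \<odot>\<^bsub>B'\<^esub> \<rho> b" by simp
  qed (use assms in simp)
  then show ?thesis by simp
qed

definition E :: "'a \<Rightarrow> 'a" where
  "E x = (SOME y. y \<in> B \<and> (\<forall>b\<in>B. tr\<^sub>A (\<rho> b \<otimes> x) = tr\<^sub>B (b \<otimes> y)))"

lemma E:
  assumes x: "x \<in> carrier A"
  shows "E x \<in> B" "b \<in> B \<Longrightarrow> tr\<^sub>A (\<rho> b \<otimes> x) = tr\<^sub>B (b \<otimes> E x)"
proof -
  have "addmap B' F (\<lambda>b. tr\<^sub>A (\<rho> b \<otimes> x))"
    using addmap_comp[OF addmap_comp[OF addmap_\<rho> incl] addmap_comp[OF A.addmap_mult_right[OF x] A.addmap_tr]] .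
  then have "B.linear_form (\<lambda>b. tr\<^sub>A (\<rho> b \<otimes> x))"
    using x unfolding B.linear_form_def by (simp add: \<rho>_smult A.smult_mult \<rho>_A A.tr_smult)
  from B.linear_form_representable[OF this]
  have "\<exists>y. y \<in> B \<and> (\<forall>b\<in>B. tr\<^sub>A (\<rho> b \<otimes> x) = tr\<^sub>B (b \<otimes> y))" by auto
  from someI_ex[OF this] show "E x \<in> B" "b \<in> B \<Longrightarrow> tr\<^sub>A (\<rho> b \<otimes> x) = tr\<^sub>B (b \<otimes> E x)"
    unfolding E_def by blast+
qed

lemma E_A: "x \<in> carrier A \<Longrightarrow> E x \<in> carrier A"
  using E(1) B_A by blast

lemma E_eqI:
  assumes "x \<in> carrier A" "y \<in> B"
    and "\<And>b d. b \<in> gr B' d \<Longrightarrow> tr\<^sub>A (\<rho> b \<otimes> x) = tr\<^sub>B (b \<otimes> y)"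
  shows "E x = y"
proof (rule B.right_cancel)
  fix b d assume "b \<in> gr B' d"
  then show "tr\<^sub>B (b \<otimes>\<^bsub>B'\<^esub> E x) = tr\<^sub>B (b \<otimes>\<^bsub>B'\<^esub> y)"
    using assms(3) E(2)[OF assms(1)] grB(2) by simp
qed (use assms E in auto)

lemma addmap_E: "addmap A B' E"
proof (rule addmapI)
  fix x y assume x: "x \<in> carrier A" and y: "y \<in> carrier A"
  show "E (x \<oplus> y) = E x \<oplus>\<^bsub>B'\<^esub> E y"
  proof (rule E_eqI)
    fix b d assume "b \<in> gr B' d"
    then have b: "b \<in> B" by (rule grB)
    have "tr\<^sub>A (\<rho> b \<otimes> (x \<oplus> y)) = tr\<^sub>A (\<rho> b \<otimes> x) \<oplus>\<^bsub>F\<^esub> tr\<^sub>A (\<rho> b \<otimes> y)"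
      using addmap_add[OF addmap_comp[OF A.addmap_mult_left[OF \<rho>_A[OF b]] A.addmap_tr] x y] .
    also have "\<dots> = tr\<^sub>B (b \<otimes> E x) \<oplus>\<^bsub>F\<^esub> tr\<^sub>B (b \<otimes> E y)"
      using E(2)[OF x b] E(2)[OF y b] by simp
    also have "\<dots> = tr\<^sub>B (b \<otimes> (E x \<oplus>\<^bsub>B'\<^esub> E y))"
      using addmap_add[OF addmap_comp[OF B.addmap_mult_left B.addmap_tr], of b "E x" "E y"] b E x y by simp
    finally show "tr\<^sub>A (\<rho> b \<otimes> (x \<oplus> y)) = tr\<^sub>B (b \<otimes> (E x \<oplus>\<^bsub>B'\<^esub> E y))" .
  qed (use x y E B_closed in simp_all)
qed (simp add: E)

text \<open>When paired with \<open>c\<close>, both sides become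
  \<open>tr\<^sub>A (\<rho> (c \<otimes> b) \<otimes> x)\<close>, by multiplicativity of
  \<open>\<rho>\<close>.\<close>

lemma E_mult_left:
  assumes x: "x \<in> carrier A" and b: "b \<in> B"
  shows "E (\<rho> b \<otimes> x) = b \<otimes> E x"
proof (rule E_eqI)
  fix c d assume "c \<in> gr B' d"
  then have c: "c \<in> B" by (rule grB)
  have "tr\<^sub>A (\<rho> c \<otimes> (\<rho> b \<otimes> x)) = tr\<^sub>A (\<rho> (c \<otimes> b) \<otimes> x)"
    using b c x by (simp add: \<rho>_mult A.A.m_assoc \<rho>_A)
  also have "\<dots> = tr\<^sub>B (c \<otimes> (b \<otimes> E x))"
    using b c x by (simp add: E(2) B_closed A.A.m_assoc B_A E(1))
  finally show "tr\<^sub>A (\<rho> c \<otimes> (\<rho> b \<otimes> x)) = tr\<^sub>B (c \<otimes> (b \<otimes> E x))" .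
qed (use x b in \<open>simp_all add: \<rho>_A B_closed E\<close>)

lemma tr_E: "x \<in> carrier A \<Longrightarrow> tr\<^sub>B (E x) = tr\<^sub>A x"
  using E(2)[of x "\<one>"] by (simp add: \<rho>_one B_closed E_A)

lemma E_gr:
  assumes x: "x \<in> gr A e" shows "E x \<in> gr B' (e + \<delta>)"
proof -
  note xc = A.A.gr_carrier[OF x]
  have "E x \<in> gr B' ((e + (- l\<^sub>A, p\<^sub>A)) - (- l\<^sub>B, p\<^sub>B))"
  proof (rule B.linear_form_representable_gr)
    fix b d assume b: "b \<in> gr B' d" and ne: "d + (e + (- l\<^sub>A, p\<^sub>A)) \<noteq> 0"
    then have "tr\<^sub>A (\<rho> b \<otimes> x) = \<zero>\<^bsub>F\<^esub>"
      using A.tr_mult_hom[OF grB(1)[OF \<rho>_gr[OF b]] x] by (simp add: add.assoc)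
    then show "tr\<^sub>B (b \<otimes>\<^bsub>B'\<^esub> E x) = \<zero>\<^bsub>F\<^esub>" using E(2)[OF xc grB(2)[OF b]] by simp
  qed (use E xc in simp)
  then show ?thesis unfolding add_diff_eq[symmetric] \<delta> .
qed

text \<open>Pair with a homogeneous \<open>a\<close>. The Nakayama identity of \<open>A\<close>
  cycles \<open>\<psi>\<^sub>A b\<close> to the front as \<open>b\<close>, the defining property of
  \<open>E\<close> passes to the trace of \<open>B\<close>, and the Nakayama identity of
  \<open>B\<close> cycles to the back.\<close>

lemma E_mult_right:
  assumes x: "x \<in> carrier A" and b: "b \<in> B"
  shows "E (x \<otimes> \<psi>\<^sub>A b) = E x \<otimes> b"
proof -
  have amx: "addmap A B' (\<lambda>x. E (x \<otimes> \<psi>\<^sub>A b))" "addmap A B' (\<lambda>x. E x \<otimes>\<^bsub>B'\<^esub> b)" if "b \<in> B" for b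
    using that by (intro addmap_comp[OF A.addmap_mult_right addmap_E] addmap_comp[OF addmap_E B.addmap_mult_right];
      simp add: A.\<psi>_closed B_A)+
  have amb: "addmap B' B' (\<lambda>b. E (x \<otimes> \<psi>\<^sub>A b))" "addmap B' B' (\<lambda>b. E x \<otimes>\<^bsub>B'\<^esub> b)" if "x \<in> carrier A" for x
    using addmap_comp[OF addmap_comp[OF incl A.addmap_\<psi>] addmap_comp[OF A.addmap_mult_left[OF that] addmap_E]]
      B.addmap_mult_left E(1)[OF that] by simp_all
  have "E (x \<otimes> \<psi>\<^sub>A b) = E x \<otimes>\<^bsub>B'\<^esub> b"
  proof (rule A.A.addmap_eqI[OF amx[OF b] B.A.abelian_group_axioms _ x])
    fix e x assume x: "x \<in> gr A e"
    note xc = A.A.gr_carrier[OF x]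
    show "E (x \<otimes> \<psi>\<^sub>A b) = E x \<otimes>\<^bsub>B'\<^esub> b"
    proof (rule B.A.addmap_eqI[OF amb[OF xc] B.A.abelian_group_axioms])
      fix \<beta> b assume bg: "b \<in> gr B' \<beta>"
      note b = grB(2)[OF bg]
      \<comment> \<open>With \<open>b = \<psi>\<^sub>B c\<close>, the element brought to the front
        is \<open>\<rho> c\<close> up to sign, the form to which the defining property of
        \<open>E\<close> applies; the trace of \<open>B\<close> later returns \<open>c\<close> to
        the back as \<open>b\<close>.\<close>
      obtain c where cg: "c \<in> gr B' \<beta>" and bc: "b = \<psi>\<^sub>B c" using B.\<psi>_surj_gr[OF bg] by blast
      note c = grB(2)[OF cg]
      show "E (x \<otimes> \<psi>\<^sub>A b) = E x \<otimes>\<^bsub>B'\<^esub> b"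
      proof (rule E_eqI)
        fix a \<gamma> assume ag: "a \<in> gr B' \<gamma>"
        note a = grB(2)[OF ag]
        have aE: "a \<otimes> E x \<in> gr B' (\<gamma> + (e + \<delta>))" using B.mult_gr[OF ag E_gr[OF x]] by simp
        have \<rho>x: "\<rho> a \<otimes> x \<in> gr A (\<gamma> + e)" by (rule A.mult_gr[OF grB(1)[OF \<rho>_gr[OF ag]] x])
        let ?s = "sgn_mult F (snd \<beta> * snd (\<gamma> + e))"
        have "?s (tr\<^sub>A (\<rho> a \<otimes> (x \<otimes> \<psi>\<^sub>A b))) = tr\<^sub>A (b \<otimes> (\<rho> a \<otimes> x))"
          using A.tr_mult[OF grB(1)[OF bg] \<rho>x] a b xc by (simp add: A.A.m_assoc \<rho>_A A.\<psi>_closed B_A)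
        also have "\<dots> = sgn_mult F (snd \<delta> * snd \<beta>) (tr\<^sub>A (\<rho> c \<otimes> (\<rho> a \<otimes> x)))"
          using \<rho>_hom[OF cg] a b xc unfolding bc
          by (simp add: sgn_mult_mult \<rho>_A B_A tr_sgn A.A.sgn_mult_sgn_mult A.F.sgn_mult_sgn_mult A.tr_closed)
        also have "tr\<^sub>A (\<rho> c \<otimes> (\<rho> a \<otimes> x)) = tr\<^sub>B (c \<otimes> (a \<otimes> E x))"
          using E(2)[OF xc, of "c \<otimes> a"] a c xc
          by (simp add: \<rho>_mult A.A.m_assoc \<rho>_A B_closed B_A E_A)
        also have "\<dots> = sgn_mult F (snd \<beta> * snd (\<gamma> + (e + \<delta>))) (tr\<^sub>B ((a \<otimes> E x) \<otimes> b))"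
          using B.tr_mult[OF cg aE] unfolding bc by simp
        finally have "?s (tr\<^sub>A (\<rho> a \<otimes> (x \<otimes> \<psi>\<^sub>A b))) =
          sgn_mult F (snd \<delta> * snd \<beta> + snd \<beta> * snd (\<gamma> + (e + \<delta>))) (tr\<^sub>B (a \<otimes> (E x \<otimes> b)))"
          using a b xc B.tr_closed[of "a \<otimes> (E x \<otimes> b)"]
          by (simp add: A.F.sgn_mult_sgn_mult A.A.m_assoc B_A E_A B_closed E(1))
        \<comment> \<open>The sign inside \<open>\<rho>\<close> compensates for the degree
          \<open>\<delta>\<close> by which \<open>E\<close> moves \<open>x\<close>, so the two
          cyclings contribute the same sign.\<close>
        also have "snd \<delta> * snd \<beta> + snd \<beta> * snd (\<gamma> + (e + \<delta>)) = snd \<beta> * snd (\<gamma> + e)"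
          by (cases "snd \<delta>"; cases "snd \<beta>"; cases "snd \<gamma>"; cases "snd e") simp_all
        finally have "?s (?s (tr\<^sub>A (\<rho> a \<otimes> (x \<otimes> \<psi>\<^sub>A b)))) = ?s (?s (tr\<^sub>B (a \<otimes> (E x \<otimes> b))))"
          by simp
        moreover have "tr\<^sub>A (\<rho> a \<otimes> (x \<otimes> \<psi>\<^sub>A b)) \<in> carrier F"
          using a b xc by (simp add: A.tr_closed \<rho>_A A.\<psi>_closed B_A)
        moreover have "tr\<^sub>B (a \<otimes> (E x \<otimes> b)) \<in> carrier F"
          using a b xc by (simp add: B.tr_closed E B_closed)
        ultimately show "tr\<^sub>A (\<rho> a \<otimes> (x \<otimes> \<psi>\<^sub>A b)) = tr\<^sub>B (a \<otimes> (E x \<otimes>\<^bsub>B'\<^esub> b))"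
          by (simp add: A.F.sgn_mult_sgn_mult)
      qed (use b xc in \<open>simp_all add: B_A A.\<psi>_closed B_closed E\<close>)
    qed (use b in simp)
  qed
  then show ?thesis by simp
qed

text \<open>The trace of \<open>B\<close> composed with \<open>E\<close> is the trace of
  \<open>A\<close>, whose pairing is nondegenerate.\<close>

lemma E_faithful:
  assumes "y \<in> carrier A" "z \<in> carrier A" "\<And>x. x \<in> carrier A \<Longrightarrow> E (x \<otimes> y) = E (x \<otimes> z)"
  shows "y = z"
proof (rule A.right_cancel[OF assms(1,2)])
  fix x d assume "x \<in> gr A d"
  then have "x \<in> carrier A" by (rule A.A.gr_carrier)
  then show "tr\<^sub>A (x \<otimes> y) = tr\<^sub>A (x \<otimes> z)"
    using tr_E[of "x \<otimes> y"] tr_E[of "x \<otimes> z"] assms by simp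
qed

text \<open>Composing \<open>f\<close> with \<open>tr\<^sub>B\<close> gives a linear form on
  \<open>A\<close>, represented by some \<open>z\<close>. Linearity turns
  \<open>tr\<^sub>B (b \<otimes> f x)\<close> into this form evaluated at
  \<open>\<rho> b \<otimes> x\<close>, whence \<open>f x = E (x \<otimes> z)\<close>; the element
  \<open>y\<close> is the preimage of \<open>z\<close> under \<open>\<psi>\<^sub>A\<close>. Its
  degree is \<open>g\<close> plus the degree of \<open>tr\<^sub>B\<close> minus that of
  \<open>tr\<^sub>A\<close>.\<close>

lemma E_representable:
  assumes f: "addmap A B' f" and lin: "\<And>b x. b \<in> B \<Longrightarrow> x \<in> carrier A \<Longrightarrow> f (\<rho> b \<otimes> x) = b \<otimes> f x"
    and deg: "\<And>e x. x \<in> gr A e \<Longrightarrow> f x \<in> gr B' (e + g)"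
  shows "\<exists>y\<in>gr A (g - \<delta>). \<forall>x\<in>carrier A. f x = E (x \<otimes> \<psi>\<^sub>A y)"
proof -
  have fc: "f x \<in> B" if "x \<in> carrier A" for x using addmap_closed[OF f that] by simp
  \<comment> \<open>Scalars act as the elements \<open>k \<odot> \<one>\<close> of \<open>B\<close>,
    which \<open>\<rho>\<close> fixes, so linearity over the field is a case of linearity over
    \<open>B\<close>.\<close>
  have "f (k \<odot> x) = k \<odot> f x" if "k \<in> carrier F" "x \<in> carrier A" for k x
    using lin[of "k \<odot> \<one>" x] that fc[OF that(2)]
    by (simp add: B_closed \<rho>_smult \<rho>_one A.smult_mult B_A)
  then have "A.linear_form (\<lambda>x. tr\<^sub>B (f x))"
    unfolding A.linear_form_def using addmap_comp[OF f B.addmap_tr] fc B.tr_smult by simp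
  from A.linear_form_representable[OF this]
  obtain z where z: "z \<in> carrier A" "\<And>x. x \<in> carrier A \<Longrightarrow> tr\<^sub>B (f x) = tr\<^sub>A (x \<otimes> z)" by blast
  have "z \<in> gr A ((g + (- l\<^sub>B, p\<^sub>B)) - (- l\<^sub>A, p\<^sub>A))"
  proof (rule A.linear_form_representable_gr[OF z(1)])
    fix x d assume x: "x \<in> gr A d" and ne: "d + (g + (- l\<^sub>B, p\<^sub>B)) \<noteq> 0"
    have "tr\<^sub>B (f x) = \<zero>\<^bsub>F\<^esub>" using B.tr_gr[OF deg[OF x]] ne by (simp add: add.assoc)
    then show "tr\<^sub>A (x \<otimes> z) = \<zero>\<^bsub>F\<^esub>" using z(2)[OF A.A.gr_carrier[OF x]] by simp
  qed
  then have zg: "z \<in> gr A (g - \<delta>)" unfolding \<delta>[symmetric] by (simp only: diff_diff_eq2)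
  have "f x = E (x \<otimes> z)" if x: "x \<in> carrier A" for x
  proof (rule E_eqI[symmetric])
    fix b d assume "b \<in> gr B' d"
    then have b: "b \<in> B" by (rule grB)
    show "tr\<^sub>A (\<rho> b \<otimes> (x \<otimes> z)) = tr\<^sub>B (b \<otimes> f x)"
      using z(2)[of "\<rho> b \<otimes> x"] b x z(1) by (simp add: lin \<rho>_A A.A.m_assoc)
  qed (use x z(1) fc in simp_all)
  then show ?thesis using A.\<psi>_surj_gr[OF zg] by metis
qed

end

section \<open>The bimodule isomorphism\<close>

lemma shift_smult_hom:
  assumes "graded_group R" "abelian_group M" "addmap R M (\<lambda>r. r \<odot>\<^bsub>M\<^esub> x)" "r \<in> gr R d"
  shows "r \<odot>\<^bsub>shift R \<delta> M\<^esub> x = sgn_mult M (snd \<delta> * snd d) (r \<odot>\<^bsub>M\<^esub> x)"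
    and "addmap R M (\<lambda>r. r \<odot>\<^bsub>shift R \<delta> M\<^esub> x)"
proof -
  interpret R: graded_group R by fact
  interpret M: abelian_group M by fact
  note am = addmap_comp[OF assms(3) M.addmap_sgn_mult]
  have e: "r \<odot>\<^bsub>shift R \<delta> M\<^esub> x =
      finsum M (\<lambda>d. sgn_mult M (snd \<delta> * snd d) (hcomp R r d \<odot>\<^bsub>M\<^esub> x)) (hsupp R r)" for r
    by (simp add: shift_def)
  show "addmap R M (\<lambda>r. r \<odot>\<^bsub>shift R \<delta> M\<^esub> x)"
    unfolding e by (rule R.addmap_gext(1)[OF assms(2) am])
  show "r \<odot>\<^bsub>shift R \<delta> M\<^esub> x = sgn_mult M (snd \<delta> * snd d) (r \<odot>\<^bsub>M\<^esub> x)"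
    unfolding e
    by (rule R.addmap_gext(2)[where f = "\<lambda>d r. sgn_mult M (snd \<delta> * snd d) (r \<odot>\<^bsub>M\<^esub> x)", OF assms(2) am assms(4)])
qed

context frobenius_pair
begin

text \<open>For \<open>q = 1\<close> the parity involution of \<open>A\<close>, for
  \<open>q = 0\<close> the identity. It supplies the sign between an element of parity
  \<open>q\<close> and an arbitrary, possibly inhomogeneous \<open>x\<close>.\<close>

definition par :: "bit \<Rightarrow> 'a \<Rightarrow> 'a" where
  "par q x = finsum A (\<lambda>k. sgn_mult A (q * snd k) (hcomp A x k)) (hsupp A x)"

lemma addmap_par: "addmap A A (par q)"
  unfolding par_def by (rule A.A.addmap_gext(1)[OF A.A.abelian_group_axioms A.A.addmap_sgn_mult])

lemma par_hom: "x \<in> gr A k \<Longrightarrow> par q x = sgn_mult A (q * snd k) x"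
  unfolding par_def
  by (rule A.A.addmap_gext(2)[where f = "\<lambda>k. sgn_mult A (q * snd k)",
        OF A.A.abelian_group_axioms A.A.addmap_sgn_mult])

lemma par_par: "x \<in> carrier A \<Longrightarrow> par q (par q x) = x"
proof (rule A.A.addmap_eqI[OF addmap_comp[OF addmap_par addmap_par] addmap_id A.A.abelian_group_axioms])
  fix k x assume x: "x \<in> gr A k"
  show "par q (par q x) = x"
    using par_hom[OF A.A.sgn_mult_gr[OF x]] A.A.gr_carrier[OF x]
    by (simp add: par_hom[OF x] A.A.sgn_mult_sgn_mult)
qed

lemma E_sgn: "x \<in> carrier A \<Longrightarrow> E (sgn_mult A q x) = sgn_mult A q (E x)"
  using addmap_sgn[OF addmap_E A.A.abelian_group_axioms B.A.abelian_group_axioms] sgn_B E(1) by simp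

text \<open>For homogeneous \<open>a\<close> and \<open>x\<close> this is \<open>(-1)^(|a||x|) E (x \<psi>\<^sub>A(a))\<close>, the value at \<open>x\<close> of
  \<open>a \<cdot> E\<close>.\<close>

definition \<theta> :: "'a \<Rightarrow> 'a \<Rightarrow> 'a" where
  "\<theta> a x = finsum B' (\<lambda>d. E (par (snd d) x \<otimes> \<psi>\<^sub>A (hcomp A a d))) (hsupp A a)"

lemma addmap_E_par:
  "x \<in> carrier A \<Longrightarrow> addmap A B' (\<lambda>a. E (par q x \<otimes> \<psi>\<^sub>A a))"
  "a \<in> carrier A \<Longrightarrow> addmap A B' (\<lambda>x. E (par q x \<otimes> \<psi>\<^sub>A a))"
  using addmap_comp[OF addmap_comp[OF A.addmap_\<psi> A.addmap_mult_left] addmap_E]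
    addmap_comp[OF addmap_comp[OF addmap_par A.addmap_mult_right] addmap_E]
    addmap_closed[OF addmap_par] A.\<psi>_closed by blast+

lemma addmap_\<theta>_left: "x \<in> carrier A \<Longrightarrow> addmap A B' (\<lambda>a. \<theta> a x)"
  unfolding \<theta>_def by (rule A.A.addmap_gext(1)[OF B.A.abelian_group_axioms addmap_E_par(1)])

lemma \<theta>_hom_left: "x \<in> carrier A \<Longrightarrow> a \<in> gr A d \<Longrightarrow> \<theta> a x = E (par (snd d) x \<otimes> \<psi>\<^sub>A a)"
  unfolding \<theta>_def
  by (rule A.A.addmap_gext(2)[where f = "\<lambda>d a. E (par (snd d) x \<otimes> \<psi>\<^sub>A a)",
        OF B.A.abelian_group_axioms addmap_E_par(1)])

lemma addmap_\<theta>_right: "a \<in> carrier A \<Longrightarrow> addmap A B' (\<theta> a)"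
  unfolding \<theta>_def
  by (intro addmap_sum[OF A.A.abelian_group_axioms B.A.abelian_group_axioms] addmap_E_par A.A.hcomp_closed)

lemma \<theta>_hom:
  assumes a: "a \<in> gr A d" and x: "x \<in> gr A k"
  shows "\<theta> a x = sgn_mult A (snd d * snd k) (E (x \<otimes> \<psi>\<^sub>A a))"
  using A.A.gr_carrier[OF a] A.A.gr_carrier[OF x]
  by (simp add: \<theta>_hom_left[OF _ a] par_hom[OF x] sgn_mult_mult A.\<psi>_closed E_sgn)

lemma \<theta>_closed: "a \<in> carrier A \<Longrightarrow> x \<in> carrier A \<Longrightarrow> \<theta> a x \<in> B"
  using addmap_closed[OF addmap_\<theta>_right] by simp

text \<open>For homogeneous arguments the sign in \<open>\<theta>\<close> is exactly the one in the
  Nakayama identity of \<open>A\<close>, which turns \<open>x \<otimes> \<psi>\<^sub>A a\<close>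
  back into \<open>a \<otimes> x\<close> under the trace.\<close>

lemma tr_\<theta>:
  assumes a: "a \<in> carrier A" and x: "x \<in> carrier A"
  shows "tr\<^sub>B (\<theta> a x) = tr\<^sub>A (a \<otimes> x)"
proof (rule A.A.addmap_eqI[OF addmap_comp[OF addmap_\<theta>_left[OF x] B.addmap_tr]
      addmap_comp[OF A.addmap_mult_right[OF x] A.addmap_tr] A.F.abelian_group_axioms _ a])
  fix d a assume a: "a \<in> gr A d"
  note ac = A.A.gr_carrier[OF a]
  show "tr\<^sub>B (\<theta> a x) = tr\<^sub>A (a \<otimes> x)"
  proof (rule A.A.addmap_eqI[OF addmap_comp[OF addmap_\<theta>_right[OF ac] B.addmap_tr]
        addmap_comp[OF A.addmap_mult_left[OF ac] A.addmap_tr] A.F.abelian_group_axioms _ x])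
    fix k x assume x: "x \<in> gr A k"
    note xc = A.A.gr_carrier[OF x]
    show "tr\<^sub>B (\<theta> a x) = tr\<^sub>A (a \<otimes> x)"
      using A.tr_mult[OF a x] ac xc
      by (simp add: \<theta>_hom[OF a x] E_sgn[symmetric] tr_E tr_sgn A.\<psi>_closed A.A.sgn_mult_closed)
  qed
qed

lemma \<theta>_inj:
  assumes "a \<in> carrier A" "b \<in> carrier A" "\<And>x. x \<in> carrier A \<Longrightarrow> \<theta> a x = \<theta> b x"
  shows "a = b"
proof -
  have "a \<ominus> b = \<zero>"
  proof (rule A.left_nondegenerate)
    fix x assume x: "x \<in> carrier A"
    have "tr\<^sub>A ((a \<ominus> b) \<otimes> x) = tr\<^sub>A (a \<otimes> x) \<ominus>\<^bsub>F\<^esub> tr\<^sub>A (b \<otimes> x)"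
      by (rule addmap_minus[OF addmap_comp[OF A.addmap_mult_right[OF x] A.addmap_tr] A.A.abelian_group_axioms
            A.F.abelian_group_axioms assms(1,2)])
    also have "\<dots> = \<zero>\<^bsub>F\<^esub>"
      using tr_\<theta>[OF assms(1) x] tr_\<theta>[OF assms(2) x] assms x by (simp add: A.tr_closed)
    finally show "tr\<^sub>A ((a \<ominus> b) \<otimes> x) = \<zero>\<^bsub>F\<^esub>" .
  qed (use assms in simp)
  then show ?thesis using A.A.eq_of_minus_zero assms(1,2) by blast
qed

abbreviation "M\<^sub>0 \<equiv> twisted_bimodule A \<psi>\<^sub>B \<psi>\<^sub>A"
abbreviation "N\<^sub>0 \<equiv> shift B' (- fst \<delta>, snd \<delta>) (regular_bimodule B')"
abbreviation "H\<^sub>0 \<equiv> HOML_group B' M\<^sub>0 N\<^sub>0"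

lemma finsum_N0: "finsum N\<^sub>0 = finsum B'"
  by (intro ext finsum_cong_struct) simp_all

lemma sgn_N0: "sgn_mult N\<^sub>0 = sgn_mult B'"
  by (rule sgn_mult_cong_struct) simp_all

text \<open>With \<open>\<delta> = (- \<lambda>, \<pi>)\<close> the target is shifted by
  \<open>(\<lambda>, \<pi>)\<close>, which is \<open>- \<delta>\<close> since parities are their own
  negatives. As a map into the shifted \<open>B\<close>, the map \<open>E\<close> thus has degree
  zero.\<close>

lemma gr_N0: "gr N\<^sub>0 d = gr B' (d + \<delta>)"
proof -
  have *: "d - (- fst \<delta>, snd \<delta>) = d + \<delta>"
    by (cases d; cases \<delta>) simp
  show ?thesis unfolding gr_shift twisted_bimodule_simps * ..
qed

lemma smult_N0:
  assumes "r \<in> gr B' e" "y \<in> B"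
  shows "r \<odot>\<^bsub>N\<^sub>0\<^esub> y = sgn_mult A (snd \<delta> * snd e) (r \<otimes> y)"
proof -
  have ab: "abelian_group (regular_bimodule B')"
    by (rule abelian_group_cong_struct[OF _ _ _ B.A.abelian_group_axioms]) simp_all
  have am: "addmap B' (regular_bimodule B') (\<lambda>r. r \<odot>\<^bsub>regular_bimodule B'\<^esub> y)"
    using B.addmap_mult_right[of y] assms(2) by (simp add: addmap_def)
  have "sgn_mult (regular_bimodule B') = sgn_mult B'"
    by (rule sgn_mult_cong_struct) simp_all
  then show ?thesis
    using shift_smult_hom(1)[OF B.A.graded_group_axioms ab am assms(1), of "(- fst \<delta>, snd \<delta>)"]
      assms(2) grB(2)[OF assms(1)] by (simp add: sgn_B B_closed)
qed

text \<open>Membership is rewritten in terms of \<open>A\<close> and \<open>B\<close> alone; the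
  sign of a map of degree \<open>d\<close> and the sign of the shifted action merge into one
  exponent.\<close>

lemma HOML_gr_iff:
  "f \<in> HOML_gr B' M\<^sub>0 N\<^sub>0 d \<longleftrightarrow> f \<in> carrier A \<rightarrow>\<^sub>E B \<and> addmap A B' f \<and>
     (\<forall>e. \<forall>x\<in>gr A e. f x \<in> gr B' (e + d + \<delta>)) \<and>
     (\<forall>e. \<forall>r\<in>gr B' e. \<forall>x\<in>carrier A.
        f (\<psi>\<^sub>B r \<otimes> x) = sgn_mult A (snd d * snd e + snd \<delta> * snd e) (r \<otimes> f x))"
  (is "_ \<longleftrightarrow> ?R")
proof -
  have *: "sgn_mult N\<^sub>0 (snd d * snd e) (r \<odot>\<^bsub>N\<^sub>0\<^esub> y) =
      sgn_mult A (snd d * snd e + snd \<delta> * snd e) (r \<otimes> y)" if "r \<in> gr B' e" "y \<in> B" for r y e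
  proof -
    have "sgn_mult A (snd \<delta> * snd e) (r \<otimes> y) \<in> B" "r \<otimes> y \<in> carrier A"
      using that B_closed(1)[OF grB(2)[OF that(1)] that(2)] sgn_B_closed B_A by auto
    then show ?thesis by (simp add: smult_N0[OF that] sgn_N0 sgn_B A.A.sgn_mult_sgn_mult)
  qed
  show ?thesis
  proof (cases "f \<in> carrier A \<rightarrow>\<^sub>E B")
    case True
    then have fB: "f \<in> carrier A \<rightarrow> B" and fB': "f x \<in> B" if "x \<in> carrier A" for x using that by auto
    have "(\<forall>e. \<forall>r\<in>gr B' e. \<forall>x\<in>carrier A.
        f (\<psi>\<^sub>B r \<otimes> x) = sgn_mult N\<^sub>0 (snd d * snd e) (r \<odot>\<^bsub>N\<^sub>0\<^esub> f x)) \<longleftrightarrow>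
      (\<forall>e. \<forall>r\<in>gr B' e. \<forall>x\<in>carrier A.
        f (\<psi>\<^sub>B r \<otimes> x) = sgn_mult A (snd d * snd e + snd \<delta> * snd e) (r \<otimes> f x))"
      by (intro iff_allI ball_cong refl) (simp only: *[OF _ fB'])
    then show ?thesis
      using True fB[OF A.A.zero_closed]
      unfolding HOML_gr_def gr_N0 addmap_def mem_Collect_eq shift_simps twisted_bimodule_simps sub_structure_simps(1-5)
      by (simp only: add.assoc) blast
  qed (simp add: HOML_gr_def)
qed

definition \<Theta> :: "'a \<Rightarrow> 'a \<Rightarrow> 'a" where
  "\<Theta> a = restrict (\<theta> a) (carrier A)"

text \<open>\<open>E\<close> is strictly linear for \<open>\<rho>\<close>, so the plain twist by
  \<open>\<psi>\<^sub>B\<close> costs exactly the sign of the shifted action.\<close>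

lemma \<psi>B_mult_E:
  assumes r: "r \<in> gr B' e" and z: "z \<in> carrier A"
  shows "E (\<psi>\<^sub>B r \<otimes> z) = sgn_mult A (snd \<delta> * snd e) (r \<otimes> E z)"
proof -
  note rB = grB(2)[OF r]
  have "\<psi>\<^sub>B r = sgn_mult A (snd \<delta> * snd e) (\<rho> r)"
    using B_A[OF B_closed(5)[OF rB]] by (simp add: \<rho>_hom[OF r] A.A.sgn_mult_sgn_mult)
  then show ?thesis
    using rB z by (simp add: sgn_mult_mult \<rho>_A E_sgn E_mult_left)
qed

lemma \<Theta>_gr:
  assumes a: "a \<in> gr A d" shows "\<Theta> a \<in> HOML_gr B' M\<^sub>0 N\<^sub>0 d"
  unfolding HOML_gr_iff
proof (intro conjI allI ballI)
  note ac = A.A.gr_carrier[OF a]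
  show "\<Theta> a \<in> carrier A \<rightarrow>\<^sub>E B" by (simp add: \<Theta>_def \<theta>_closed ac)
  show "addmap A B' (\<Theta> a)"
    by (rule addmap_cong[OF addmap_\<theta>_right[OF ac] A.A.abelian_group_axioms]) (simp add: \<Theta>_def)
  show "\<Theta> a x \<in> gr B' (e + d + \<delta>)" if x: "x \<in> gr A e" for x e
  proof -
    have Eg: "E (x \<otimes> \<psi>\<^sub>A a) \<in> gr B' (e + d + \<delta>)" by (rule E_gr[OF A.mult_gr[OF x A.\<psi>_gr[OF a]]])
    have "\<Theta> a x = sgn_mult B' (snd d * snd e) (E (x \<otimes> \<psi>\<^sub>A a))"
      using A.A.gr_carrier[OF x] by (simp add: \<Theta>_def \<theta>_hom[OF a x] sgn_B[OF grB(2)[OF Eg]])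
    then show ?thesis using B.A.sgn_mult_gr[OF Eg] by metis
  qed
  show "\<Theta> a (\<psi>\<^sub>B r \<otimes> x) = sgn_mult A (snd d * snd e + snd \<delta> * snd e) (r \<otimes> \<Theta> a x)"
    if r: "r \<in> gr B' e" and x: "x \<in> carrier A" for e r x
  proof -
    note rB = grB(2)[OF r]
    have \<psi>r: "\<psi>\<^sub>B r \<in> gr A e" "\<psi>\<^sub>B r \<in> carrier A" using B.\<psi>_gr[OF r] B_A[OF B_closed(5)[OF rB]] by auto
    have "\<theta> a (\<psi>\<^sub>B r \<otimes> x) = sgn_mult B' (snd d * snd e + snd \<delta> * snd e) (r \<otimes>\<^bsub>B'\<^esub> \<theta> a x)"
    proof (rule A.A.addmap_eqI[OF addmap_comp[OF A.addmap_mult_left[OF \<psi>r(2)] addmap_\<theta>_right[OF ac]]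
          addmap_comp[OF addmap_comp[OF addmap_\<theta>_right[OF ac] B.addmap_mult_left] B.A.addmap_sgn_mult]
          B.A.abelian_group_axioms _ x])
      show "r \<in> carrier B'" using rB by simp
      fix k x assume x: "x \<in> gr A k"
      note xc = A.A.gr_carrier[OF x]
      have z: "x \<otimes> \<psi>\<^sub>A a \<in> carrier A" using xc ac by (simp add: A.\<psi>_closed)
      have "\<theta> a (\<psi>\<^sub>B r \<otimes> x) = sgn_mult A (snd d * (snd e + snd k)) (E (\<psi>\<^sub>B r \<otimes> (x \<otimes> \<psi>\<^sub>A a)))"
        using \<theta>_hom[OF a A.mult_gr[OF \<psi>r(1) x]] xc ac \<psi>r by (simp add: A.A.m_assoc A.\<psi>_closed)
      also have "\<dots> = sgn_mult A (snd d * snd e + snd \<delta> * snd e) (r \<otimes> \<theta> a x)"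
        using rB z by (simp add: \<psi>B_mult_E[OF r z] \<theta>_hom[OF a x] sgn_mult_mult A.A.sgn_mult_sgn_mult
          B_A E_A A.A.sgn_mult_closed algebra_simps)
      finally show "\<theta> a (\<psi>\<^sub>B r \<otimes> x) = sgn_mult B' (snd d * snd e + snd \<delta> * snd e) (r \<otimes>\<^bsub>B'\<^esub> \<theta> a x)"
        using rB xc ac by (simp add: sgn_B B_closed \<theta>_closed)
    qed
    then show ?thesis using rB x ac \<psi>r by (simp add: \<Theta>_def sgn_B B_closed \<theta>_closed)
  qed
qed

text \<open>Composing \<open>f\<close> with \<open>par\<close> cancels the part of its sign that
  comes from the degree \<open>d\<close>; what is left is the sign inside \<open>\<rho>\<close>. The
  composite is thus strictly linear for \<open>\<rho>\<close> and represented by an element of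
  degree \<open>d + \<delta> - \<delta>\<close>. Since \<open>par\<close> is an involution, this
  recovers \<open>f\<close>.\<close>

lemma \<Theta>_surj:
  assumes f: "f \<in> HOML_gr B' M\<^sub>0 N\<^sub>0 d" shows "\<exists>a\<in>gr A d. f = \<Theta> a"
proof -
  have fe: "f \<in> carrier A \<rightarrow>\<^sub>E B" and fa: "addmap A B' f"
    and fg: "\<And>e x. x \<in> gr A e \<Longrightarrow> f x \<in> gr B' (e + d + \<delta>)"
    and fl: "\<And>e r x. r \<in> gr B' e \<Longrightarrow> x \<in> carrier A \<Longrightarrow>
      f (\<psi>\<^sub>B r \<otimes> x) = sgn_mult A (snd d * snd e + snd \<delta> * snd e) (r \<otimes> f x)"
    using f unfolding HOML_gr_iff by blast+
  have fB: "f x \<in> B" if "x \<in> carrier A" for x using addmap_closed[OF fa that] by simp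
  have fs: "f (sgn_mult A q x) = sgn_mult A q (f x)" if "x \<in> carrier A" for q x
    using addmap_sgn[OF fa A.A.abelian_group_axioms B.A.abelian_group_axioms that] fB[OF that] by (simp add: sgn_B)
  define g where "g x = f (par (snd d) x)" for x
  have ga: "addmap A B' g" unfolding g_def by (rule addmap_comp[OF addmap_par fa])
  have gg: "g x \<in> gr B' (e + (d + \<delta>))" if x: "x \<in> gr A e" for x e
  proof -
    have "sgn_mult A (snd d * snd e) x \<in> gr A e" by (rule A.A.sgn_mult_gr[OF x])
    then show ?thesis using fg unfolding g_def par_hom[OF x] add.assoc by blast
  qed
  have "g (\<rho> b \<otimes> x) = b \<otimes>\<^bsub>B'\<^esub> g x" if b: "b \<in> B" and x: "x \<in> carrier A" for b x
  proof (rule B.A.addmap_eqI[OF addmap_comp[OF addmap_comp[OF addmap_comp[OF addmap_\<rho> incl]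
            A.addmap_mult_right[OF x]] ga] B.addmap_mult_right B.A.abelian_group_axioms])
    show "g x \<in> carrier B'" using addmap_closed[OF ga x] .
    show "b \<in> carrier B'" using b by simp
    fix e b assume b: "b \<in> gr B' e"
    note bB = grB(2)[OF b]
    show "g (\<rho> b \<otimes> x) = b \<otimes>\<^bsub>B'\<^esub> g x"
    proof (rule A.A.addmap_eqI[OF addmap_comp[OF A.addmap_mult_left[OF \<rho>_A[OF bB]] ga]
          addmap_comp[OF ga B.addmap_mult_left] B.A.abelian_group_axioms _ x])
      show "b \<in> carrier B'" using bB by simp
      fix k x assume x: "x \<in> gr A k"
      note xc = A.A.gr_carrier[OF x]
      have \<psi>b: "\<psi>\<^sub>B b \<in> carrier A" using B_A[OF B_closed(5)[OF bB]] .
      have "g (\<rho> b \<otimes> x) = f (sgn_mult A (snd d * (snd e + snd k) + snd \<delta> * snd e) (\<psi>\<^sub>B b \<otimes> x))"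
        using par_hom[OF A.mult_gr[OF grB(1)[OF \<rho>_gr[OF b]] x]] xc \<psi>b
        by (simp add: g_def \<rho>_hom[OF b] sgn_mult_mult A.A.sgn_mult_sgn_mult)
      also have "\<dots> = sgn_mult A (snd d * (snd e + snd k) + snd \<delta> * snd e)
          (sgn_mult A (snd d * snd e + snd \<delta> * snd e) (b \<otimes> f x))"
        using xc \<psi>b by (simp add: fs fl[OF b])
      also have "\<dots> = sgn_mult A (snd d * snd k) (b \<otimes> f x)"
      proof -
        have "(snd d * (snd e + snd k) + snd \<delta> * snd e) + (snd d * snd e + snd \<delta> * snd e) = snd d * snd k"
          by (cases "snd d"; cases "snd e"; cases "snd k"; cases "snd \<delta>") simp_all
        then show ?thesis using B_A[OF bB] B_A[OF fB[OF xc]] by (simp add: A.A.sgn_mult_sgn_mult)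
      qed
      also have "\<dots> = b \<otimes> g x"
        using xc bB by (simp add: g_def par_hom[OF x] fs sgn_mult_mult B_A fB)
      finally show "g (\<rho> b \<otimes> x) = b \<otimes>\<^bsub>B'\<^esub> g x" by simp
    qed
  qed
  then have "\<exists>y\<in>gr A (d + \<delta> - \<delta>). \<forall>x\<in>carrier A. g x = E (x \<otimes> \<psi>\<^sub>A y)"
    by (intro E_representable[OF ga _ gg]) simp_all
  then obtain a where a: "a \<in> gr A d" "\<And>x. x \<in> carrier A \<Longrightarrow> g x = E (x \<otimes> \<psi>\<^sub>A a)" by auto
  have "f x = \<Theta> a x" for x
  proof (cases "x \<in> carrier A")
    case True
    have "g (par (snd d) x) = E (par (snd d) x \<otimes> \<psi>\<^sub>A a)"
      by (rule a(2)[OF addmap_closed[OF addmap_par True]])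
    then show ?thesis
      by (simp add: g_def par_par True \<Theta>_def \<theta>_hom_left[OF True a(1)])
  qed (simp add: \<Theta>_def PiE_arb[OF fe])
  then show ?thesis using a(1) by blast
qed

lemma \<Theta>_inj: "inj_on \<Theta> (carrier A)"
proof (rule inj_onI)
  fix a b assume *: "a \<in> carrier A" "b \<in> carrier A" "\<Theta> a = \<Theta> b"
  show "a = b" by (rule \<theta>_inj[OF *(1,2)]) (metis *(3) \<Theta>_def restrict_apply')
qed

lemma H0_simps: "\<zero>\<^bsub>H\<^sub>0\<^esub> = (\<lambda>x\<in>carrier A. \<zero>)" "f \<oplus>\<^bsub>H\<^sub>0\<^esub> g = (\<lambda>x\<in>carrier A. f x \<oplus> g x)"
  "gr H\<^sub>0 = HOML_gr B' M\<^sub>0 N\<^sub>0"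
  by (simp_all add: HOML_group_def)

lemma \<Theta>_finsum:
  assumes "finite D" "\<And>d. d \<in> D \<Longrightarrow> c d \<in> carrier A"
  shows "\<Theta> (finsum A c D) = (\<lambda>x\<in>carrier A. finsum N\<^sub>0 (\<lambda>d. \<Theta> (c d) x) D)"
proof
  fix x
  show "\<Theta> (finsum A c D) x = (\<lambda>x\<in>carrier A. finsum N\<^sub>0 (\<lambda>d. \<Theta> (c d) x) D) x"
  proof (cases "x \<in> carrier A")
    case True
    have "c \<in> D \<rightarrow> carrier A" using assms(2) by blast
    then show ?thesis
      using addmap_finsum[OF addmap_\<theta>_left[OF True] A.A.abelian_group_axioms B.A.abelian_group_axioms assms(1)]
      by (simp add: \<Theta>_def True finsum_N0)
  qed (simp add: \<Theta>_def)
qed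

lemma carrier_H0: "carrier H\<^sub>0 = \<Theta> ` carrier A"
proof (intro subset_antisym subsetI)
  fix h assume "h \<in> carrier H\<^sub>0"
  then obtain D g where D: "finite D" "\<forall>d\<in>D. g d \<in> HOML_gr B' M\<^sub>0 N\<^sub>0 d"
    and h: "h = (\<lambda>x\<in>carrier A. finsum N\<^sub>0 (\<lambda>d. g d x) D)"
    by (auto simp: HOML_group_def)
  have "\<forall>d\<in>D. \<exists>a. a \<in> gr A d \<and> g d = \<Theta> a" using \<Theta>_surj D(2) by blast
  then obtain c where c: "\<forall>d\<in>D. c d \<in> gr A d \<and> g d = \<Theta> (c d)" by metis
  then have cc: "\<And>d. d \<in> D \<Longrightarrow> c d \<in> carrier A" using A.A.gr_carrier by blast
  have "\<Theta> (c d) x \<in> B" if "d \<in> D" "x \<in> carrier A" for d x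
    using that cc by (simp add: \<Theta>_def \<theta>_closed)
  then have "h = (\<lambda>x\<in>carrier A. finsum N\<^sub>0 (\<lambda>d. \<Theta> (c d) x) D)"
    unfolding h finsum_N0 using c by (intro restrict_ext B.A.finsum_cong') auto
  also have "\<dots> = \<Theta> (finsum A c D)" by (rule \<Theta>_finsum[OF D(1) cc, symmetric])
  finally have "h = \<Theta> (finsum A c D)" .
  moreover have "finsum A c D \<in> carrier A" using cc by (intro A.A.finsum_closed) blast
  ultimately show "h \<in> \<Theta> ` carrier A" by blast
next
  fix h assume "h \<in> \<Theta> ` carrier A"
  then obtain a where a: "a \<in> carrier A" "h = \<Theta> a" by blast
  have "h = (\<lambda>x\<in>carrier A. finsum N\<^sub>0 (\<lambda>d. \<Theta> (hcomp A a d) x) (hsupp A a))"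
    using \<Theta>_finsum[OF A.A.finite_hsupp[OF a(1)], of "hcomp A a"] A.A.hcomp_closed[OF a(1)] A.A.hcomp_sum[OF a(1)] a(2)
    by simp
  then show "h \<in> carrier H\<^sub>0"
    using A.A.finite_hsupp[OF a(1)] \<Theta>_gr[OF A.A.hcomp_gr[OF a(1)]]
    unfolding HOML_group_def
    by (simp, intro exI[of _ "hsupp A a"] exI[of _ "\<lambda>d. \<Theta> (hcomp A a d)"]) simp
qed

lemma \<Theta>_add: "a \<in> carrier A \<Longrightarrow> b \<in> carrier A \<Longrightarrow> \<Theta> (a \<oplus> b) = \<Theta> a \<oplus>\<^bsub>H\<^sub>0\<^esub> \<Theta> b"
  using addmap_add[OF addmap_\<theta>_left] by (auto simp: \<Theta>_def H0_simps fun_eq_iff)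

lemma \<Theta>_zero: "\<Theta> \<zero> = \<zero>\<^bsub>H\<^sub>0\<^esub>"
  using addmap_zero[OF addmap_\<theta>_left A.A.abelian_group_axioms B.A.abelian_group_axioms]
  by (auto simp: \<Theta>_def H0_simps fun_eq_iff)

lemma abelian_group_H0: "abelian_group H\<^sub>0"
proof (rule abelian_groupI)
  show "\<exists>g\<in>carrier H\<^sub>0. g \<oplus>\<^bsub>H\<^sub>0\<^esub> f = \<zero>\<^bsub>H\<^sub>0\<^esub>" if "f \<in> carrier H\<^sub>0" for f
  proof -
    obtain a where a: "a \<in> carrier A" "f = \<Theta> a" using \<open>f \<in> carrier H\<^sub>0\<close> unfolding carrier_H0 by blast
    then have "\<Theta> (\<ominus> a) \<oplus>\<^bsub>H\<^sub>0\<^esub> f = \<zero>\<^bsub>H\<^sub>0\<^esub>" by (simp add: \<Theta>_add[symmetric] \<Theta>_zero A.A.l_neg)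
    then show ?thesis using a(1) unfolding carrier_H0 by blast
  qed
qed (auto simp: carrier_H0 \<Theta>_add[symmetric] \<Theta>_zero[symmetric] A.A.a_ac)

lemma addmap_\<Theta>: "addmap A H\<^sub>0 \<Theta>"
  by (intro addmapI) (auto simp: carrier_H0 \<Theta>_add)

lemma hcomp_H0: assumes a: "a \<in> carrier A" shows "hcomp H\<^sub>0 (\<Theta> a) d = \<Theta> (hcomp A a d)"
proof -
  have nz: "\<Theta> c \<noteq> \<zero>\<^bsub>H\<^sub>0\<^esub> \<longleftrightarrow> c \<noteq> \<zero>" if "c \<in> carrier A" for c
    using inj_onD[OF \<Theta>_inj _ that A.A.zero_closed] \<Theta>_zero by auto
  have sum: "finsum H\<^sub>0 (\<lambda>d. \<Theta> (c d)) S = \<Theta> (finsum A c S)" if "finite S" "\<And>d. c d \<in> carrier A" for c S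
    using addmap_finsum[OF addmap_\<Theta> A.A.abelian_group_axioms abelian_group_H0 that(1), of c] that(2) by auto
  have "hcomp H\<^sub>0 (\<Theta> a) = (\<lambda>d. \<Theta> (hcomp A a d))"
    unfolding hcomp_def[of H\<^sub>0]
  proof (rule the_equality)
    have S: "{d. \<Theta> (hcomp A a d) \<noteq> \<zero>\<^bsub>H\<^sub>0\<^esub>} = hsupp A a"
      unfolding hsupp_def using nz A.A.hcomp_closed[OF a] by auto
    have "finsum H\<^sub>0 (\<lambda>d. \<Theta> (hcomp A a d)) (hsupp A a) = \<Theta> (finsum A (hcomp A a) (hsupp A a))"
      by (rule sum[OF A.A.finite_hsupp[OF a] A.A.hcomp_closed[OF a]])
    then have "\<Theta> a = finsum H\<^sub>0 (\<lambda>d. \<Theta> (hcomp A a d)) (hsupp A a)" using A.A.hcomp_sum[OF a] by simp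
    then show "homogeneous_decomposition H\<^sub>0 (\<Theta> a) (\<lambda>d. \<Theta> (hcomp A a d))"
      unfolding homogeneous_decomposition_def S
      using A.A.finite_hsupp[OF a] \<Theta>_gr[OF A.A.hcomp_gr[OF a]] by (simp add: H0_simps(3))
  next
    fix f assume f: "homogeneous_decomposition H\<^sub>0 (\<Theta> a) f"
    have "\<forall>d. \<exists>c. c \<in> gr A d \<and> f d = \<Theta> c"
      using f \<Theta>_surj unfolding homogeneous_decomposition_def H0_simps by blast
    then obtain c where c: "\<And>d. c d \<in> gr A d" "f = (\<lambda>d. \<Theta> (c d))" by metis
    have cc: "\<And>d. c d \<in> carrier A" using A.A.gr_carrier[OF c(1)] .
    let ?S = "{d. f d \<noteq> \<zero>\<^bsub>H\<^sub>0\<^esub>}"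
    have S: "?S = {d. c d \<noteq> \<zero>}" unfolding c(2) using nz[OF cc] by simp
    have fS: "finite ?S" "\<Theta> a = finsum H\<^sub>0 f ?S" using f unfolding homogeneous_decomposition_def by auto
    then have "\<Theta> a = \<Theta> (finsum A c ?S)" using sum[OF fS(1) cc] unfolding c(2) by simp
    then have "a = finsum A c ?S"
      using inj_onD[OF \<Theta>_inj _ a] cc by (auto intro!: A.A.finsum_closed)
    then have "hcomp A a d = c d" for d
      using A.A.hcomp_eqI[OF fS(1) c(1), of a d] unfolding S by auto
    then show "f = (\<lambda>d. \<Theta> (hcomp A a d))" unfolding c(2) by simp
  qed
  then show ?thesis by simp
qed

lemma hsupp_H0: "a \<in> carrier A \<Longrightarrow> hsupp H\<^sub>0 (\<Theta> a) = hsupp A a"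
  using inj_onD[OF \<Theta>_inj _ A.A.hcomp_closed A.A.zero_closed]
  by (auto simp: hsupp_def hcomp_H0 \<Theta>_zero[symmetric])

lemma hcomp_M0: "hcomp M\<^sub>0 = hcomp A" "hsupp M\<^sub>0 = hsupp A"
  by (rule graded_cong_struct; simp)+

lemma finsum_B_closed: "(\<And>s. s \<in> S \<Longrightarrow> f s \<in> B) \<Longrightarrow> finsum B' f S \<in> B"
  using B.A.finsum_closed[of f S] by auto

lemma sgn_B'_closed: "b \<in> B \<Longrightarrow> sgn_mult B' q b \<in> B"
  using B.A.sgn_mult_closed by simp

text \<open>For homogeneous \<open>s\<close>, \<open>a\<close>, \<open>x\<close> of parities
  \<open>d\<close>, \<open>e\<close>, \<open>k\<close>, the exponents satisfy
  \<open>d e + d k + e (k + d) = (d + e) k\<close> modulo two, and \<open>\<psi>\<^sub>A\<close> is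
  multiplicative. The rest expands the three arguments one after another in the order used by
  \<open>HOML\<close>.\<close>

lemma \<theta>_smult:
  assumes s: "s \<in> carrier A" and a: "a \<in> carrier A" and x: "x \<in> carrier A"
  shows "\<theta> (s \<otimes> a) x = (\<Oplus>\<^bsub>B'\<^esub>d\<in>hsupp A s. \<Oplus>\<^bsub>B'\<^esub>e\<in>hsupp A a. \<Oplus>\<^bsub>B'\<^esub>k\<in>hsupp A x.
    sgn_mult B' (snd d * snd e + snd d * snd k)
      (\<theta> (hcomp A a e) (hcomp A x k \<otimes> \<psi>\<^sub>A (hcomp A s d))))"
proof -
  note Bab = B.A.abelian_group_axioms
  have 1: "\<theta> (s' \<otimes> a') x' = sgn_mult B' (snd d * snd e + snd d * snd k) (\<theta> a' (x' \<otimes> \<psi>\<^sub>A s'))"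
    if g: "s' \<in> gr A d" "a' \<in> gr A e" "x' \<in> gr A k" for s' a' x' d e k
  proof -
    have c: "s' \<in> carrier A" "a' \<in> carrier A" "x' \<in> carrier A" using g A.A.gr_carrier by blast+
    have "sgn_mult B' (snd d * snd e + snd d * snd k) (\<theta> a' (x' \<otimes> \<psi>\<^sub>A s')) =
        sgn_mult A (snd d * snd e + snd d * snd k + snd e * (snd k + snd d)) (E (x' \<otimes> \<psi>\<^sub>A (s' \<otimes> a')))"
      using \<theta>_hom[OF g(2) A.mult_gr[OF g(3) A.\<psi>_gr[OF g(1)]]] c
      by (simp add: sgn_B sgn_B_closed E A.\<psi>_closed A.A.sgn_mult_sgn_mult E_A A.\<psi>_mult A.A.m_assoc)
    also have "snd d * snd e + snd d * snd k + snd e * (snd k + snd d) = (snd d + snd e) * snd k"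
      by (cases "snd d"; cases "snd e"; cases "snd k") simp_all
    finally show ?thesis using \<theta>_hom[OF A.mult_gr[OF g(1,2)] g(3)] by simp
  qed
  have "\<theta> (s \<otimes> a) x = (\<Oplus>\<^bsub>B'\<^esub>d\<in>hsupp A s. \<theta> (hcomp A s d \<otimes> a) x)"
    by (rule A.A.addmap_hsum[OF addmap_comp[OF A.addmap_mult_right[OF a] addmap_\<theta>_left[OF x]] Bab s])
  also have "\<dots> = (\<Oplus>\<^bsub>B'\<^esub>d\<in>hsupp A s. \<Oplus>\<^bsub>B'\<^esub>e\<in>hsupp A a. \<Oplus>\<^bsub>B'\<^esub>k\<in>hsupp A x.
      sgn_mult B' (snd d * snd e + snd d * snd k)
        (\<theta> (hcomp A a e) (hcomp A x k \<otimes> \<psi>\<^sub>A (hcomp A s d))))"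
  proof (intro B.A.finsum_cong' refl)
    fix d
    let ?s = "hcomp A s d"
    have sc: "?s \<in> carrier A" and sg: "?s \<in> gr A d" using A.A.hcomp_closed[OF s] A.A.hcomp_gr[OF s] by blast+
    have "\<theta> (?s \<otimes> a) x = (\<Oplus>\<^bsub>B'\<^esub>e\<in>hsupp A a. \<theta> (?s \<otimes> hcomp A a e) x)"
      by (rule A.A.addmap_hsum[OF addmap_comp[OF A.addmap_mult_left[OF sc] addmap_\<theta>_left[OF x]] Bab a])
    also have "\<dots> = (\<Oplus>\<^bsub>B'\<^esub>e\<in>hsupp A a. \<Oplus>\<^bsub>B'\<^esub>k\<in>hsupp A x.
      sgn_mult B' (snd d * snd e + snd d * snd k) (\<theta> (hcomp A a e) (hcomp A x k \<otimes> \<psi>\<^sub>A ?s)))"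
    proof (intro B.A.finsum_cong' refl)
      fix e
      let ?a = "hcomp A a e"
      have ac: "?a \<in> carrier A" and ag: "?a \<in> gr A e" using A.A.hcomp_closed[OF a] A.A.hcomp_gr[OF a] by blast+
      have "\<theta> (?s \<otimes> ?a) x = (\<Oplus>\<^bsub>B'\<^esub>k\<in>hsupp A x. \<theta> (?s \<otimes> ?a) (hcomp A x k))"
        by (rule A.A.addmap_hsum[OF addmap_\<theta>_right[OF A.A.m_closed[OF sc ac]] Bab x])
      also have "\<dots> = (\<Oplus>\<^bsub>B'\<^esub>k\<in>hsupp A x.
          sgn_mult B' (snd d * snd e + snd d * snd k) (\<theta> ?a (hcomp A x k \<otimes> \<psi>\<^sub>A ?s)))"
        using 1[OF sg ag A.A.hcomp_gr[OF x]] \<theta>_closed[OF A.A.m_closed[OF sc ac] A.A.hcomp_closed[OF x]]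
        by (intro B.A.finsum_cong') auto
      finally show "\<theta> (?s \<otimes> ?a) x = (\<Oplus>\<^bsub>B'\<^esub>k\<in>hsupp A x.
          sgn_mult B' (snd d * snd e + snd d * snd k) (\<theta> ?a (hcomp A x k \<otimes> \<psi>\<^sub>A ?s)))" .
    qed (use a x sc in \<open>simp add: Pi_iff finsum_B_closed sgn_B'_closed \<theta>_closed A.A.hcomp_closed A.\<psi>_closed\<close>)
    finally show "\<theta> (?s \<otimes> a) x = (\<Oplus>\<^bsub>B'\<^esub>e\<in>hsupp A a. \<Oplus>\<^bsub>B'\<^esub>k\<in>hsupp A x.
      sgn_mult B' (snd d * snd e + snd d * snd k) (\<theta> (hcomp A a e) (hcomp A x k \<otimes> \<psi>\<^sub>A ?s)))" .
  qed (use s a x in \<open>simp add: Pi_iff finsum_B_closed sgn_B'_closed \<theta>_closed A.A.hcomp_closed A.\<psi>_closed\<close>)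
  finally show ?thesis .
qed

text \<open>Right linearity of \<open>E\<close> extracts \<open>t\<close> from
  \<open>\<psi>\<^sub>A (a \<otimes> t)\<close>, and the exponent \<open>(e + d) k\<close> splits
  into the one hidden in \<open>\<theta> a\<close> and the one of the right action.\<close>

lemma \<theta>_rsmult:
  assumes a: "a \<in> carrier A" and t: "t \<in> B" and x: "x \<in> carrier A"
  shows "\<theta> (a \<otimes> t) x = (\<Oplus>\<^bsub>B'\<^esub>d\<in>hsupp B' t. \<Oplus>\<^bsub>B'\<^esub>k\<in>hsupp A x.
    sgn_mult B' (snd d * snd k) (\<theta> a (hcomp A x k) \<otimes> hcomp B' t d))"
proof -
  note Bab = B.A.abelian_group_axioms
  have 1: "\<theta> (a \<otimes> t') x' = sgn_mult B' (snd d * snd k) (\<theta> a x' \<otimes>\<^bsub>B'\<^esub> t')"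
    if g: "t' \<in> gr B' d" "x' \<in> gr A k" for t' x' d k
  proof -
    have t': "t' \<in> B" and tA: "t' \<in> carrier A" using grB(2)[OF g(1)] B_A by blast+
    have xc: "x' \<in> carrier A" using A.A.gr_carrier[OF g(2)] .
    show ?thesis
    proof (rule A.A.addmap_eqI[OF addmap_comp[OF A.addmap_mult_right[OF tA] addmap_\<theta>_left[OF xc]]
          addmap_comp[OF addmap_comp[OF addmap_\<theta>_left[OF xc] B.addmap_mult_right] B.A.addmap_sgn_mult] Bab _ a])
      show "t' \<in> carrier B'" using t' by simp
      fix e a assume a: "a \<in> gr A e"
      note ac = A.A.gr_carrier[OF a]
      have "\<theta> (a \<otimes> t') x' = sgn_mult A ((snd e + snd d) * snd k) (E (x' \<otimes> \<psi>\<^sub>A a) \<otimes> t')"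
        using \<theta>_hom[OF A.mult_gr[OF a grB(1)[OF g(1)]] g(2)] E_mult_right[of "x' \<otimes> \<psi>\<^sub>A a" t'] ac xc t' tA
        by (simp add: A.\<psi>_mult A.\<psi>_closed A.A.m_assoc)
      also have "\<dots> = sgn_mult A (snd d * snd k) (\<theta> a x' \<otimes> t')"
        using ac xc tA by (simp add: \<theta>_hom[OF a g(2)] sgn_mult_mult A.A.sgn_mult_sgn_mult E_A A.\<psi>_closed algebra_simps)
      finally show "\<theta> (a \<otimes> t') x' = sgn_mult B' (snd d * snd k) (\<theta> a x' \<otimes>\<^bsub>B'\<^esub> t')"
        using ac xc t' by (simp add: sgn_B B_closed \<theta>_closed)
    qed
  qed
  have tc: "hcomp B' t d \<in> B" "hcomp B' t d \<in> carrier A" for d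
    using B.A.hcomp_closed[of t d] t B_A by auto
  have "\<theta> (a \<otimes> t) x = (\<Oplus>\<^bsub>B'\<^esub>d\<in>hsupp B' t. \<theta> (a \<otimes> hcomp B' t d) x)"
    by (rule B.A.addmap_hsum[OF addmap_comp[OF addmap_comp[OF incl A.addmap_mult_left[OF a]] addmap_\<theta>_left[OF x]] Bab])
      (use t in simp)
  also have "\<dots> = (\<Oplus>\<^bsub>B'\<^esub>d\<in>hsupp B' t. \<Oplus>\<^bsub>B'\<^esub>k\<in>hsupp A x.
    sgn_mult B' (snd d * snd k) (\<theta> a (hcomp A x k) \<otimes> hcomp B' t d))"
  proof (intro B.A.finsum_cong' refl)
    fix d
    have tg: "hcomp B' t d \<in> gr B' d" using B.A.hcomp_gr t by simp
    have "\<theta> (a \<otimes> hcomp B' t d) x = (\<Oplus>\<^bsub>B'\<^esub>k\<in>hsupp A x. \<theta> (a \<otimes> hcomp B' t d) (hcomp A x k))"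
      by (rule A.A.addmap_hsum[OF addmap_\<theta>_right[OF A.A.m_closed[OF a tc(2)]] Bab x])
    also have "\<dots> = (\<Oplus>\<^bsub>B'\<^esub>k\<in>hsupp A x. sgn_mult B' (snd d * snd k) (\<theta> a (hcomp A x k) \<otimes> hcomp B' t d))"
      using 1[OF tg A.A.hcomp_gr[OF x]] a x tc
      by (intro B.A.finsum_cong') (simp_all add: Pi_iff sgn_B'_closed B_closed \<theta>_closed A.A.hcomp_closed)
    finally show "\<theta> (a \<otimes> hcomp B' t d) x = \<dots>" .
  qed (use a x tc in \<open>simp add: Pi_iff finsum_B_closed sgn_B'_closed \<theta>_closed A.A.hcomp_closed B_closed\<close>)
  finally show ?thesis .
qed

abbreviation "H\<^sub>1 \<equiv> HOML B' A B' M\<^sub>0 N\<^sub>0"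

lemma H1_simps: "carrier H\<^sub>1 = carrier H\<^sub>0" "ring.add H\<^sub>1 = ring.add H\<^sub>0" "gr H\<^sub>1 = gr H\<^sub>0"
  by (simp_all add: HOML_def Let_def)

lemma smult_H1:
  assumes s: "s \<in> carrier A" and a: "a \<in> carrier A"
  shows "s \<odot>\<^bsub>H\<^sub>1\<^esub> \<Theta> a = \<Theta> (s \<otimes> a)"
proof
  fix x
  show "(s \<odot>\<^bsub>H\<^sub>1\<^esub> \<Theta> a) x = \<Theta> (s \<otimes> a) x"
  proof (cases "x \<in> carrier A")
    case x: True
    have "\<Theta> (hcomp A a e) (hcomp A x k \<otimes> \<psi>\<^sub>A (hcomp A s d))
        = \<theta> (hcomp A a e) (hcomp A x k \<otimes> \<psi>\<^sub>A (hcomp A s d))" for d e k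
      using s x by (simp add: \<Theta>_def A.A.hcomp_closed A.\<psi>_closed)
    then show ?thesis
      unfolding HOML_def Let_def
      by (simp add: x finsum_N0 sgn_N0 hcomp_M0 hsupp_H0[OF a] hcomp_H0[OF a] \<theta>_smult[OF s a x, symmetric])
        (simp add: \<Theta>_def x)
  qed (simp add: HOML_def Let_def \<Theta>_def)
qed

lemma rsmult_H1:
  assumes t: "t \<in> B" and a: "a \<in> carrier A"
  shows "rsmult H\<^sub>1 (\<Theta> a) t = \<Theta> (a \<otimes> t)"
proof
  fix x
  show "rsmult H\<^sub>1 (\<Theta> a) t x = \<Theta> (a \<otimes> t) x"
  proof (cases "x \<in> carrier A")
    case x: True
    have "\<Theta> a (hcomp A x k) = \<theta> a (hcomp A x k)" for k
      using x by (simp add: \<Theta>_def A.A.hcomp_closed)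
    then show ?thesis
      unfolding HOML_def Let_def
      by (simp add: x finsum_N0 sgn_N0 hcomp_M0 \<theta>_rsmult[OF a t x, symmetric]) (simp add: \<Theta>_def x)
  qed (simp add: HOML_def Let_def \<Theta>_def)
qed

theorem bimodule_isomorphism:
  "bimodule_isomorphic A B' (regular_bimodule A) H\<^sub>1"
  unfolding bimodule_isomorphic_def
proof (rule bexI[of _ "restrict \<Theta> (carrier A)"], intro conjI ballI)
  have "bij_betw \<Theta> (carrier A) (carrier H\<^sub>1)"
    using \<Theta>_inj by (simp add: bij_betw_def H1_simps carrier_H0)
  then show "bij_betw (restrict \<Theta> (carrier A)) (carrier (regular_bimodule A)) (carrier H\<^sub>1)"
    by (simp add: bij_betw_restrict_eq)
  show "restrict \<Theta> (carrier A) (rsmult (regular_bimodule A) x s) = rsmult H\<^sub>1 (restrict \<Theta> (carrier A) x) s"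
    if "x \<in> carrier (regular_bimodule A)" "s \<in> carrier B'" for x s
    using that by (simp add: rsmult_H1 B_A)
  show "restrict \<Theta> (carrier A) \<in> mod_hom A (regular_bimodule A) H\<^sub>1"
    unfolding mod_hom_def using A.A.gr_carrier \<Theta>_gr
    by (auto simp: H1_simps carrier_H0 \<Theta>_add smult_H1 H0_simps(3))
qed

end

section \<open>Dual bases from projectivity\<close>

text \<open>For finite \<open>I\<close>, the free module with a basis vector in degree
  \<open>dg v\<close> for each \<open>v\<close>. Elements are coordinate functions of type
  \<open>'m \<Rightarrow> 'r\<close>, the carrier type of the covering test modules in
  \<open>projective\<close>.\<close>

definition free_gmodule ::
    "('l::ab_group_add, 'q, 'r, 'e) gmodule_scheme \<Rightarrow> 'm set \<Rightarrow> ('m \<Rightarrow> 'l \<times> bit) \<Rightarrow> ('l, 'r, 'm \<Rightarrow> 'r) gmodule" where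
  "free_gmodule R I dg =
     \<lparr>carrier = I \<rightarrow>\<^sub>E carrier R, monoid.mult = undefined, one = undefined,
      ring.zero = (\<lambda>v\<in>I. \<zero>\<^bsub>R\<^esub>), ring.add = (\<lambda>f g. \<lambda>v\<in>I. f v \<oplus>\<^bsub>R\<^esub> g v),
      smult = (\<lambda>r f. \<lambda>v\<in>I. r \<otimes>\<^bsub>R\<^esub> f v),
      gr = (\<lambda>d. {f \<in> I \<rightarrow>\<^sub>E carrier R. \<forall>v\<in>I. f v \<in> gr R (d - dg v)})\<rparr>"

lemma free_gmodule_simps:
  "carrier (free_gmodule R I dg) = I \<rightarrow>\<^sub>E carrier R"
  "\<zero>\<^bsub>free_gmodule R I dg\<^esub> = (\<lambda>v\<in>I. \<zero>\<^bsub>R\<^esub>)"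
  "f \<oplus>\<^bsub>free_gmodule R I dg\<^esub> g = (\<lambda>v\<in>I. f v \<oplus>\<^bsub>R\<^esub> g v)"
  "r \<odot>\<^bsub>free_gmodule R I dg\<^esub> f = (\<lambda>v\<in>I. r \<otimes>\<^bsub>R\<^esub> f v)"
  "gr (free_gmodule R I dg) d = {f \<in> I \<rightarrow>\<^sub>E carrier R. \<forall>v\<in>I. f v \<in> gr R (d - dg v)}"
  by (simp_all add: free_gmodule_def)

lemma graded_left_module_free:
  fixes R :: "('l::ab_group_add, 'q, 'r, 'e) gmodule_scheme"
  assumes R: "graded_superring R" and I: "finite I"
  shows "graded_left_module R (free_gmodule R I dg)"
proof -
  interpret R: ring R using R by (rule graded_superring_ring)
  interpret R: graded_group R using R by (rule graded_superring_group)
  let ?P = "free_gmodule R I dg"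
  note P = free_gmodule_simps[of R I dg]
  have mem: "f v \<in> carrier R" if "f \<in> carrier ?P" "v \<in> I" for f v using that unfolding P by (rule PiE_mem)
  have eqI: "f = g" if "f \<in> carrier ?P" "g \<in> carrier ?P" "\<And>v. v \<in> I \<Longrightarrow> f v = g v" for f g
    using that unfolding P by (rule PiE_ext)
  have ab: "abelian_group ?P"
  proof (rule abelian_groupI)
    show add: "f \<oplus>\<^bsub>?P\<^esub> g \<in> carrier ?P" if "f \<in> carrier ?P" "g \<in> carrier ?P" for f g
      using that mem by (simp add: P)
    show zero: "\<zero>\<^bsub>?P\<^esub> \<in> carrier ?P" by (simp add: P)
    show "f \<oplus>\<^bsub>?P\<^esub> g \<oplus>\<^bsub>?P\<^esub> h = f \<oplus>\<^bsub>?P\<^esub> (g \<oplus>\<^bsub>?P\<^esub> h)"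
      if "f \<in> carrier ?P" "g \<in> carrier ?P" "h \<in> carrier ?P" for f g h
      using that by (intro eqI add) (simp_all add: P(3) mem R.a_assoc)
    show "f \<oplus>\<^bsub>?P\<^esub> g = g \<oplus>\<^bsub>?P\<^esub> f" if "f \<in> carrier ?P" "g \<in> carrier ?P" for f g
      using that by (intro eqI add) (simp_all add: P(3) mem R.a_comm)
    show "\<zero>\<^bsub>?P\<^esub> \<oplus>\<^bsub>?P\<^esub> f = f" if "f \<in> carrier ?P" for f
      using that by (intro eqI add zero) (simp_all add: P(2,3) mem)
    show "\<exists>g\<in>carrier ?P. g \<oplus>\<^bsub>?P\<^esub> f = \<zero>\<^bsub>?P\<^esub>" if f: "f \<in> carrier ?P" for f
    proof (rule bexI)
      show g: "(\<lambda>v\<in>I. \<ominus>\<^bsub>R\<^esub> f v) \<in> carrier ?P" using mem[OF f] by (simp add: P(1))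
      show "(\<lambda>v\<in>I. \<ominus>\<^bsub>R\<^esub> f v) \<oplus>\<^bsub>?P\<^esub> f = \<zero>\<^bsub>?P\<^esub>"
        by (intro eqI add zero f g) (simp add: P(2,3) mem[OF f] R.l_neg)
    qed
  qed
  interpret P: abelian_group ?P by (rule ab)
  have eval: "addmap ?P R (\<lambda>f. f v)" if "v \<in> I" for v
    using that by (intro addmapI) (simp_all add: mem P(3))
  have smc: "r \<odot>\<^bsub>?P\<^esub> f \<in> carrier ?P" if "r \<in> carrier R" "f \<in> carrier ?P" for r f
    using that by (simp add: P(1,4) mem[unfolded P(1)])
  have grc: "f \<in> carrier ?P" if "f \<in> gr ?P d" for f d using that by (simp add: P(1,5))
  have grading: "grading ?P"
  proof (rule gradingI[where pr = "\<lambda>d f. \<lambda>v\<in>I. hcomp R (f v) (d - dg v)", OF ab])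
    show "additive_subgroup (gr ?P d) ?P" for d
      unfolding additive_subgroup_def
    proof (rule P.add.subgroupI)
      show "gr ?P d \<subseteq> carrier ?P" using grc by blast
      have "\<zero>\<^bsub>?P\<^esub> \<in> gr ?P d" by (simp add: P(2,5) R.gr_zero)
      then show "gr ?P d \<noteq> {}" by blast
      show "\<ominus>\<^bsub>?P\<^esub> f \<in> gr ?P d" if f: "f \<in> gr ?P d" for f
        using f P.a_inv_closed[OF grc[OF f]] addmap_neg[OF eval ab R.abelian_group_axioms grc[OF f]]
        by (simp add: P(1,5) R.gr_neg)
      show "f \<oplus>\<^bsub>?P\<^esub> g \<in> gr ?P d" if "f \<in> gr ?P d" "g \<in> gr ?P d" for f g
        using that P.a_closed[OF grc[OF that(1)] grc[OF that(2)]] by (simp add: P(1,3,5) R.gr_add)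
    qed
    show pr: "addmap ?P ?P (\<lambda>f. \<lambda>v\<in>I. hcomp R (f v) (d - dg v))" for d
      using mem by (intro addmapI) (auto simp: P(1,3) R.hcomp_closed R.hcomp_add PiE_mem intro!: restrict_ext)
    show "(\<lambda>v\<in>I. hcomp R (f v) (d - dg v)) = f" if f: "f \<in> gr ?P d" for f d
      using f R.hcomp_hom[of "f v" "d - dg v" "d - dg v" for v]
      by (intro eqI[OF addmap_closed[OF pr grc[OF f]] grc[OF f]]) (simp add: P(5))
    show "(\<lambda>v\<in>I. hcomp R (f v) (d - dg v)) = \<zero>\<^bsub>?P\<^esub>" if f: "f \<in> gr ?P e" "e \<noteq> d" for f d e
      using f(1,2) R.hcomp_hom[of "f v" "e - dg v" "d - dg v" for v]
      by (intro eqI[OF addmap_closed[OF pr grc[OF f(1)]] P.zero_closed]) (simp add: P(2,5))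
    show "\<exists>D g. finite D \<and> (\<forall>d\<in>D. g d \<in> gr ?P d) \<and> f = finsum ?P g D" if f: "f \<in> carrier ?P" for f
    proof (intro exI conjI)
      \<comment> \<open>Degree \<open>k\<close> in the coordinate \<open>v\<close> corresponds to
        degree \<open>k + dg v\<close> of the module.\<close>
      let ?D = "\<Union>v\<in>I. (\<lambda>k. k + dg v) ` hsupp R (f v)"
      let ?g = "\<lambda>d. \<lambda>v\<in>I. hcomp R (f v) (d - dg v)"
      show D: "finite ?D" using I R.finite_hsupp mem[OF f] by blast
      have gc: "?g d \<in> carrier ?P" for d by (rule addmap_closed[OF pr f])
      then show "\<forall>d\<in>?D. ?g d \<in> gr ?P d" using R.hcomp_gr[OF mem[OF f]] by (simp add: P(1,5))
      show "f = finsum ?P ?g ?D"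
      proof (rule eqI[OF f])
        show "finsum ?P ?g ?D \<in> carrier ?P" using gc by (intro P.finsum_closed) blast
        fix v assume v: "v \<in> I"
        let ?D' = "(\<lambda>d. d - dg v) ` ?D"
        have fv: "f v \<in> carrier R" by (rule mem[OF f v])
        have "finsum ?P ?g ?D v = finsum R (\<lambda>d. ?g d v) ?D"
          using gc by (intro addmap_finsum[OF eval[OF v] ab R.abelian_group_axioms D]) blast
        also have "\<dots> = finsum R (\<lambda>d. hcomp R (f v) (d - dg v)) ?D" using v by simp
        also have "\<dots> = finsum R (hcomp R (f v)) ?D'"
          by (rule R.finsum_reindex[symmetric]) (auto simp: inj_on_def R.hcomp_closed[OF fv])
        also have "\<dots> = finsum R (hcomp R (f v)) (hsupp R (f v))"
        proof (rule finsum_support[OF R.abelian_group_axioms])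
          show "finite ?D'" using D by simp
          show "hsupp R (f v) \<subseteq> ?D'"
          proof
            fix k assume "k \<in> hsupp R (f v)"
            then have "k + dg v \<in> ?D" using v by blast
            then have "k + dg v - dg v \<in> ?D'" by (rule imageI)
            then show "k \<in> ?D'" by simp
          qed
          show "hcomp R (f v) \<in> ?D' \<rightarrow> carrier R" using R.hcomp_closed[OF fv] by blast
        qed (simp add: R.not_in_hsupp)
        also have "\<dots> = f v" using R.hcomp_sum[OF fv] by simp
        finally show "f v = finsum ?P ?g ?D v" by simp
      qed
    qed
  qed
  show ?thesis
    unfolding graded_left_module_def
  proof (intro conjI ballI allI ab grading smc)
    show "(r \<oplus>\<^bsub>R\<^esub> s) \<odot>\<^bsub>?P\<^esub> f = r \<odot>\<^bsub>?P\<^esub> f \<oplus>\<^bsub>?P\<^esub> s \<odot>\<^bsub>?P\<^esub> f"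
      if "r \<in> carrier R" "s \<in> carrier R" "f \<in> carrier ?P" for r s f
      using that by (intro eqI smc P.a_closed) (simp_all add: P(3,4) mem R.l_distr)
    show "r \<odot>\<^bsub>?P\<^esub> (f \<oplus>\<^bsub>?P\<^esub> g) = r \<odot>\<^bsub>?P\<^esub> f \<oplus>\<^bsub>?P\<^esub> r \<odot>\<^bsub>?P\<^esub> g"
      if "r \<in> carrier R" "f \<in> carrier ?P" "g \<in> carrier ?P" for r f g
      using that by (intro eqI smc P.a_closed) (simp_all add: P(3,4) mem R.r_distr)
    show "(r \<otimes>\<^bsub>R\<^esub> s) \<odot>\<^bsub>?P\<^esub> f = r \<odot>\<^bsub>?P\<^esub> (s \<odot>\<^bsub>?P\<^esub> f)"
      if "r \<in> carrier R" "s \<in> carrier R" "f \<in> carrier ?P" for r s f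
      using that by (intro eqI smc) (simp_all add: P(4) mem R.m_assoc)
    show "\<one>\<^bsub>R\<^esub> \<odot>\<^bsub>?P\<^esub> f = f" if "f \<in> carrier ?P" for f
      using that by (intro eqI smc) (simp_all add: P(4) mem)
    show "r \<odot>\<^bsub>?P\<^esub> f \<in> gr ?P (d + e)" if "r \<in> gr R d" "f \<in> gr ?P e" for d e r f
      using smc[OF R.gr_carrier[OF that(1)] grc[OF that(2)]] that(2)
        graded_superring_mult[OF R that(1), of _ "e - dg v" for v]
      by (simp add: P(1,4,5) add_diff_eq)
  qed
qed

text \<open>Covers in one statement the regular actions, with \<open>\<sigma>\<close> the identity
  on elements and \<open>c = 0\<close>, and the twisted restriction, with
  \<open>\<sigma> = \<rho>\<close> and \<open>c = \<delta>\<close>.\<close>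

lemma graded_left_module_through:
  fixes A :: "('l::ab_group_add, 'q, 'a, 'e) gmodule_scheme" and M :: "('l, 'r, 'a, 'f) gmodule_scheme"
    and R :: "('l, 'q1, 'r, 'e1) gmodule_scheme"
  assumes A: "graded_superring A" and R: "graded_superring R"
    and M: "carrier M = carrier A" "ring.zero M = ring.zero A" "ring.add M = ring.add A"
    and gr: "\<And>d. gr M d = gr A (d - c)"
    and sm: "\<And>r x. r \<in> carrier R \<Longrightarrow> x \<in> carrier A \<Longrightarrow> r \<odot>\<^bsub>M\<^esub> x = \<sigma> r \<otimes>\<^bsub>A\<^esub> x"
    and \<sigma>: "addmap R A \<sigma>" "\<And>r s. r \<in> carrier R \<Longrightarrow> s \<in> carrier R \<Longrightarrow> \<sigma> (r \<otimes>\<^bsub>R\<^esub> s) = \<sigma> r \<otimes>\<^bsub>A\<^esub> \<sigma> s"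
      "\<sigma> \<one>\<^bsub>R\<^esub> = \<one>\<^bsub>A\<^esub>" "\<And>r d. r \<in> gr R d \<Longrightarrow> \<sigma> r \<in> gr A d"
  shows "graded_left_module R M"
proof -
  interpret A: ring A using A by (rule graded_superring_ring)
  interpret A: graded_group A using A by (rule graded_superring_group)
  interpret R: ring R using R by (rule graded_superring_ring)
  interpret R: graded_group R using R by (rule graded_superring_group)
  have "bij (\<lambda>d. d - c)" by (rule bij_diff_right)
  then interpret M: graded_group M
    by (intro graded_group_regrade[OF A.graded_group_axioms M gr])
  note c = addmap_closed[OF \<sigma>(1)]
  show ?thesis
    unfolding graded_left_module_def
  proof (intro conjI ballI allI M.abelian_group_axioms M.grading)
    show "r \<odot>\<^bsub>M\<^esub> x \<in> gr M (d + e)" if r: "r \<in> gr R d" and x: "x \<in> gr M e" for r x d e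
    proof -
      have x': "x \<in> gr A (e - c)" using x gr by simp
      then show ?thesis
        using graded_superring_mult[OF A \<sigma>(4)[OF r] x'] sm[OF R.gr_carrier[OF r] A.gr_carrier[OF x']]
        by (simp add: gr add_diff_eq)
    qed
  qed (simp_all add: M sm c \<sigma> addmap_add[OF \<sigma>(1)] A.l_distr A.r_distr A.m_assoc)
qed

lemma graded_bimodule_through:
  fixes A :: "('l::ab_group_add, 'q, 'a, 'e) gmodule_scheme" and M :: "('l, 'r, 'a, 's) gbimodule"
    and S :: "('l, 'q1, 's, 'e1) gmodule_scheme"
  assumes A: "graded_superring A" and S: "graded_superring S" and glm: "graded_left_module R M"
    and M: "carrier M = carrier A" "ring.add M = ring.add A"
    and gr: "\<And>d. gr M d = gr A (d - c)"
    and sm: "\<And>r x. r \<in> carrier R \<Longrightarrow> x \<in> carrier A \<Longrightarrow> r \<odot>\<^bsub>M\<^esub> x = \<sigma> r \<otimes>\<^bsub>A\<^esub> x"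
    and rs: "\<And>s x. rsmult M x s = x \<otimes>\<^bsub>A\<^esub> \<tau> s"
    and \<sigma>: "\<And>r. r \<in> carrier R \<Longrightarrow> \<sigma> r \<in> carrier A"
    and \<tau>: "addmap S A \<tau>" "\<And>r s. r \<in> carrier S \<Longrightarrow> s \<in> carrier S \<Longrightarrow> \<tau> (r \<otimes>\<^bsub>S\<^esub> s) = \<tau> r \<otimes>\<^bsub>A\<^esub> \<tau> s"
      "\<tau> \<one>\<^bsub>S\<^esub> = \<one>\<^bsub>A\<^esub>" "\<And>r d. r \<in> gr S d \<Longrightarrow> \<tau> r \<in> gr A d"
  shows "graded_bimodule R S M"
proof -
  interpret A: ring A using A by (rule graded_superring_ring)
  note c = addmap_closed[OF \<tau>(1)]
  show ?thesis
    unfolding graded_bimodule_def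
  proof (intro conjI ballI allI glm)
    show "rsmult M x s \<in> gr M (d + e)" if x: "x \<in> gr M d" and s: "s \<in> gr S e" for x s d e
      using graded_superring_mult[OF A x[unfolded gr] \<tau>(4)[OF s]] by (simp add: rs gr algebra_simps)
  qed (simp_all add: M sm rs c \<tau> \<sigma> addmap_add[OF \<tau>(1)] A.l_distr A.r_distr A.m_assoc)
qed

lemma finsum_twisted_bimodule: "finsum (twisted_bimodule A \<beta> \<alpha>) f S = finsum A f S"
  by (rule finsum_cong_struct) simp_all

context frobenius_pair
begin

text \<open>Scalars act as the elements \<open>k \<odot> \<one>\<close> of \<open>B\<close>, so
  generators over the field are generators over \<open>B\<close>.\<close>

lemma finitely_generated_left: "finitely_generated B' (regular_bimodule A)"
proof -
  have "finitely_generated F A" using A.frob by (simp add: frobenius_superalgebra_def)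
  then obtain S where S: "finite S" "S \<subseteq> carrier A"
    and gen: "\<And>x. x \<in> carrier A \<Longrightarrow> \<exists>c. c \<in> S \<rightarrow> carrier F \<and> x = (\<Oplus>s\<in>S. c s \<odot> s)"
    unfolding finitely_generated_def by blast
  have "\<exists>b. b \<in> S \<rightarrow> B \<and> x = (\<Oplus>s\<in>S. b s \<otimes> s)" if x: "x \<in> carrier A" for x
  proof -
    obtain c where c: "c \<in> S \<rightarrow> carrier F" "x = (\<Oplus>s\<in>S. c s \<odot> s)" using gen[OF x] by blast
    have cs: "c s \<in> carrier F" "s \<in> carrier A" if "s \<in> S" for s using c(1) S(2) that by auto
    have "(\<Oplus>s\<in>S. c s \<odot> s) = (\<Oplus>s\<in>S. (c s \<odot> \<one>) \<otimes> s)"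
      using cs by (intro A.A.finsum_cong') (simp_all add: Pi_iff A.smult_mult)
    then show ?thesis
      using c(2) cs by (intro exI[of _ "\<lambda>s. c s \<odot> \<one>"]) (simp add: B_closed)
  qed
  then show ?thesis
    unfolding finitely_generated_def using S by (intro exI[of _ S]) (simp add: finsum_twisted_bimodule)
qed

text \<open>The lifting property is applied to the free graded module on the finite set \<open>I\<close> of the
  homogeneous components of a generating set; the coordinates of the lift of the identity are
  \<open>B\<close>-linear forms and hence of the form \<open>x \<mapsto> \<rho> (E (x \<psi>\<^sub>A(y)))\<close>.\<close>

lemma dual_bases:
  assumes proj: "projective B' (regular_bimodule A)"
  obtains I dg y where "finite I" "\<And>v. v \<in> I \<Longrightarrow> v \<in> gr A (dg v)"
    "\<And>v. v \<in> I \<Longrightarrow> y v \<in> gr A (- dg v - \<delta>)"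
    "\<And>x. x \<in> carrier A \<Longrightarrow> x = finsum A (\<lambda>v. \<rho> (E (x \<otimes> \<psi>\<^sub>A (y v))) \<otimes> v) I"
proof -
  obtain S where S: "finite S" "S \<subseteq> carrier A"
    and gen: "\<And>x. x \<in> carrier A \<Longrightarrow> \<exists>c. c \<in> S \<rightarrow> B \<and> x = (\<Oplus>s\<in>S. c s \<otimes> s)"
    using finitely_generated_left unfolding finitely_generated_def finsum_twisted_bimodule by auto
  define I where "I = (\<Union>s\<in>S. hcomp A s ` hsupp A s)"
  have I: "finite I" unfolding I_def using S A.A.finite_hsupp by blast
  have "\<forall>v\<in>I. \<exists>d. v \<in> gr A d" unfolding I_def using S A.A.hcomp_gr by blast
  then obtain dg where dg: "\<And>v. v \<in> I \<Longrightarrow> v \<in> gr A (dg v)" by metis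
  have IA: "\<And>v. v \<in> I \<Longrightarrow> v \<in> carrier A" using A.A.gr_carrier[OF dg] .
  define P where "P = free_gmodule B' I dg"
  note Ps = free_gmodule_simps[of B' I dg, folded P_def]
  have Pm: "graded_left_module B' P" unfolding P_def by (rule graded_left_module_free[OF B.superring I])
  interpret P: graded_lmodule B' P using Pm by (simp add: graded_lmodule_iff)
  \<comment> \<open>The test modules in \<open>projective\<close> have no field for a right action,
    so the regular bimodule is truncated.\<close>
  define Q where "Q = gmodule.truncate (regular_bimodule A)"
  have Qs: "carrier Q = carrier A" "ring.zero Q = ring.zero A" "ring.add Q = ring.add A" "gr Q = gr A"
    "smult Q = (\<lambda>b x. b \<otimes> x)"
    by (simp_all add: Q_def gmodule.truncate_def)
  have Qm: "graded_left_module B' Q"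
    by (rule graded_left_module_through[where c = 0 and \<sigma> = "\<lambda>b. b", OF A.superring B.superring Qs(1-3) _ _ incl])
      (simp_all add: Qs)
  define p where "p f = finsum A (\<lambda>v. f v \<otimes> v) I" for f
  have fB: "f v \<in> B" "f v \<in> carrier A" if "f \<in> carrier P" "v \<in> I" for f v
    using that B_A unfolding Ps by auto
  have pa: "addmap P Q p"
    unfolding p_def
  proof (rule addmapI)
    fix f g assume f: "f \<in> carrier P" and g: "g \<in> carrier P"
    have "finsum A (\<lambda>v. (f \<oplus>\<^bsub>P\<^esub> g) v \<otimes> v) I = finsum A (\<lambda>v. f v \<otimes> v \<oplus> g v \<otimes> v) I"
      using fB[OF f] fB[OF g] IA by (intro A.A.finsum_cong') (simp_all add: Pi_iff Ps(3) A.A.l_distr)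
    also have "\<dots> = finsum A (\<lambda>v. f v \<otimes> v) I \<oplus> finsum A (\<lambda>v. g v \<otimes> v) I"
      using fB[OF f] fB[OF g] IA by (intro A.A.finsum_addf) (simp_all add: Pi_iff)
    finally show "finsum A (\<lambda>v. (f \<oplus>\<^bsub>P\<^esub> g) v \<otimes> v) I =
      finsum A (\<lambda>v. f v \<otimes> v) I \<oplus>\<^bsub>Q\<^esub> finsum A (\<lambda>v. g v \<otimes> v) I" by (simp add: Qs)
  qed (use fB IA in \<open>simp add: Qs Pi_iff A.A.finsum_closed\<close>)
  have ps: "p (b \<odot>\<^bsub>P\<^esub> f) = b \<otimes> p f" if b: "b \<in> B" and f: "f \<in> carrier P" for b f
  proof -
    have "p (b \<odot>\<^bsub>P\<^esub> f) = finsum A (\<lambda>v. b \<otimes> (f v \<otimes> v)) I"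
      unfolding p_def using fB[OF f] IA B_A[OF b]
      by (intro A.A.finsum_cong') (simp_all add: Pi_iff Ps(4) A.A.m_assoc)
    also have "\<dots> = b \<otimes> p f"
      unfolding p_def using fB[OF f] IA
      by (intro addmap_finsum[OF A.addmap_mult_left[OF B_A[OF b]] A.A.abelian_group_axioms
            A.A.abelian_group_axioms I, symmetric]) (simp add: Pi_iff)
    finally show ?thesis .
  qed
  have pg: "p f \<in> gr Q d" if f: "f \<in> gr P d" for f d
    unfolding p_def Qs
  proof (rule A.A.gr_finsum[OF I])
    fix v assume v: "v \<in> I"
    have "f v \<in> gr A (d - dg v)" using f v unfolding Ps by simp
    then show "f v \<otimes> v \<in> gr A d" using A.mult_gr[OF _ dg[OF v], of "f v" "d - dg v"] by simp
  qed
  have phom: "restrict p (carrier P) \<in> mod_hom B' P Q"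
    by (rule mod_homI[OF Pm pa pg]) (simp_all add: ps Qs)
  let ?U = "p ` carrier P"
  have Uz: "\<zero> \<in> ?U"
  proof (rule image_eqI)
    have "abelian_group Q" using Qm by (simp add: graded_left_module_def)
    then show "\<zero> = p \<zero>\<^bsub>P\<^esub>"
      using addmap_zero[OF pa P.abelian_group_axioms] by (simp add: Qs)
  qed (rule P.zero_closed)
  have Ua: "a \<oplus> b \<in> ?U" if "a \<in> ?U" "b \<in> ?U" for a b
  proof -
    obtain f g where "f \<in> carrier P" "a = p f" "g \<in> carrier P" "b = p g"
      using \<open>a \<in> ?U\<close> \<open>b \<in> ?U\<close> by blast
    then show ?thesis
      using addmap_add[OF pa, of f g] by (intro image_eqI[of _ _ "f \<oplus>\<^bsub>P\<^esub> g"]) (simp_all add: Qs)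
  qed
  have UA: "?U \<subseteq> carrier A" using addmap_closed[OF pa] by (auto simp: Qs)
  have Us: "finsum A g Y \<in> ?U" if "finite Y" "\<And>x. x \<in> Y \<Longrightarrow> g x \<in> ?U" for g and Y :: "'z set"
    using that
  proof (induction Y rule: finite_induct)
    case (insert x Y)
    have "g x \<in> carrier A" "g \<in> Y \<rightarrow> carrier A" using insert.prems UA by auto
    then have "finsum A g (insert x Y) = g x \<oplus> finsum A g Y" using insert.hyps by simp
    then show ?case using Ua insert by simp
  qed (simp add: Uz)
  have UI: "v \<in> ?U" if v: "v \<in> I" for v
  proof (rule image_eqI)
    let ?f = "\<lambda>w\<in>I. if w = v then \<one> else \<zero>"
    show "?f \<in> carrier P" by (simp add: Ps B_closed)
    have "p ?f = finsum A (\<lambda>w. if w = v then v else \<zero>) I"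
      unfolding p_def using IA v by (intro A.A.finsum_cong') (simp_all add: Pi_iff)
    then show "v = p ?f" using finsum_delta[OF A.A.abelian_group_axioms I v IA[OF v]] by simp
  qed
  have Usurj: "x \<in> ?U" if x: "x \<in> carrier A" for x
  proof -
    obtain c where c: "c \<in> S \<rightarrow> B" "x = (\<Oplus>s\<in>S. c s \<otimes> s)" using gen[OF x] by blast
    have "c s \<otimes> s \<in> ?U" if s: "s \<in> S" for s
    proof -
      have sA: "s \<in> carrier A" using s S by blast
      have "finsum A (hcomp A s) (hsupp A s) \<in> ?U"
        by (rule Us[OF A.A.finite_hsupp[OF sA] UI]) (use s in \<open>auto simp: I_def\<close>)
      then have "s \<in> ?U" using A.A.hcomp_sum[OF sA] by simp
      then obtain f where "f \<in> carrier P" "s = p f" by blast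
      moreover have "c s \<in> B" using c(1) s by blast
      ultimately show ?thesis using ps P.smult_closed by (metis image_eqI sub_structure_simps(1))
    qed
    then show ?thesis unfolding c(2) by (rule Us[OF S(1)])
  qed
  have surj: "restrict p (carrier P) ` carrier P = carrier Q"
    using Usurj UA by (auto simp: Qs)
  have idhom: "restrict (\<lambda>x. x) (carrier A) \<in> mod_hom B' (regular_bimodule A) Q"
  proof -
    have "addmap (regular_bimodule A) Q (\<lambda>x. x)" by (simp add: addmap_def Qs)
    then have "restrict (\<lambda>x. x) (carrier (regular_bimodule A)) \<in> mod_hom B' (regular_bimodule A) Q"
      using proj by (intro mod_homI) (simp_all add: projective_def Qs)
    then show ?thesis by simp
  qed
  \<comment> \<open>Lifting the identity along the surjection \<open>p\<close> gives a section of
    \<open>p\<close>; its coordinates express each \<open>x\<close> through the generators in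
    \<open>I\<close>.\<close>
  obtain h where h: "h \<in> mod_hom B' (regular_bimodule A) P"
    and hp: "compose (carrier (regular_bimodule A)) (restrict p (carrier P)) h = restrict (\<lambda>x. x) (carrier A)"
    using proj phom idhom Pm Qm surj unfolding projective_def by blast
  have hc: "h x \<in> carrier P" if "x \<in> carrier A" for x using mod_hom_closed[OF h] that by simp
  have x_eq: "x = finsum A (\<lambda>v. h x v \<otimes> v) I" if "x \<in> carrier A" for x
    using fun_cong[OF hp, of x] that hc[OF that] by (simp add: compose_def p_def)
  have rep: "\<exists>y\<in>gr A (- dg v - \<delta>). \<forall>x\<in>carrier A. h x v = \<rho> (E (x \<otimes> \<psi>\<^sub>A y))" if v: "v \<in> I" for v
  proof -
    \<comment> \<open>The coordinate is linear over \<open>B\<close> in the plain sense, while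
      representability by \<open>E\<close> asks for \<open>\<rho>\<close> on the argument. Applying
      the inverse of \<open>\<rho>\<close> to the values converts one into the other.\<close>
    define f where "f x = inv_into B \<rho> (h x v)" for x
    have hB: "h x v \<in> B" if "x \<in> carrier A" for x using fB(1)[OF hc[OF that] v] .
    have fc: "f x \<in> B" and \<rho>f: "\<rho> (f x) = h x v" if "x \<in> carrier A" for x
      using \<rho>_surj[OF hB[OF that]] unfolding f_def by (auto intro: inv_into_into f_inv_into_f)
    have f_eqI: "f x = b" if "x \<in> carrier A" "b \<in> B" "h x v = \<rho> b" for x b
      using that inv_into_f_f[OF \<rho>_inj] by (simp add: f_def)
    have h_add: "h (x \<oplus> y) v = h x v \<oplus> h y v" if "x \<in> carrier A" "y \<in> carrier A" for x y
      using addmap_add[OF mod_hom_addmap[OF h], of x y] that v by (simp add: Ps)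
    have h_mult: "h (b \<otimes> x) v = b \<otimes> h x v" if "b \<in> B" "x \<in> carrier A" for b x
      using mod_hom_smult[OF h, of b x] that v by (simp add: Ps)
    have "addmap A B' f"
    proof (rule addmapI)
      fix x z assume xz: "x \<in> carrier A" "z \<in> carrier A"
      have "\<rho> (f x \<oplus> f z) = h x v \<oplus> h z v"
        using addmap_add[OF addmap_\<rho>, of "f x" "f z"] xz by (simp add: fc \<rho>f)
      then show "f (x \<oplus> z) = f x \<oplus>\<^bsub>B'\<^esub> f z"
        using xz f_eqI[of "x \<oplus> z" "f x \<oplus> f z"] by (simp add: h_add fc B_closed)
    qed (simp add: fc)
    moreover have "f (\<rho> b \<otimes> x) = b \<otimes> f x" if "b \<in> B" "x \<in> carrier A" for b x
      using that by (intro f_eqI) (simp_all add: \<rho>_A B_closed fc h_mult \<rho>_closed \<rho>f \<rho>_mult)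
    moreover have "f x \<in> gr B' (e + (- dg v))" if x: "x \<in> gr A e" for x e
    proof (rule gr_addmap_cancel[OF B.A.graded_group_axioms B.A.graded_group_axioms addmap_\<rho> \<rho>_gr])
      note xc = A.A.gr_carrier[OF x]
      have "h x \<in> gr P e" using mod_hom_gr[OF h] x by simp
      then show "\<rho> (f x) \<in> gr B' (e + (- dg v))" unfolding \<rho>f[OF xc] Ps using v by simp
      show "f x \<in> carrier B'" using fc[OF xc] by simp
    qed (use \<rho>_inj in simp_all)
    ultimately have "\<exists>y\<in>gr A (- dg v - \<delta>). \<forall>x\<in>carrier A. f x = E (x \<otimes> \<psi>\<^sub>A y)"
      by (rule E_representable)
    then show ?thesis using \<rho>f by metis
  qed
  then obtain y where y: "\<And>v. v \<in> I \<Longrightarrow> y v \<in> gr A (- dg v - \<delta>)"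
    and hy: "\<And>v x. v \<in> I \<Longrightarrow> x \<in> carrier A \<Longrightarrow> h x v = \<rho> (E (x \<otimes> \<psi>\<^sub>A (y v)))" by metis
  have "x = finsum A (\<lambda>v. \<rho> (E (x \<otimes> \<psi>\<^sub>A (y v))) \<otimes> v) I" if x: "x \<in> carrier A" for x
  proof -
    have "finsum A (\<lambda>v. h x v \<otimes> v) I = finsum A (\<lambda>v. \<rho> (E (x \<otimes> \<psi>\<^sub>A (y v))) \<otimes> v) I"
      using fB(2)[OF hc[OF x]] IA by (intro A.A.finsum_cong') (simp_all add: Pi_iff hy[OF _ x, symmetric])
    then show ?thesis using x_eq[OF x] by simp
  qed
  then show thesis using that[OF I dg y] by blast
qed

text \<open>The functional \<open>E\<close> is faithful, so the second dual basis identity follows from the first by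
  applying \<open>E (x \<psi>\<^sub>A(-))\<close>.\<close>

lemma dual_bases_right:
  assumes I: "finite I" and v: "\<And>v. v \<in> I \<Longrightarrow> v \<in> carrier A" and y: "\<And>v. v \<in> I \<Longrightarrow> y v \<in> carrier A"
    and dual: "\<And>x. x \<in> carrier A \<Longrightarrow> x = finsum A (\<lambda>v. \<rho> (E (x \<otimes> \<psi>\<^sub>A (y v))) \<otimes> v) I"
    and a: "a \<in> carrier A"
  shows "a = finsum A (\<lambda>v. y v \<otimes> E (v \<otimes> \<psi>\<^sub>A a)) I"
proof -
  let ?a = "finsum A (\<lambda>v. y v \<otimes> E (v \<otimes> \<psi>\<^sub>A a)) I"
  have Ev: "E (w \<otimes> \<psi>\<^sub>A a) \<in> B" "E (w \<otimes> \<psi>\<^sub>A a) \<in> carrier A" if "w \<in> I" for w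
    using that v a by (simp_all add: E E_A A.\<psi>_closed)
  have ac: "?a \<in> carrier A" using y Ev by (intro A.A.finsum_closed) (simp add: Pi_iff)
  have "\<psi>\<^sub>A ?a = \<psi>\<^sub>A a"
  proof (rule E_faithful[OF A.\<psi>_closed[OF ac] A.\<psi>_closed[OF a]])
    fix x assume x: "x \<in> carrier A"
    have xy: "x \<otimes> \<psi>\<^sub>A (y w) \<in> carrier A" if "w \<in> I" for w using that x y by (simp add: A.\<psi>_closed)
    have \<rho>xy: "\<rho> (E (x \<otimes> \<psi>\<^sub>A (y w))) \<in> carrier A" if "w \<in> I" for w
      using xy[OF that] by (simp add: \<rho>_A E)
    have "E (x \<otimes> \<psi>\<^sub>A ?a) = finsum B' (\<lambda>w. E (x \<otimes> \<psi>\<^sub>A (y w \<otimes> E (w \<otimes> \<psi>\<^sub>A a)))) I"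
      using y Ev by (intro addmap_finsum[OF addmap_comp[OF addmap_comp[OF A.addmap_\<psi> A.addmap_mult_left[OF x]] addmap_E]
          A.A.abelian_group_axioms B.A.abelian_group_axioms I]) (simp add: Pi_iff)
    also have "\<dots> = finsum B' (\<lambda>w. E ((\<rho> (E (x \<otimes> \<psi>\<^sub>A (y w))) \<otimes> w) \<otimes> \<psi>\<^sub>A a)) I"
    proof (rule B.A.finsum_cong'[OF refl])
      show "(\<lambda>w. E ((\<rho> (E (x \<otimes> \<psi>\<^sub>A (y w))) \<otimes> w) \<otimes> \<psi>\<^sub>A a)) \<in> I \<rightarrow> carrier B'"
        using v a \<rho>xy by (simp add: Pi_iff E A.\<psi>_closed)
      fix w assume w: "w \<in> I"
      \<comment> \<open>The factor \<open>E (w \<otimes> \<psi>\<^sub>A a)\<close> leaves on the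
        right; the remaining factor \<open>E (x \<otimes> \<psi>\<^sub>A (y w))\<close> then enters
        on the left through \<open>\<rho>\<close>, which produces the summands of the first
        identity.\<close>
      have "E (x \<otimes> \<psi>\<^sub>A (y w \<otimes> E (w \<otimes> \<psi>\<^sub>A a))) = E (x \<otimes> \<psi>\<^sub>A (y w)) \<otimes> E (w \<otimes> \<psi>\<^sub>A a)"
        using E_mult_right[OF xy[OF w] Ev(1)[OF w]] x y[OF w] Ev(2)[OF w]
        by (simp add: A.\<psi>_mult A.A.m_assoc A.\<psi>_closed)
      also have "\<dots> = E (\<rho> (E (x \<otimes> \<psi>\<^sub>A (y w))) \<otimes> (w \<otimes> \<psi>\<^sub>A a))"
        using xy[OF w] v[OF w] a by (simp add: E_mult_left E A.\<psi>_closed)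
      finally show "E (x \<otimes> \<psi>\<^sub>A (y w \<otimes> E (w \<otimes> \<psi>\<^sub>A a))) =
          E ((\<rho> (E (x \<otimes> \<psi>\<^sub>A (y w))) \<otimes> w) \<otimes> \<psi>\<^sub>A a)"
        using \<rho>xy[OF w] v[OF w] a by (simp add: A.A.m_assoc A.\<psi>_closed)
    qed
    also have "\<dots> = E (finsum A (\<lambda>w. \<rho> (E (x \<otimes> \<psi>\<^sub>A (y w))) \<otimes> w) I \<otimes> \<psi>\<^sub>A a)"
      using v \<rho>xy by (intro addmap_finsum[OF addmap_comp[OF A.addmap_mult_right[OF A.\<psi>_closed[OF a]] addmap_E]
          A.A.abelian_group_axioms B.A.abelian_group_axioms I, symmetric]) (simp add: Pi_iff)
    also have "\<dots> = E (x \<otimes> \<psi>\<^sub>A a)" using dual[OF x] by simp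
    finally show "E (x \<otimes> \<psi>\<^sub>A ?a) = E (x \<otimes> \<psi>\<^sub>A a)" .
  qed
  then show ?thesis using A.\<psi>_inj[OF ac a] by simp
qed

section \<open>The dual pair of the twisted restriction and the induction bimodule\<close>

abbreviation "K \<equiv> shift B' \<delta> (twisted_bimodule A \<psi>\<^sub>B \<psi>\<^sub>A)"

lemma smult_K: assumes "b \<in> B" "x \<in> carrier A" shows "b \<odot>\<^bsub>K\<^esub> x = \<rho> b \<otimes> x"
proof -
  have ab: "abelian_group M\<^sub>0"
    by (rule abelian_group_cong_struct[OF _ _ _ A.A.abelian_group_axioms]) simp_all
  have am: "addmap B' M\<^sub>0 (\<lambda>r. r \<odot>\<^bsub>M\<^sub>0\<^esub> x)"
    using addmap_comp[OF addmap_comp[OF B.addmap_\<psi> incl] A.addmap_mult_right[OF assms(2)]] by (simp add: addmap_def)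
  have sM: "sgn_mult M\<^sub>0 = sgn_mult A" by (rule sgn_mult_cong_struct) simp_all
  have "addmap B' A (\<lambda>r. r \<odot>\<^bsub>K\<^esub> x)"
    using shift_smult_hom(2)[OF B.A.graded_group_axioms ab am B.A.gr_zero] by (simp add: addmap_def)
  then show ?thesis
  proof (rule B.A.addmap_eqI[OF _ addmap_comp[OF addmap_comp[OF addmap_\<rho> incl] A.addmap_mult_right[OF assms(2)]]
        A.A.abelian_group_axioms])
    fix d b assume b: "b \<in> gr B' d"
    show "b \<odot>\<^bsub>K\<^esub> x = \<rho> b \<otimes> x"
      using shift_smult_hom(1)[OF B.A.graded_group_axioms ab am b] B_A[OF B_closed(5)[OF grB(2)[OF b]]] assms(2)
      by (simp add: sM \<rho>_hom[OF b] sgn_mult_mult)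
  qed (use assms in simp)
qed

lemma gr_K: "gr K d = gr A (d - \<delta>)"
  by (simp add: gr_shift)

lemma graded_bimodule_K: "graded_bimodule B' A K"
proof (rule graded_bimodule_through[where c = \<delta> and \<sigma> = \<rho> and \<tau> = \<psi>\<^sub>A, OF A.superring A.superring])
  show "graded_left_module B' K"
    by (rule graded_left_module_through[where c = \<delta> and \<sigma> = \<rho>, OF A.superring B.superring _ _ _ gr_K
          _ addmap_comp[OF addmap_\<rho> incl]])
      (use \<rho>_gr in \<open>simp_all add: smult_K \<rho>_mult \<rho>_one\<close>)
qed (simp_all add: gr_K smult_K \<rho>_A A.addmap_\<psi> A.\<psi>_mult A.\<psi>_one A.\<psi>_gr)

lemma graded_bimodule_L: "graded_bimodule A B' (regular_bimodule A)"
proof (rule graded_bimodule_through[where c = 0 and \<sigma> = "\<lambda>a. a" and \<tau> = "\<lambda>b. b", OF A.superring B.superring])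
  show "graded_left_module A (regular_bimodule A)"
    by (rule graded_left_module_through[where c = 0 and \<sigma> = "\<lambda>a. a", OF A.superring A.superring _ _ _ _ _ addmap_id])
      simp_all
qed (simp_all add: incl)

text \<open>The compatibility of the pairing with \<open>B\<close> on both sides is the left and
  right linearity of \<open>E\<close>. The family \<open>v\<close> consists of the generators
  themselves; in \<open>K\<close> a generator has degree \<open>dg v + \<delta>\<close> because of
  the shift, opposite to the degree of \<open>y v\<close>.\<close>

lemma dual_pair_K_regular:
  assumes "finite I" and v: "\<And>v. v \<in> I \<Longrightarrow> v \<in> gr A (dg v)" and y: "\<And>v. v \<in> I \<Longrightarrow> y v \<in> gr A (- dg v - \<delta>)"
    and dual: "\<And>x. x \<in> carrier A \<Longrightarrow> x = finsum A (\<lambda>v. \<rho> (E (x \<otimes> \<psi>\<^sub>A (y v))) \<otimes> v) I"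
  shows "dual_pair A B' K (regular_bimodule A) (\<lambda>x l. E (x \<otimes> \<psi>\<^sub>A l)) I y (\<lambda>v. v) (\<lambda>v. - dg v - \<delta>)"
proof -
  have vc: "\<And>v. v \<in> I \<Longrightarrow> v \<in> carrier A" and yc: "\<And>v. v \<in> I \<Longrightarrow> y v \<in> carrier A"
    using v y A.A.gr_carrier by blast+
  have EB: "E (x \<otimes> \<psi>\<^sub>A l) \<in> B" if "x \<in> carrier A" "l \<in> carrier A" for x l
    using that by (simp add: E A.\<psi>_closed)
  have fs: "finsum K f I = finsum A f I" for f
    by (rule finsum_cong_struct) simp_all
  show ?thesis
  proof (intro dual_pair.intro dual_pair_axioms.intro
      superring_bimoduleI[OF B.superring A.superring graded_bimodule_K]
      superring_bimoduleI[OF A.superring B.superring graded_bimodule_L])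
    fix x l assume x: "x \<in> carrier K" and l: "l \<in> carrier (regular_bimodule A)"
    show "E (b \<odot>\<^bsub>K\<^esub> x \<otimes> \<psi>\<^sub>A l) = b \<otimes>\<^bsub>B'\<^esub> E (x \<otimes> \<psi>\<^sub>A l)" if "b \<in> carrier B'" for b
      using that x l by (simp add: smult_K A.A.m_assoc \<rho>_A A.\<psi>_closed E_mult_left)
    show "E (x \<otimes> \<psi>\<^sub>A (rsmult (regular_bimodule A) l b)) = E (x \<otimes> \<psi>\<^sub>A l) \<otimes>\<^bsub>B'\<^esub> b" if "b \<in> carrier B'" for b
      using that x l E_mult_right[of "x \<otimes> \<psi>\<^sub>A l" b] by (simp add: A.\<psi>_mult B_A A.\<psi>_closed A.A.m_assoc)
    show "E (rsmult K x a \<otimes> \<psi>\<^sub>A l) = E (x \<otimes> \<psi>\<^sub>A (a \<odot>\<^bsub>regular_bimodule A\<^esub> l))" if "a \<in> carrier A" for a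
      using that x l by (simp add: A.\<psi>_mult A.\<psi>_closed A.A.m_assoc)
  next
    fix l assume "l \<in> carrier (regular_bimodule A)"
    then have l: "l \<in> carrier A" by simp
    show "addmap K B' (\<lambda>x. E (x \<otimes> \<psi>\<^sub>A l))"
      using addmap_comp[OF A.addmap_mult_right[OF A.\<psi>_closed[OF l]] addmap_E] by (simp add: addmap_def)
    show "l = finsum (regular_bimodule A) (\<lambda>i. rsmult (regular_bimodule A) (y i) (E (i \<otimes> \<psi>\<^sub>A l))) I"
      using dual_bases_right[OF assms(1) vc yc dual l] by (simp add: finsum_twisted_bimodule)
  next
    fix x assume "x \<in> carrier K"
    then have x: "x \<in> carrier A" by simp
    show "addmap (regular_bimodule A) B' (\<lambda>l. E (x \<otimes> \<psi>\<^sub>A l))"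
      using addmap_comp[OF addmap_comp[OF A.addmap_\<psi> A.addmap_mult_left[OF x]] addmap_E] by (simp add: addmap_def)
    have "finsum A (\<lambda>v. E (x \<otimes> \<psi>\<^sub>A (y v)) \<odot>\<^bsub>K\<^esub> v) I = finsum A (\<lambda>v. \<rho> (E (x \<otimes> \<psi>\<^sub>A (y v))) \<otimes> v) I"
      using x vc yc by (intro A.A.finsum_cong') (simp_all add: Pi_iff smult_K EB \<rho>_A)
    then show "x = finsum K (\<lambda>i. E (x \<otimes> \<psi>\<^sub>A (y i)) \<odot>\<^bsub>K\<^esub> i) I"
      using dual[OF x] by (simp add: fs)
  next
    fix x d l e assume x: "x \<in> gr K d" and l: "l \<in> gr (regular_bimodule A) e"
    have "E (x \<otimes> \<psi>\<^sub>A l) \<in> gr B' (d - \<delta> + e + \<delta>)"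
      using x l by (intro E_gr A.mult_gr A.\<psi>_gr) (simp_all add: gr_K)
    moreover have "d - \<delta> + e + \<delta> = d + e" by simp
    ultimately show "E (x \<otimes> \<psi>\<^sub>A l) \<in> gr B' (d + e)" by (simp only:)
  qed (use v y in \<open>simp_all add: gr_K assms(1)\<close>)
qed

end

theorem corollary7p4:
  fixes F :: "('k, 'e) ring_scheme"
    and A :: "('l::ab_group_add, 'k, 'a) gmodule"
    and B :: "'a set"
    and tr\<^sub>A tr\<^sub>B :: "'a \<Rightarrow> 'k"
    and \<psi>\<^sub>A \<psi>\<^sub>B :: "'a \<Rightarrow> 'a"
    and l\<^sub>A l\<^sub>B :: 'l
    and p\<^sub>A p\<^sub>B :: bit
  assumes "field F"
    and "frobenius_superalgebra F A (- l\<^sub>A, p\<^sub>A) tr\<^sub>A"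
    and "nakayama_automorphism F A tr\<^sub>A \<psi>\<^sub>A"
    and "graded_subalgebra F B A"
    and "frobenius_superalgebra F (sub_structure A B) (- l\<^sub>B, p\<^sub>B) tr\<^sub>B"
    and "nakayama_automorphism F (sub_structure A B) tr\<^sub>B \<psi>\<^sub>B"
    and "projective (sub_structure A B) (regular_bimodule A)"
  shows "frobenius_extension A B \<psi>\<^sub>A \<psi>\<^sub>B (l\<^sub>B - l\<^sub>A, p\<^sub>B + p\<^sub>A) \<and>
    adjoint_functors A (sub_structure A B)
      (tensor A (shift (sub_structure A B) (l\<^sub>B - l\<^sub>A, p\<^sub>B + p\<^sub>A) (twisted_bimodule A \<psi>\<^sub>B \<psi>\<^sub>A))
        :: ('l, 'a, 'n) gmodule \<Rightarrow> ('l, 'a, ('a \<times> 'n \<Rightarrow>\<^sub>0 int) set) gmodule)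
      (tensor_map A (shift (sub_structure A B) (l\<^sub>B - l\<^sub>A, p\<^sub>B + p\<^sub>A) (twisted_bimodule A \<psi>\<^sub>B \<psi>\<^sub>A)))
      (tensor (sub_structure A B) (regular_bimodule A)
        :: ('l, 'a, 'm) gmodule \<Rightarrow> ('l, 'a, ('a \<times> 'm \<Rightarrow>\<^sub>0 int) set) gmodule)
      (tensor_map (sub_structure A B) (regular_bimodule A))"
proof
  interpret frobenius_pair F A B tr\<^sub>A tr\<^sub>B \<psi>\<^sub>A \<psi>\<^sub>B l\<^sub>A l\<^sub>B p\<^sub>A p\<^sub>B
    by (rule frobenius_pair.intro) fact+
  show "frobenius_extension A B \<psi>\<^sub>A \<psi>\<^sub>B (l\<^sub>B - l\<^sub>A, p\<^sub>B + p\<^sub>A)"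
    using A.superring assms(4,7) A.automorphism B.automorphism finitely_generated_left bimodule_isomorphism
    unfolding frobenius_extension_def Let_def graded_subalgebra_def \<delta>_def by blast
  obtain I dg y where "finite I" "\<And>v. v \<in> I \<Longrightarrow> v \<in> gr A (dg v)"
    "\<And>v. v \<in> I \<Longrightarrow> y v \<in> gr A (- dg v - \<delta>)"
    "\<And>x. x \<in> carrier A \<Longrightarrow> x = finsum A (\<lambda>v. \<rho> (E (x \<otimes>\<^bsub>A\<^esub> \<psi>\<^sub>A (y v))) \<otimes>\<^bsub>A\<^esub> v) I"
    using dual_bases[OF assms(7)] by blast
  from dual_pair.adjoint_functors_tensor[OF dual_pair_K_regular[OF this]]
  show "adjoint_functors A (sub_structure A B)
      (tensor A (shift (sub_structure A B) (l\<^sub>B - l\<^sub>A, p\<^sub>B + p\<^sub>A) (twisted_bimodule A \<psi>\<^sub>B \<psi>\<^sub>A))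
        :: ('l, 'a, 'n) gmodule \<Rightarrow> ('l, 'a, ('a \<times> 'n \<Rightarrow>\<^sub>0 int) set) gmodule)
      (tensor_map A (shift (sub_structure A B) (l\<^sub>B - l\<^sub>A, p\<^sub>B + p\<^sub>A) (twisted_bimodule A \<psi>\<^sub>B \<psi>\<^sub>A)))
      (tensor (sub_structure A B) (regular_bimodule A)
        :: ('l, 'a, 'm) gmodule \<Rightarrow> ('l, 'a, ('a \<times> 'm \<Rightarrow>\<^sub>0 int) set) gmodule)
      (tensor_map (sub_structure A B) (regular_bimodule A))"
    unfolding \<delta>_def .
qed

end
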